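(* Let $(\Omega,\mathcal{A},\mu,\mathcal{R},\alpha)$ be a computable measure space with $\mu(\Omega)=\infty$, with $(C_n)$, $(D_n)$, $\widetilde{\mu}$ and $\delta_{\widetilde{\mu}}$ as in the context. Then: (1) $\widetilde{\mu}$ is $(\delta_{\widetilde{\mu}},\rho)$-computable; (2) $\mu$ is $(\delta_{\widetilde{\mu}},\overline{\rho}_<)$-computable; (3) $(A,n)\mapsto\mu(A\cap C_n)$ is $(\delta_{\widetilde{\mu}},\nu_{\mathbb{N}},\rho)$-computable; (4) each set-theoretical operation (union $(A,B)\mapsto A\cup B$, intersection $(A,B)\mapsto A\cap B$, difference $(A,B)\mapsto A\setminus B$, complement $A\mapsto\Omega\setminus A$) is computable w.r.t. $\delta_{\widetilde{\mu}}$ on all of $\mathcal{A}$.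
   Context: Let $\Sigma$ be a finite alphabet with $\{0,1\}\subseteq\Sigma$, $\Sigma^*$ the finite and $\Sigma^\omega$ the infinite strings over $\Sigma$. A partial string function is computable if it is computed by a Type-2 Turing machine (one-way output tape; infinite outputs written forever). A naming system of a set $X$ is a surjective partial multi-valued map $\delta:\subseteq W\rightrightarrows X$, $W\in\{\Sigma^*,\Sigma^\omega\}$ (notation if $W=\Sigma^*$, multi-representation if $W=\Sigma^\omega$); $p$ is a $\delta$-name of $x$ if $x\in\delta(p)$. For naming systems $\delta_1,\dots,\delta_k$ of $X_1,\dots,X_k$ and $\gamma$ of $Y$, a multi-function $f:\subseteq X_1\times\dots\times X_k\rightrightarrows Y$ is $(\delta_1,\dots,\delta_k,\gamma)$-computable if some computable string function $F$ satisfies $f(x_1,\dots,x_k)\cap\gamma(F(p_1,\dots,p_k))\neq\emptyset$ whenever $p_i$ is a $\delta_i$-name of $x_i$ and $(x_1,\dots,x_k)\in\mathrm{dom}(f)$; "computable w.r.t. $\delta$" means all naming systems are $\delta$. $\nu_{\mathbb{N}}$ is the standard notation of $\mathbb{N}$, $\rho$ the standard representation of $\mathbb{R}$, and $\overline{\rho}_<$ the standard lower representation of $\overline{\mathbb{R}}=\mathbb{R}\cup\{-\infty,\infty\}$ (a name of $x$ encodes an enumeration of all rationals $q<x$). A computable measure space is a quintuple $(\Omega,\mathcal{A},\mu,\mathcal{R},\alpha)$ with $(\Omega,\mathcal{A},\mu)$ a measure space, $\mathcal{R}$ a countable ring of subsets of $\Omega$ with $\sigma(\mathcal{R})=\mathcal{A}$,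 $\alpha:\subseteq\Sigma^*\to\mathcal{R}$ a notation of $\mathcal{R}$ with recursive domain, $\mu$ on $\mathcal{R}$ $(\alpha,\rho)$-computable, and union and difference on $\mathcal{R}$ computable w.r.t. $\alpha$. Assume $\mu(\Omega)=\infty$ and fix sequences $(C_n)_{n\ge1},(D_n)_{n\ge1}$ in $\mathcal{R}$ with $n\mapsto C_n$ $(\nu_{\mathbb{N}},\alpha)$-computable, $C_n\subseteq C_{n+1}$, $\bigcup_nC_n=\Omega$, the multi-function $E\mapsto\{n:E\subseteq C_n\}$ $(\alpha,\nu_{\mathbb{N}})$-computable, and, with $C_0:=\emptyset$, $D_n=C_n\setminus C_{n-1}$ and $\mu(D_n)\ge 2^n$. $A\bigtriangleup B$ is the symmetric difference; $\langle\cdot\rangle$ is the standard tupling function encoding a sequence of strings as one infinite string. Define the probability measure $\widetilde{\mu}(A)=\sum_{n=1}^\infty\frac{\mu(A\cap D_n)}{\mu(D_n)}2^{-n}$ for $A\in\mathcal{A}$. The multi-representation $\delta_{\widetilde{\mu}}:\subseteq\Sigma^\omega\rightrightarrows\mathcal{A}$: $A\in\delta_{\widetilde{\mu}}\langle w_1,w_2,\ldots\rangle$ iff, with $A_n:=\alpha(w_n)$, $\lim_n\widetilde{\mu}(A_n\bigtriangleup A)=0$ and $\widetilde{\mu}(A_n\bigtriangleup A_m)\le 2^{-n}$ for all $n<m$. *)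

theory Defs
  imports "HOL-Analysis.Analysis"
begin

text \<open>
  The alphabet is any type \<open>'s :: {finite, zero_neq_one}\<close>: a finite set with two distinct
  distinguished symbols \<open>0\<close> and \<open>1\<close>.
\<close>

section \<open>Type-2 Turing machines\<close>

datatype 's str = Fin "'s list" | Inf "nat \<Rightarrow> 's"

datatype kind = Finite_Str | Infinite_Str

fun of_kind :: "kind \<Rightarrow> 's str \<Rightarrow> bool" where
  "of_kind Finite_Str (Fin _) = True"
| "of_kind Infinite_Str (Inf _) = True"
| "of_kind _ _ = False"

text \<open>
  Tape symbols: the blank, the symbols of the alphabet, and auxiliary work symbols. As a program
  is a finite list of instructions, it can only mention finitely many auxiliary symbols, work
  tapes and control states.
\<close>

datatype 's sym = Blank | Sym 's | Aux nat

text \<open>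
  Machines are flowcharts whose nodes are numbered by list positions; control moves on to the next
  position except after a test, which names both successors. Reaching a position outside the list
  is halting. The instruction set makes the input tapes one-way and read-only and the output tape
  one-way and write-only; work tapes are two-way.
\<close>

datatype 's instr =
    Emit 's
  | In_Right nat
  | In_Test nat "'s sym" nat nat
  | Work_Left nat
  | Work_Right nat
  | Work_Write nat "'s sym"
  | Work_Test nat "'s sym" nat nat

record 's machine =
  in_kinds :: "kind list"
  out_kind :: kind
  prog :: "'s instr list"

record 's config =
  pc :: nat
  in_pos :: "nat \<Rightarrow> nat"
  work_pos :: "nat \<Rightarrow> int"
  work :: "nat \<Rightarrow> int \<Rightarrow> 's sym"
  outp :: "'s list"

definition init_config :: "'s config" where
  "init_config = \<lparr>pc = 0, in_pos = (\<lambda>_. 0), work_pos = (\<lambda>_. 0), work = (\<lambda>_ _. Blank), outp = []\<rparr>"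

fun str_cell :: "'s str \<Rightarrow> nat \<Rightarrow> 's sym" where
  "str_cell (Fin w) n = (if n < length w then Sym (w ! n) else Blank)"
| "str_cell (Inf p) n = Sym (p n)"

text \<open>Tests on an input tape that does not exist see a blank.\<close>

definition in_cell :: "'s str list \<Rightarrow> nat \<Rightarrow> nat \<Rightarrow> 's sym" where
  "in_cell ps i n = (if i < length ps then str_cell (ps ! i) n else Blank)"

fun exec_instr :: "'s str list \<Rightarrow> 's instr \<Rightarrow> 's config \<Rightarrow> 's config" where
  "exec_instr ps (Emit a) c = c\<lparr>pc := Suc (pc c), outp := outp c @ [a]\<rparr>"
| "exec_instr ps (In_Right i) c =
     c\<lparr>pc := Suc (pc c), in_pos := (in_pos c)(i := Suc (in_pos c i))\<rparr>"
| "exec_instr ps (In_Test i a l l') c =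
     c\<lparr>pc := (if in_cell ps i (in_pos c i) = a then l else l')\<rparr>"
| "exec_instr ps (Work_Left i) c =
     c\<lparr>pc := Suc (pc c), work_pos := (work_pos c)(i := work_pos c i - 1)\<rparr>"
| "exec_instr ps (Work_Right i) c =
     c\<lparr>pc := Suc (pc c), work_pos := (work_pos c)(i := work_pos c i + 1)\<rparr>"
| "exec_instr ps (Work_Write i a) c =
     c\<lparr>pc := Suc (pc c), work := (work c)(i := (work c i)(work_pos c i := a))\<rparr>"
| "exec_instr ps (Work_Test i a l l') c =
     c\<lparr>pc := (if work c i (work_pos c i) = a then l else l')\<rparr>"

definition halted :: "'s instr list \<Rightarrow> 's config \<Rightarrow> bool" where
  "halted P c \<longleftrightarrow> pc c \<ge> length P"

definition step :: "'s instr list \<Rightarrow> 's str list \<Rightarrow> 's config \<Rightarrow> 's config" where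
  "step P ps c = (if halted P c then c else exec_instr ps (P ! pc c) c)"

definition config_at :: "'s instr list \<Rightarrow> 's str list \<Rightarrow> nat \<Rightarrow> 's config" where
  "config_at P ps t = (step P ps ^^ t) init_config"

text \<open>
  A finite result must be on the output tape when the machine halts; an infinite result must be
  written symbol by symbol by a machine that runs forever.
\<close>

fun writes :: "'s instr list \<Rightarrow> 's str list \<Rightarrow> 's str \<Rightarrow> bool" where
  "writes P ps (Fin w) \<longleftrightarrow> (\<exists>t. halted P (config_at P ps t) \<and> outp (config_at P ps t) = w)"
| "writes P ps (Inf q) \<longleftrightarrow>
     (\<forall>t. \<not> halted P (config_at P ps t)) \<and>
     (\<forall>n. \<exists>t. n < length (outp (config_at P ps t)) \<and> outp (config_at P ps t) ! n = q n)"

definition computes :: "'s machine \<Rightarrow> 's str list \<Rightarrow> 's str \<Rightarrow> bool" where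
  "computes T ps q \<longleftrightarrow>
     list_all2 of_kind (in_kinds T) ps \<and> of_kind (out_kind T) q \<and> writes (prog T) ps q"

definition computable_string_fun :: "('s str list \<rightharpoonup> 's str) \<Rightarrow> bool" where
  "computable_string_fun F \<longleftrightarrow> (\<exists>T. \<forall>ps q. F ps = Some q \<longleftrightarrow> computes T ps q)"

definition recursive_set :: "('s::zero_neq_one) list set \<Rightarrow> bool" where
  "recursive_set L \<longleftrightarrow> (\<exists>F. computable_string_fun F \<and>
     (\<forall>w. F [Fin w] = Some (Fin (if w \<in> L then [1] else [0]))))"


section \<open>Naming systems and relative computability\<close>

text \<open>
  A naming system maps each string to the set of objects it names, the empty set for strings
  outside its domain. Likewise a partial multi-function maps to the set of admissible results and
  its domain consists of the points with nonempty result.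
\<close>

type_synonym ('s, 'x) naming = "'s str \<Rightarrow> 'x set"

definition notation_of :: "('s list \<rightharpoonup> 'x) \<Rightarrow> ('s, 'x) naming" where
  "notation_of \<alpha> p = (case p of Fin w \<Rightarrow> set_option (\<alpha> w) | Inf _ \<Rightarrow> {})"

definition computable1 ::
    "('s, 'x) naming \<Rightarrow> ('s, 'y) naming \<Rightarrow> ('x \<Rightarrow> 'y set) \<Rightarrow> bool" where
  "computable1 \<delta> \<gamma> f \<longleftrightarrow> (\<exists>F. computable_string_fun F \<and>
     (\<forall>p x. x \<in> \<delta> p \<and> f x \<noteq> {} \<longrightarrow> (\<exists>q. F [p] = Some q \<and> f x \<inter> \<gamma> q \<noteq> {})))"

definition computable2 ::
    "('s, 'x1) naming \<Rightarrow> ('s, 'x2) naming \<Rightarrow> ('s, 'y) naming \<Rightarrow> ('x1 \<Rightarrow> 'x2 \<Rightarrow> 'y set) \<Rightarrow> bool" where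
  "computable2 \<delta>1 \<delta>2 \<gamma> f \<longleftrightarrow> (\<exists>F. computable_string_fun F \<and>
     (\<forall>p1 p2 x1 x2. x1 \<in> \<delta>1 p1 \<and> x2 \<in> \<delta>2 p2 \<and> f x1 x2 \<noteq> {} \<longrightarrow>
        (\<exists>q. F [p1, p2] = Some q \<and> f x1 x2 \<inter> \<gamma> q \<noteq> {})))"

text \<open>Single-valued functions with domain \<open>X\<close>, respectively \<open>X \<times> Y\<close>, as multi-functions.\<close>

definition fun_on :: "'x set \<Rightarrow> ('x \<Rightarrow> 'y) \<Rightarrow> 'x \<Rightarrow> 'y set" where
  "fun_on X f x = (if x \<in> X then {f x} else {})"

definition fun_on2 :: "'x set \<Rightarrow> 'y set \<Rightarrow> ('x \<Rightarrow> 'y \<Rightarrow> 'z) \<Rightarrow> 'x \<Rightarrow> 'y \<Rightarrow> 'z set" where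
  "fun_on2 X Y f x y = (if x \<in> X \<and> y \<in> Y then {f x y} else {})"


section \<open>Standard naming systems\<close>

text \<open>
  Weihrauch's wrapping \<open>\<iota>(a\<^sub>1\<dots>a\<^sub>n) = 110a\<^sub>10a\<^sub>20\<dots>a\<^sub>n011\<close>. Finite and infinite tuples of words
  are concatenations of wrapped words.
\<close>

definition wrap :: "('s::zero_neq_one) list \<Rightarrow> 's list" where
  "wrap w = [1, 1, 0] @ concat (map (\<lambda>a. [a, 0]) w) @ [1, 1]"

text \<open>Every wrapped word is nonempty, so the first \<open>n + 1\<close> components determine position \<open>n\<close>.\<close>

definition seq_tuple :: "(nat \<Rightarrow> ('s::zero_neq_one) list) \<Rightarrow> nat \<Rightarrow> 's" where
  "seq_tuple v n = concat (map (\<lambda>i. wrap (v i)) [0..<Suc n]) ! n"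

definition occurs_in :: "'s list \<Rightarrow> (nat \<Rightarrow> 's) \<Rightarrow> bool" where
  "occurs_in u p \<longleftrightarrow> (\<exists>i. \<forall>j<length u. p (i + j) = u ! j)"

text \<open>Binary notation, most significant digit first, without leading zeros.\<close>

definition nat_word :: "('s::zero_neq_one) list \<rightharpoonup> nat" where
  "nat_word w = (if w = [0] \<or> (\<exists>v. w = 1 # v \<and> set v \<subseteq> {0, 1})
     then Some (horner_sum of_bool 2 (map (\<lambda>a. a = 1) (rev w))) else None)"

definition nu_nat :: "('s::zero_neq_one, nat) naming" where
  "nu_nat = notation_of nat_word"

text \<open>
  The word \<open>\<langle>u, v, w\<rangle>\<close> denotes the rational \<open>(\<nu>(u) - \<nu>(v)) / \<nu>(w)\<close>, where \<open>\<nu>(w) \<noteq> 0\<close>. The sets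
  \<open>rat_word w\<close> and \<open>interval_word w\<close> have at most one element.
\<close>

definition rat_word :: "('s::zero_neq_one) list \<Rightarrow> rat set" where
  "rat_word x = {(of_nat i - of_nat j) / of_nat k | i j k u v w.
     x = wrap u @ wrap v @ wrap w \<and>
     nat_word u = Some i \<and> nat_word v = Some j \<and> nat_word w = Some k \<and> k \<noteq> 0}"

definition interval_word :: "('s::zero_neq_one) list \<Rightarrow> (rat \<times> rat) set" where
  "interval_word x = {(a, b) | a b u v.
     x = wrap u @ wrap v \<and> a \<in> rat_word u \<and> b \<in> rat_word v}"

text \<open>
  Enumerations list wrapped words at arbitrary positions of the infinite string, so that also the
  empty set can be enumerated.
\<close>

definition enumerates :: "(('s::zero_neq_one) list \<Rightarrow> 'x set) \<Rightarrow> (nat \<Rightarrow> 's) \<Rightarrow> 'x set \<Rightarrow> bool" where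
  "enumerates \<nu> p S \<longleftrightarrow>
     (\<forall>w. occurs_in (wrap w) p \<longrightarrow> \<nu> w \<noteq> {}) \<and> (\<Union>w\<in>{w. occurs_in (wrap w) p}. \<nu> w) = S"

text \<open>A name of a real number enumerates all open rational intervals that contain it.\<close>

definition rho :: "('s::zero_neq_one, real) naming" where
  "rho p = (case p of Fin _ \<Rightarrow> {} | Inf p' \<Rightarrow>
     {x. enumerates interval_word p' {(a, b). of_rat a < x \<and> x < of_rat b}})"

definition rho_lower :: "('s::zero_neq_one, ereal) naming" where
  "rho_lower p = (case p of Fin _ \<Rightarrow> {} | Inf p' \<Rightarrow>
     {x. enumerates rat_word p' {q. ereal (of_rat q) < x}})"


section \<open>Computable measure spaces\<close>

locale computable_measure_space =
  fixes M :: "'a measure"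
    and R :: "'a set set"
    and \<alpha> :: "('s::{finite, zero_neq_one}) list \<rightharpoonup> 'a set"
  assumes ring: "ring_of_sets (space M) R"
    and countable: "countable R"
    and generates: "sigma_sets (space M) R = sets M"
    and notation_onto: "ran \<alpha> = R"
    and recursive_dom: "recursive_set (dom \<alpha>)"
    and finite_on_ring: "\<And>E. E \<in> R \<Longrightarrow> emeasure M E \<noteq> \<infinity>"
    and measure_computable: "computable1 (notation_of \<alpha>) rho (fun_on R (measure M))"
    and union_computable:
      "computable2 (notation_of \<alpha>) (notation_of \<alpha>) (notation_of \<alpha>) (fun_on2 R R (\<union>))"
    and diff_computable:
      "computable2 (notation_of \<alpha>) (notation_of \<alpha>) (notation_of \<alpha>) (fun_on2 R R (-))"

text \<open>
  The sequences \<open>C\<close> and \<open>D\<close> are indexed from \<open>1\<close>, with \<open>C 0 = {}\<close> as a convention; \<open>D 0\<close> is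
  irrelevant.
\<close>

locale infinite_computable_measure_space =
  computable_measure_space M R \<alpha>
  for M :: "'a measure"
    and R :: "'a set set"
    and \<alpha> :: "('s::{finite, zero_neq_one}) list \<rightharpoonup> 'a set" +
  fixes C D :: "nat \<Rightarrow> 'a set"
  assumes infinite_measure: "emeasure M (space M) = \<infinity>"
    and C_0: "C 0 = {}"
    and C_in_ring: "\<And>n. n \<ge> 1 \<Longrightarrow> C n \<in> R"
    and D_in_ring: "\<And>n. n \<ge> 1 \<Longrightarrow> D n \<in> R"
    and C_computable: "computable1 nu_nat (notation_of \<alpha>) (fun_on {1..} C)"
    and C_mono: "\<And>n. n \<ge> 1 \<Longrightarrow> C n \<subseteq> C (Suc n)"
    and C_exhausts: "(\<Union>n\<in>{1..}. C n) = space M"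
    and cover_computable:
      "computable1 (notation_of \<alpha>) nu_nat (\<lambda>E. if E \<in> R then {n. n \<ge> 1 \<and> E \<subseteq> C n} else {})"
    and D_eq: "\<And>n. n \<ge> 1 \<Longrightarrow> D n = C n - C (n - 1)"
    and D_large: "\<And>n. n \<ge> 1 \<Longrightarrow> measure M (D n) \<ge> 2 ^ n"

text \<open>The summation index is shifted by one.\<close>

definition mu_tilde :: "'a measure \<Rightarrow> (nat \<Rightarrow> 'a set) \<Rightarrow> 'a set \<Rightarrow> real" where
  "mu_tilde M D A =
     (\<Sum>n. measure M (A \<inter> D (Suc n)) / measure M (D (Suc n)) * (1 / 2) ^ Suc n)"

text \<open>The words \<open>w\<close> are indexed from \<open>1\<close>.\<close>

definition delta_mu_tilde ::
    "'a measure \<Rightarrow> (('s::zero_neq_one) list \<rightharpoonup> 'a set) \<Rightarrow> (nat \<Rightarrow> 'a set) \<Rightarrow> ('s, 'a set) naming" where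
  "delta_mu_tilde M \<alpha> D p = {A. A \<in> sets M \<and>
     (\<exists>w E. p = Inf (seq_tuple (\<lambda>i. w (Suc i))) \<and>
        (\<forall>n\<ge>1. \<alpha> (w n) = Some (E n)) \<and>
        (\<lambda>n. mu_tilde M D (sym_diff (E n) A)) \<longlonglongrightarrow> 0 \<and>
        (\<forall>n m. 1 \<le> n \<and> n < m \<longrightarrow> mu_tilde M D (sym_diff (E n) (E m)) \<le> (1 / 2) ^ n))}"

end

(*
  A computable function is described by a primitive recursive test on numbers, and every partial
  result that is searched for is replaced by a certificate that is guessed. Counter programs, whose
  counters are head positions on work tapes, execute primitive recursive functions on a machine;
  conversely the run of a given machine on finite words is primitive recursive. Hence a machine can
  enumerate, and write in any required order, everything that is recursively enumerable in the
  symbols read so far, so that only enumerability has to be checked.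

  A nonnegative real x is represented by the pairs (i, j) with i < x j and those with x j < i.
  Writing A_n for the n-th set of a name of A, the measures of A_n \<inter> D_k and D_k give the cuts of the
  partial sums of the series of A_n, which differ from the value at A by at most 2 / 2^n. On C_n the
  measure is bounded by \<mu>(C_n) 2^n times the new one, which gives the cuts of \<mu>(A \<inter> C_n), and \<mu>(A) is
  their supremum. The set operations are done component by component after a shift by one,
  complements as C_{n+1} - A_{n+1}, since the complement of C_n has new measure at most 2^-n.
*)

theory Submission
  imports Defs "HOL-Library.Nat_Bijection"
begin

text \<open>The machines supplied by the hypotheses take only finite words as input, so no run on an
  infinite input has to be simulated; infinite names enter only as a growing buffer of symbols read.
  The supplied machines may run forever on words outside the domains of the notations, so a direct
  call could block; testing a guessed number of steps never does. Every output wanted is a list of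
  wrapped words, whether it names a measurable set, a real or an extended real, so one kind of
  machine, looping forever over numbered candidates, serves all statements. Such a machine must find
  some word for every position, so an enumeration is filled up with arbitrary admissible words
  instead of padding. Comparison of reals is undecidable, and equality of reals is never tested: a
  real is used only through strict inequalities with rationals, each of which has a finite
  certificate if it is true. The words found in this way are not unique. The ring operations are
  therefore treated as relations between words, and each step has to show that its outcome does not
  depend on the words chosen.\<close>

lemma funpow_eq_add: "(f ^^ (m + n)) x = (f ^^ n) ((f ^^ m) x)"
  by (induction n) auto

section \<open>Runs of a machine: halting is final and the output only grows\<close>

lemma config_at_Suc: "config_at P ps (Suc t) = step P ps (config_at P ps t)"
  by (simp add: config_at_def)

lemma halted_mono: "halted P (config_at P ps t) \<Longrightarrow> t \<le> t' \<Longrightarrow> config_at P ps t' = config_at P ps t"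
proof (induction t' rule: nat_induct)
  case (Suc n)
  then show ?case by (cases "t = Suc n") (auto simp: config_at_Suc step_def)
qed auto

lemma outp_exec_prefix: "\<exists>u. outp (exec_instr ps a c) = outp c @ u"
  by (cases a) auto

lemma outp_step_prefix: "\<exists>u. outp (step P ps c) = outp c @ u"
  by (simp add: step_def outp_exec_prefix)

lemma outp_mono:
  assumes "t \<le> t'" shows "\<exists>u. outp (config_at P ps t') = outp (config_at P ps t) @ u"
  using assms
proof (induction t' rule: dec_induct)
  case (step n)
  then show ?case using outp_step_prefix[of P ps "config_at P ps n"] by (auto simp: config_at_Suc)
qed auto

lemma outp_nth_mono:
  assumes "n < length (outp (config_at P ps t))" "n < length (outp (config_at P ps t'))"
  shows "outp (config_at P ps t) ! n = outp (config_at P ps t') ! n"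
proof (cases "t \<le> t'")
  case True
  with outp_mono[OF True, of P ps] assms show ?thesis by (auto simp: nth_append)
next
  case False
  then have "t' \<le> t" by simp
  with outp_mono[OF this, of P ps] assms show ?thesis by (auto simp: nth_append)
qed

text \<open>Two halting times yield the same configuration by \<open>halted_mono\<close>, and a
  symbol once written stays by \<open>outp_nth_mono\<close>. Hence a machine determines a partial
  function.\<close>

lemma computes_unique:
  assumes "computes T ps q" "computes T ps q'" shows "q = q'"
proof (cases "out_kind T")
  case Finite_Str
  with assms obtain w w' where [simp]: "q = Fin w" "q' = Fin w'"
    by (cases q; cases q'; auto simp: computes_def)
  from assms obtain t t' where t: "halted (prog T) (config_at (prog T) ps t)" "outp (config_at (prog T) ps t) = w"
    "halted (prog T) (config_at (prog T) ps t')" "outp (config_at (prog T) ps t') = w'"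
    by (auto simp: computes_def)
  then show ?thesis
    using halted_mono[OF t(1), of t'] halted_mono[OF t(3), of t] by (cases "t \<le> t'") auto
next
  case Infinite_Str
  with assms obtain w w' where [simp]: "q = Inf w" "q' = Inf w'"
    by (cases q; cases q'; auto simp: computes_def)
  have "w n = w' n" for n
    using assms outp_nth_mono[of n "prog T" ps] by (auto simp: computes_def) metis
  then show ?thesis by auto
qed

definition string_fun :: "'s machine \<Rightarrow> 's str list \<rightharpoonup> 's str" where
  "string_fun T ps = (if \<exists>q. computes T ps q then Some (THE q. computes T ps q) else None)"

lemma string_fun_iff: "string_fun T ps = Some q \<longleftrightarrow> computes T ps q"
  unfolding string_fun_def using computes_unique[of T ps] by (auto intro: the_equality theI)

lemma computable_string_fun_string_fun: "computable_string_fun (string_fun T)"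
  unfolding computable_string_fun_def using string_fun_iff by blast

section \<open>Counter programs\<close>

datatype 's com =
    Skip
  | Inc nat
  | Dec nat
  | Put 's
  | Move nat
  | Seq "'s com" "'s com"
  | Loop nat "'s com"
  | IfNZ nat "'s com" "'s com"
  | IfSym nat 's "'s com" "'s com"

type_synonym 's state = "(nat \<Rightarrow> nat) \<times> (nat \<Rightarrow> nat) \<times> 's list"

text \<open>Only terminating runs are related; the single endless loop is added separately in
  \<open>forever_prog\<close>. \<open>Dec\<close> has no transition at 0, because the head would
  move to the left of the marked cell.\<close>

inductive exec :: "'s str list \<Rightarrow> 's com \<Rightarrow> 's state \<Rightarrow> 's state \<Rightarrow> bool" for ps where
  Skip: "exec ps Skip s s"
| Inc: "exec ps (Inc i) (v, h, out) (v(i := Suc (v i)), h, out)"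
| Dec: "v i > 0 \<Longrightarrow> exec ps (Dec i) (v, h, out) (v(i := v i - 1), h, out)"
| Put: "exec ps (Put a) (v, h, out) (v, h, out @ [a])"
| Move: "exec ps (Move j) (v, h, out) (v, h(j := Suc (h j)), out)"
| Seq: "exec ps c1 s s' \<Longrightarrow> exec ps c2 s' s'' \<Longrightarrow> exec ps (Seq c1 c2) s s''"
| Loop_End: "fst s i = 0 \<Longrightarrow> exec ps (Loop i c) s s"
| Loop_Step: "fst s i > 0 \<Longrightarrow> exec ps c s s' \<Longrightarrow> exec ps (Loop i c) s' s'' \<Longrightarrow> exec ps (Loop i c) s s''"
| IfNZ_True: "fst s i > 0 \<Longrightarrow> exec ps c1 s s' \<Longrightarrow> exec ps (IfNZ i c1 c2) s s'"
| IfNZ_False: "fst s i = 0 \<Longrightarrow> exec ps c2 s s' \<Longrightarrow> exec ps (IfNZ i c1 c2) s s'"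
| IfSym_True: "in_cell ps j (fst (snd s) j) = Sym a \<Longrightarrow> exec ps c1 s s' \<Longrightarrow> exec ps (IfSym j a c1 c2) s s'"
| IfSym_False: "in_cell ps j (fst (snd s) j) \<noteq> Sym a \<Longrightarrow> exec ps c2 s s' \<Longrightarrow> exec ps (IfSym j a c1 c2) s s'"

primrec reg_bound :: "'s com \<Rightarrow> nat" where
  "reg_bound Skip = 0"
| "reg_bound (Inc i) = Suc i"
| "reg_bound (Dec i) = Suc i"
| "reg_bound (Put a) = 0"
| "reg_bound (Move j) = 0"
| "reg_bound (Seq c1 c2) = max (reg_bound c1) (reg_bound c2)"
| "reg_bound (Loop i c) = max (Suc i) (reg_bound c)"
| "reg_bound (IfNZ i c1 c2) = max (Suc i) (max (reg_bound c1) (reg_bound c2))"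
| "reg_bound (IfSym j a c1 c2) = max (reg_bound c1) (reg_bound c2)"

abbreviation (input) jump :: "nat \<Rightarrow> 's instr" where
  "jump l \<equiv> Work_Test 0 Blank l l"

primrec code_len :: "'s com \<Rightarrow> nat" where
  "code_len Skip = 0"
| "code_len (Inc i) = 1"
| "code_len (Dec i) = 1"
| "code_len (Put a) = 1"
| "code_len (Move j) = 1"
| "code_len (Seq c1 c2) = code_len c1 + code_len c2"
| "code_len (Loop i c) = code_len c + 2"
| "code_len (IfNZ i c1 c2) = code_len c1 + code_len c2 + 2"
| "code_len (IfSym j a c1 c2) = code_len c1 + code_len c2 + 2"

text \<open>
  A counter \<open>i\<close> is the position of the head on work tape \<open>i\<close>, whose cell \<open>0\<close> is marked by \<open>Aux 0\<close>.
\<close>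

primrec code :: "nat \<Rightarrow> 's com \<Rightarrow> 's instr list" where
  "code l Skip = []"
| "code l (Inc i) = [Work_Right i]"
| "code l (Dec i) = [Work_Left i]"
| "code l (Put a) = [Emit a]"
| "code l (Move j) = [In_Right j]"
| "code l (Seq c1 c2) = code l c1 @ code (l + code_len c1) c2"
| "code l (Loop i c) =
     [Work_Test i (Aux 0) (l + code_len c + 2) (Suc l)] @ code (Suc l) c @ [jump l]"
| "code l (IfNZ i c1 c2) =
     [Work_Test i (Aux 0) (l + code_len c1 + 2) (Suc l)] @ code (Suc l) c1 @
     [jump (l + code_len c1 + code_len c2 + 2)] @ code (l + code_len c1 + 2) c2"
| "code l (IfSym j a c1 c2) =
     [In_Test j (Sym a) (Suc l) (l + code_len c1 + 2)] @ code (Suc l) c1 @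
     [jump (l + code_len c1 + code_len c2 + 2)] @ code (l + code_len c1 + 2) c2"

lemma length_code [simp]: "length (code l c) = code_len c"
  by (induction c arbitrary: l) auto

text \<open>The tape contents stay fixed once the \<open>K\<close> marks are written; the whole
  state of the counters lies in the head positions.\<close>

definition conc :: "nat \<Rightarrow> nat \<Rightarrow> 's state \<Rightarrow> 's config" where
  "conc K l s = \<lparr>pc = l, in_pos = fst (snd s), work_pos = (\<lambda>i. int (fst s i)),
     work = (\<lambda>i z. if i < K \<and> z = 0 then Aux 0 else Blank), outp = snd (snd s)\<rparr>"

definition reach :: "'s instr list \<Rightarrow> 's str list \<Rightarrow> 's config \<Rightarrow> 's config \<Rightarrow> bool" where
  "reach P ps c c' \<longleftrightarrow> (\<exists>n. (step P ps ^^ n) c = c')"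

lemma reach_refl: "reach P ps c c"
  unfolding reach_def by (rule exI[of _ 0]) simp

lemma reach_trans: "reach P ps c c' \<Longrightarrow> reach P ps c' c'' \<Longrightarrow> reach P ps c c''"
  unfolding reach_def by (metis funpow_eq_add)

lemma reach_step: "step P ps c = c' \<Longrightarrow> reach P ps c c'"
  unfolding reach_def by (rule exI[of _ 1]) simp

definition code_at :: "'s instr list \<Rightarrow> nat \<Rightarrow> 's instr list \<Rightarrow> bool" where
  "code_at P l Q \<longleftrightarrow> (\<exists>pre post. P = pre @ Q @ post \<and> length pre = l)"

lemma code_at_Cons: "code_at P l (a # Q) \<longleftrightarrow> l < length P \<and> P ! l = a \<and> code_at P (Suc l) Q"
proof
  assume "code_at P l (a # Q)"
  then obtain pre post where "P = pre @ (a # Q) @ post" "length pre = l" by (auto simp: code_at_def)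
  then have "P = (pre @ [a]) @ Q @ post" "length (pre @ [a]) = Suc l" "P ! l = a" "l < length P" by auto
  then show "l < length P \<and> P ! l = a \<and> code_at P (Suc l) Q" unfolding code_at_def by blast
next
  assume *: "l < length P \<and> P ! l = a \<and> code_at P (Suc l) Q"
  then obtain pre post where p: "P = pre @ Q @ post" "length pre = Suc l" by (auto simp: code_at_def)
  then have "pre = take l pre @ [pre ! l]" by (metis lessI take_Suc_conv_app_nth take_all_iff order_refl)
  moreover have "pre ! l = a" using * p by (auto simp: nth_append)
  ultimately have "P = take l pre @ (a # Q) @ post" "length (take l pre) = l" using p
    by (metis append.assoc append_Cons append_Nil, simp)
  then show "code_at P l (a # Q)" unfolding code_at_def by blast
qed

lemma code_at_append: "code_at P l (Q @ Q') \<Longrightarrow> code_at P l Q \<and> code_at P (l + length Q) Q'"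
proof -
  assume "code_at P l (Q @ Q')"
  then obtain pre post where p: "P = pre @ (Q @ Q') @ post" "length pre = l" by (auto simp: code_at_def)
  then have "P = pre @ Q @ (Q' @ post)" "P = (pre @ Q) @ Q' @ post" "length (pre @ Q) = l + length Q" by auto
  then show ?thesis unfolding code_at_def using p(2) by blast
qed

lemma reach_instr:
  assumes "l < length P" "P ! l = a" "exec_instr ps a (conc K l s) = c'"
  shows "reach P ps (conc K l s) c'"
  by (rule reach_step) (use assms in \<open>simp add: step_def halted_def conc_def\<close>)

text \<open>The address \<open>l\<close> is arbitrary because the jump targets in
  \<open>code l c\<close> are absolute, so each subprogram is compiled for its own address.\<close>

lemma reach_code:
  assumes "exec ps c s s'" "reg_bound c \<le> K" "code_at P l (code l c)"
  shows "reach P ps (conc K l s) (conc K (l + code_len c) s')"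
  using assms
proof (induction arbitrary: l rule: exec.induct)
  case (Skip s)
  then show ?case by (simp add: reach_refl)
next
  case (Inc i v h out)
  then show ?case
    by (intro reach_instr[where a = "Work_Right i"]) (auto simp: code_at_Cons conc_def fun_eq_iff)
next
  case (Dec v i h out)
  then show ?case
    by (intro reach_instr[where a = "Work_Left i"]) (auto simp: code_at_Cons conc_def fun_eq_iff)
next
  case (Put a v h out)
  then show ?case
    by (intro reach_instr[where a = "Emit a"]) (auto simp: code_at_Cons conc_def fun_eq_iff)
next
  case (Move j v h out)
  then show ?case
    by (intro reach_instr[where a = "In_Right j"]) (auto simp: code_at_Cons conc_def fun_eq_iff)
next
  case (Seq c1 s s' c2 s'')
  from Seq.prems have "code_at P l (code l c1)" "code_at P (l + code_len c1) (code (l + code_len c1) c2)"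
    by (auto dest!: code_at_append)
  then have "reach P ps (conc K l s) (conc K (l + code_len c1) s')"
    "reach P ps (conc K (l + code_len c1) s') (conc K (l + code_len c1 + code_len c2) s'')"
    using Seq by auto
  then show ?case by (auto dest: reach_trans simp: add.assoc)
next
  case (Loop_End s i c)
  then show ?case
    by (intro reach_instr[where a = "Work_Test i (Aux 0) (l + code_len c + 2) (Suc l)"])
      (auto simp: code_at_Cons conc_def fun_eq_iff)
next
  case (Loop_Step s i c s' s'')
  then have a: "l < length P" "P ! l = Work_Test i (Aux 0) (l + code_len c + 2) (Suc l)"
    "code_at P (Suc l) (code (Suc l) c)" "Suc l + code_len c < length P" "P ! (Suc l + code_len c) = jump l"
    by (auto simp: code_at_Cons dest!: code_at_append)
  have "reach P ps (conc K l s) (conc K (Suc l) s)"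
    by (rule reach_instr[OF a(1,2)]) (use Loop_Step.hyps in \<open>auto simp: conc_def\<close>)
  moreover have "reach P ps (conc K (Suc l) s) (conc K (Suc l + code_len c) s')"
    using Loop_Step.prems a by (intro Loop_Step.IH(1)) auto
  moreover have "reach P ps (conc K (Suc l + code_len c) s') (conc K l s')"
    by (rule reach_instr[OF a(4,5)]) (auto simp: conc_def)
  moreover have "reach P ps (conc K l s') (conc K (l + code_len (Loop i c)) s'')"
    using Loop_Step.prems by (intro Loop_Step.IH(2)) auto
  ultimately show ?case by (meson reach_trans)
next
  case (IfNZ_True s i c1 s' c2)
  then have a: "l < length P" "P ! l = Work_Test i (Aux 0) (l + code_len c1 + 2) (Suc l)"
    "code_at P (Suc l) (code (Suc l) c1)" "Suc l + code_len c1 < length P"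
    "P ! (Suc l + code_len c1) = jump (l + code_len c1 + code_len c2 + 2)"
    by (auto simp: code_at_Cons dest!: code_at_append)
  have "reach P ps (conc K l s) (conc K (Suc l) s)"
    by (rule reach_instr[OF a(1,2)]) (use IfNZ_True.hyps in \<open>auto simp: conc_def\<close>)
  moreover have "reach P ps (conc K (Suc l) s) (conc K (Suc l + code_len c1) s')"
    using IfNZ_True.prems a by (intro IfNZ_True.IH) auto
  moreover have "reach P ps (conc K (Suc l + code_len c1) s') (conc K (l + code_len (IfNZ i c1 c2)) s')"
    by (rule reach_instr[OF a(4,5)]) (auto simp: conc_def)
  ultimately show ?case by (meson reach_trans)
next
  case (IfNZ_False s i c2 s' c1)
  then have a: "l < length P" "P ! l = Work_Test i (Aux 0) (l + code_len c1 + 2) (Suc l)"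
    "code_at P (l + code_len c1 + 2) (code (l + code_len c1 + 2) c2)" 
    by (auto simp: code_at_Cons dest!: code_at_append)
  have "reach P ps (conc K l s) (conc K (l + code_len c1 + 2) s)"
    by (rule reach_instr[OF a(1,2)]) (use IfNZ_False in \<open>auto simp: conc_def\<close>)
  moreover have "reach P ps (conc K (l + code_len c1 + 2) s) (conc K (l + code_len c1 + 2 + code_len c2) s')"
    using IfNZ_False.prems a by (intro IfNZ_False.IH) auto
  ultimately have "reach P ps (conc K l s) (conc K (l + code_len c1 + 2 + code_len c2) s')"
    by (rule reach_trans)
  then show ?case by (simp add: algebra_simps)
next
  case (IfSym_True j s a c1 s' c2)
  then have a: "l < length P" "P ! l = In_Test j (Sym a) (Suc l) (l + code_len c1 + 2)"
    "code_at P (Suc l) (code (Suc l) c1)" "Suc l + code_len c1 < length P"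
    "P ! (Suc l + code_len c1) = jump (l + code_len c1 + code_len c2 + 2)"
    by (auto simp: code_at_Cons dest!: code_at_append)
  have "reach P ps (conc K l s) (conc K (Suc l) s)"
    by (rule reach_instr[OF a(1,2)]) (use IfSym_True.hyps in \<open>auto simp: conc_def\<close>)
  moreover have "reach P ps (conc K (Suc l) s) (conc K (Suc l + code_len c1) s')"
    using IfSym_True.prems a by (intro IfSym_True.IH) auto
  moreover have "reach P ps (conc K (Suc l + code_len c1) s') (conc K (l + code_len (IfSym j a c1 c2)) s')"
    by (rule reach_instr[OF a(4,5)]) (auto simp: conc_def)
  ultimately show ?case by (meson reach_trans)
next
  case (IfSym_False j s a c2 s' c1)
  then have a: "l < length P" "P ! l = In_Test j (Sym a) (Suc l) (l + code_len c1 + 2)"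
    "code_at P (l + code_len c1 + 2) (code (l + code_len c1 + 2) c2)" 
    by (auto simp: code_at_Cons dest!: code_at_append)
  have "reach P ps (conc K l s) (conc K (l + code_len c1 + 2) s)"
    by (rule reach_instr[OF a(1,2)]) (use IfSym_False in \<open>auto simp: conc_def\<close>)
  moreover have "reach P ps (conc K (l + code_len c1 + 2) s) (conc K (l + code_len c1 + 2 + code_len c2) s')"
    using IfSym_False.prems a by (intro IfSym_False.IH) auto
  ultimately have "reach P ps (conc K l s) (conc K (l + code_len c1 + 2 + code_len c2) s')"
    by (rule reach_trans)
  then show ?case by (simp add: algebra_simps)
qed

text \<open>Marking takes one instruction per tape, so the compiled code starts at address
  \<open>K\<close>, which is also the number of marked tapes.\<close>

definition forever_prog :: "'s com \<Rightarrow> nat \<Rightarrow> 's com \<Rightarrow> 's instr list" where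
  "forever_prog c0 r c = (let K = reg_bound (Seq c0 (Loop r c)) in
     map (\<lambda>i. Work_Write i (Aux 0)) [0..<K] @ code K (Seq c0 (Loop r c)))"

text \<open>Every pass through the loop takes at least one step, which rules out halting.\<close>

lemma forever_prog_outp:
  assumes init: "exec ps c0 (\<lambda>_. 0, \<lambda>_. 0, []) (s 0)"
    and body: "\<And>n. exec ps c (s n) (s (Suc n))"
    and pos: "\<And>n. fst (s n) r > 0"
  defines "P \<equiv> forever_prog c0 r c"
  shows "\<exists>t. n \<le> t \<and> \<not> halted P (config_at P ps t) \<and> outp (config_at P ps t) = snd (snd (s n))"
proof -
  define K where "K = reg_bound (Seq c0 (Loop r c))"
  have P: "P = map (\<lambda>i. Work_Write i (Aux 0)) [0..<K] @ code K (Seq c0 (Loop r c))"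
    by (simp add: P_def forever_prog_def K_def Let_def)
  define l where "l = K + code_len c0"
  have lenK: "length (map (\<lambda>i. Work_Write i (Aux 0)) [0..<K]) = K" by simp
  have "code_at P K (code K (Seq c0 (Loop r c)))"
    unfolding code_at_def by (metis P append_Nil2 lenK)
  then have at: "code_at P K (code K c0)" "code_at P l (code l (Loop r c))"
    by (auto simp: l_def dest!: code_at_append)
  have bd: "reg_bound c0 \<le> K" "reg_bound c \<le> K" "r < K" by (auto simp: K_def)
  \<comment> \<open>After \<open>i\<close> instructions exactly \<open>i\<close> tapes are marked,
    so \<open>i\<close> is both the number of marks and the address.\<close>
  have w: "config_at P ps i = (conc i i (\<lambda>_. 0, \<lambda>_. 0, []))" if "i \<le> K" for i
    using that
  proof (induction i)
    case 0
    then show ?case by (simp add: config_at_def init_config_def conc_def)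
  next
    case (Suc i)
    moreover have "P ! i = Work_Write i (Aux 0)" using Suc.prems by (simp add: P nth_append)
    moreover have "length P \<ge> K" by (simp add: P)
    ultimately show ?case
      by (auto simp: config_at_Suc step_def halted_def conc_def fun_eq_iff)
  qed
  have reach0: "reach P ps init_config (conc K K (\<lambda>_. 0, \<lambda>_. 0, []))"
    unfolding reach_def using w[of K] by (auto simp: config_at_def)
  have a: "l < length P" "P ! l = Work_Test r (Aux 0) (l + code_len c + 2) (Suc l)"
    "code_at P (Suc l) (code (Suc l) c)" "Suc l + code_len c < length P" "P ! (Suc l + code_len c) = jump l"
    using at(2) by (auto simp: code_at_Cons dest!: code_at_append)
  have main: "\<exists>t\<ge>n. config_at P ps t = conc K l (s n)" for n
  proof (induction n)
    case 0
    have "reach P ps init_config (conc K l (s 0))"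
      using reach_trans[OF reach0 reach_code[OF init bd(1) at(1)]] by (simp add: l_def)
    then show ?case by (auto simp: reach_def config_at_def)
  next
    case (Suc n)
    then obtain t where t: "t \<ge> n" "config_at P ps t = conc K l (s n)" by blast
    have "step P ps (conc K l (s n)) = conc K (Suc l) (s n)"
      using a pos[of n] by (auto simp: step_def halted_def conc_def)
    then have t1: "config_at P ps (Suc t) = conc K (Suc l) (s n)" using t by (simp add: config_at_Suc)
    have "reach P ps (conc K (Suc l) (s n)) (conc K (Suc l + code_len c) (s (Suc n)))"
      by (rule reach_code[OF body bd(2) a(3)])
    moreover have "reach P ps (conc K (Suc l + code_len c) (s (Suc n))) (conc K l (s (Suc n)))"
      by (rule reach_instr[OF a(4,5)]) (auto simp: conc_def)
    ultimately obtain m where "(step P ps ^^ m) (conc K (Suc l) (s n)) = conc K l (s (Suc n))"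
      using reach_trans unfolding reach_def by metis
    then have "config_at P ps (Suc t + m) = conc K l (s (Suc n))"
      unfolding config_at_def funpow_eq_add using t1 by (simp add: config_at_def)
    then show ?case using t(1) by (intro exI[of _ "Suc t + m"]) auto
  qed
  then obtain t where "t \<ge> n" "config_at P ps t = conc K l (s n)" by blast
  then show ?thesis using a(1)
    by (intro exI[of _ t]) (auto simp: halted_def conc_def)
qed

section \<open>Primitive recursive functions\<close>

text \<open>A unary form of primitive recursion: pairing replaces several arguments, and iteration
  with the count in the first component replaces the recursion scheme, which
  \<open>compf_rec_nat\<close> recovers.\<close>

inductive pr :: "(nat \<Rightarrow> nat) \<Rightarrow> bool" where
  zero: "pr (\<lambda>_. 0)"
| Suc: "pr Suc"
| fst: "pr (\<lambda>n. fst (prod_decode n))"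
| snd: "pr (\<lambda>n. snd (prod_decode n))"
| pair: "pr f \<Longrightarrow> pr g \<Longrightarrow> pr (\<lambda>n. prod_encode (f n, g n))"
| comp: "pr f \<Longrightarrow> pr g \<Longrightarrow> pr (\<lambda>n. f (g n))"
| iter: "pr f \<Longrightarrow> pr (\<lambda>n. (f ^^ fst (prod_decode n)) (snd (prod_decode n)))"

section \<open>Counter programs for loops, copies and pairing\<close>

lemma exec_eq: "exec ps c s s' \<Longrightarrow> s' = s'' \<Longrightarrow> exec ps c s s''"
  by simp

lemma exec_Seq_eq: "exec ps c s s' \<Longrightarrow> exec ps c' s' s'' \<Longrightarrow> s'' = s''' \<Longrightarrow> exec ps (Seq c c') s s'''"
  using exec.Seq by metis

text \<open>The states are indexed by the number of passes that remain, so the run goes from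
  \<open>\<sigma> N\<close> down to \<open>\<sigma> 0\<close>.\<close>

lemma exec_Loop:
  assumes "\<And>n. n < N \<Longrightarrow> exec ps c (\<sigma> (Suc n)) (\<sigma> n)" "\<And>n. fst (\<sigma> (Suc n)) i > 0" "fst (\<sigma> 0) i = 0"
    and "s = \<sigma> N" "s' = \<sigma> 0"
  shows "exec ps (Loop i c) s s'"
proof -
  have "n \<le> N \<Longrightarrow> exec ps (Loop i c) (\<sigma> n) (\<sigma> 0)" for n
  proof (induction n)
    case 0
    then show ?case using assms(3) by (simp add: exec.Loop_End)
  next
    case (Suc n)
    then show ?case using assms(1)[of n] assms(2)[of n] exec.Loop_Step by (metis Suc_le_lessD less_imp_le)
  qed
  then show ?thesis using assms by blast
qed

lemma exec_Inc: "s' = (v(i := Suc (v i)), h, out) \<Longrightarrow> exec ps (Inc i) (v, h, out) s'"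
  by (simp add: exec.Inc)

lemma exec_Dec: "v i > 0 \<Longrightarrow> s' = (v(i := v i - 1), h, out) \<Longrightarrow> exec ps (Dec i) (v, h, out) s'"
  by (simp only: exec.Dec)

definition clear :: "nat \<Rightarrow> 's com" where
  "clear k = Loop k (Dec k)"

lemma exec_clear: "s' = (v(k := 0), h, out) \<Longrightarrow> exec ps (clear k) (v, h, out) s'"
  unfolding clear_def
  by (rule exec_Loop[where \<sigma> = "\<lambda>n. (v(k := n), h, out)" and N = "v k"]) (auto intro!: exec_Dec)

definition transfer :: "nat \<Rightarrow> nat \<Rightarrow> 's com" where
  "transfer k j = Loop k (Seq (Dec k) (Inc j))"

lemma exec_transfer:
  "k \<noteq> j \<Longrightarrow> s' = (v(k := 0, j := v j + v k), h, out) \<Longrightarrow> exec ps (transfer k j) (v, h, out) s'"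
  unfolding transfer_def
  by (rule exec_Loop[where \<sigma> = "\<lambda>n. (v(k := n, j := v j + (v k - n)), h, out)" and N = "v k"])
    (auto simp: fun_eq_iff intro!: exec_Seq_eq[OF exec_Dec[OF _ refl] exec_Inc[OF refl]])

definition transfer2 :: "nat \<Rightarrow> nat \<Rightarrow> nat \<Rightarrow> 's com" where
  "transfer2 k i j = Loop k (Seq (Dec k) (Seq (Inc i) (Inc j)))"

lemma exec_transfer2:
  "k \<noteq> j \<Longrightarrow> k \<noteq> i \<Longrightarrow> i \<noteq> j \<Longrightarrow> s' = (v(k := 0, i := v i + v k, j := v j + v k), h, out) \<Longrightarrow>
    exec ps (transfer2 k i j) (v, h, out) s'"
  unfolding transfer2_def
  by (rule exec_Loop[where \<sigma> = "\<lambda>n. (v(k := n, i := v i + (v k - n), j := v j + (v k - n)), h, out)" and N = "v k"])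
    (auto simp: fun_eq_iff intro!: exec_Seq_eq[OF exec_Dec[OF _ refl] exec_Seq_eq[OF exec_Inc[OF refl] exec_Inc[OF refl] refl]])

text \<open>A counter can be read only by counting it down, so two counters are filled and the
  original is restored from one of them.\<close>

definition copy :: "nat \<Rightarrow> 's com" where
  "copy k = Seq (transfer2 k (k + 1) (k + 2)) (transfer (k + 2) k)"

lemma exec_copy:
  "v (k + 1) = 0 \<Longrightarrow> v (k + 2) = 0 \<Longrightarrow> s' = (v(k + 1 := v k), h, out) \<Longrightarrow> exec ps (copy k) (v, h, out) s'"
  unfolding copy_def
  by (rule exec_Seq_eq[OF exec_transfer2[OF _ _ _ refl] exec_transfer[OF _ refl]]) (auto simp: fun_eq_iff)

text \<open>\<open>prod_encode (m, n)\<close> is \<open>triangle (m + n) + m\<close>. Counter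
  \<open>k + 1\<close> first becomes \<open>m + n\<close> and runs down to 0, while counter
  \<open>k + 2\<close> starts from \<open>m\<close> and receives \<open>m + n\<close>,
  \<open>m + n - 1\<close>, ..., 1 in turn.\<close>

definition encode_pair :: "nat \<Rightarrow> 's com" where
  "encode_pair k = Seq (transfer2 k (k + 1) (k + 2))
     (Seq (Loop (k + 1) (Seq (transfer2 (k + 1) k (k + 2)) (Seq (Dec k) (transfer k (k + 1)))))
       (transfer (k + 2) k))"

lemma exec_encode_pair:
  assumes "v (k + 2) = 0" "s' = (v(k := prod_encode (v k, v (k + 1)), k + 1 := 0), h, out)"
  shows "exec ps (encode_pair k) (v, h, out) s'"
proof -
  let ?m = "v k" and ?s = "v (k + 1) + v k"
  define \<sigma> where "\<sigma> n = (v(k := 0, k + 1 := n, k + 2 := ?m + (triangle ?s - triangle n)), h, out)" for n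
  have tr: "triangle n \<le> triangle m" if "n \<le> m" for n m
    using that by (induction m rule: dec_induct) auto
  have "exec ps (transfer2 k (k + 1) (k + 2)) (v, h, out) (\<sigma> ?s)"
    by (rule exec_transfer2) (use assms(1) in \<open>auto simp: \<sigma>_def fun_eq_iff\<close>)
  moreover have "exec ps (Loop (k + 1) (Seq (transfer2 (k + 1) k (k + 2)) (Seq (Dec k) (transfer k (k + 1))))) (\<sigma> ?s) (\<sigma> 0)"
  proof (rule exec_Loop[where \<sigma> = \<sigma> and N = ?s])
    fix n assume n: "n < ?s"
    have "triangle n + Suc n \<le> triangle ?s" using tr[of "Suc n" ?s] n by simp
    then show "exec ps (Seq (transfer2 (k + 1) k (k + 2)) (Seq (Dec k) (transfer k (k + 1)))) (\<sigma> (Suc n)) (\<sigma> n)"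
      unfolding \<sigma>_def
      by (intro exec_Seq_eq[OF exec_transfer2[OF _ _ _ refl] exec_Seq_eq[OF exec_Dec[OF _ refl] exec_transfer[OF _ refl] refl]])
        (auto simp: fun_eq_iff)
  qed (auto simp: \<sigma>_def)
  moreover have "exec ps (transfer (k + 2) k) (\<sigma> 0) s'"
    unfolding \<sigma>_def by (rule exec_transfer) (use assms(1) in \<open>auto simp: assms(2) prod_encode_def fun_eq_iff add.commute\<close>)
  ultimately show ?thesis unfolding encode_pair_def by (blast intro: exec.Seq)
qed

text \<open>The numbering runs along each diagonal with increasing first component and then passes
  to the next diagonal. Decoding is thus a walk of \<open>y\<close> elementary moves from
  \<open>(0, 0)\<close>, which is what \<open>decode_pair\<close> performs.\<close>

lemma prod_decode_Suc:
  "prod_decode (Suc y) = (let (m, n) = prod_decode y in if n > 0 then (Suc m, n - 1) else (0, Suc m))"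
proof -
  obtain m n where mn: "prod_decode y = (m, n)" by fastforce
  then have y: "y = prod_encode (m, n)" by (metis prod_decode_inverse)
  have "Suc y = prod_encode (if n > 0 then (Suc m, n - 1) else (0, Suc m))"
    by (cases n) (auto simp: y prod_encode_def)
  then show ?thesis by (simp add: mn split: if_splits)
qed

definition decode_pair :: "nat \<Rightarrow> 's com" where
  "decode_pair k = Seq (transfer k (k + 2))
     (Loop (k + 2) (Seq (Dec (k + 2))
       (IfNZ (k + 1) (Seq (Dec (k + 1)) (Inc k)) (Seq (transfer k (k + 1)) (Inc (k + 1))))))"

lemma exec_decode_pair:
  assumes "v (k + 1) = 0" "v (k + 2) = 0"
    "s' = (v(k := fst (prod_decode (v k)), k + 1 := snd (prod_decode (v k))), h, out)"
  shows "exec ps (decode_pair k) (v, h, out) s'"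
proof -
  define y where "y = v k"
  \<comment> \<open>With \<open>n\<close> moves left, the walk has reached the pair with number
    \<open>y - n\<close>.\<close>
  define \<sigma> where "\<sigma> n = (v(k := fst (prod_decode (y - n)), k + 1 := snd (prod_decode (y - n)), k + 2 := n), h, out)" for n
  have 0: "prod_decode 0 = (0, 0)"
    by (simp add: prod_decode_def prod_decode_aux.simps)
  have "exec ps (transfer k (k + 2)) (v, h, out) (\<sigma> y)"
    by (rule exec_transfer) (use assms(1,2) in \<open>auto simp: \<sigma>_def y_def fun_eq_iff 0\<close>)
  moreover have "exec ps (Loop (k + 2) (Seq (Dec (k + 2))
       (IfNZ (k + 1) (Seq (Dec (k + 1)) (Inc k)) (Seq (transfer k (k + 1)) (Inc (k + 1)))))) (\<sigma> y) s'"
  proof (rule exec_Loop[where \<sigma> = \<sigma> and N = y])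
    fix n assume n: "n < y"
    obtain a b where ab: "prod_decode (y - Suc n) = (a, b)" by fastforce
    have "y - n = Suc (y - Suc n)" using n by simp
    then have s: "prod_decode (y - n) = (if b > 0 then (Suc a, b - 1) else (0, Suc a))"
      using prod_decode_Suc[of "y - Suc n"] ab by simp
    define w where "w = v(k := a, k + 1 := b, k + 2 := n)"
    have 1: "exec ps (Dec (k + 2)) (\<sigma> (Suc n)) (w, h, out)"
      unfolding \<sigma>_def ab w_def by (rule exec_Dec) (auto simp: fun_eq_iff)
    have 2: "exec ps (IfNZ (k + 1) (Seq (Dec (k + 1)) (Inc k)) (Seq (transfer k (k + 1)) (Inc (k + 1)))) (w, h, out) (\<sigma> n)"
    proof (cases "b > 0")
      case True
      then have "exec ps (Seq (Dec (k + 1)) (Inc k)) (w, h, out) (\<sigma> n)"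
        unfolding \<sigma>_def w_def s by (intro exec_Seq_eq[OF exec_Dec[OF _ refl] exec_Inc[OF refl]]) (auto simp: fun_eq_iff)
      then show ?thesis using True by (intro exec.IfNZ_True) (auto simp: w_def)
    next
      case False
      then have "exec ps (Seq (transfer k (k + 1)) (Inc (k + 1))) (w, h, out) (\<sigma> n)"
        unfolding \<sigma>_def w_def s by (intro exec_Seq_eq[OF exec_transfer[OF _ refl] exec_Inc[OF refl]]) (auto simp: fun_eq_iff)
      then show ?thesis using False by (intro exec.IfNZ_False) (auto simp: w_def)
    qed
    from 1 2 show "exec ps (Seq (Dec (k + 2))
       (IfNZ (k + 1) (Seq (Dec (k + 1)) (Inc k)) (Seq (transfer k (k + 1)) (Inc (k + 1))))) (\<sigma> (Suc n)) (\<sigma> n)"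
      by (rule exec.Seq)
  next
    show "s' = \<sigma> 0" using assms(1,2) by (auto simp: assms(3) \<sigma>_def y_def fun_eq_iff)
  qed (auto simp: \<sigma>_def)
  ultimately show ?thesis unfolding decode_pair_def by (rule exec.Seq)
qed

text \<open>
  Counter \<open>k\<close> is overwritten by the result; the counters above \<open>k\<close> are free for intermediate
  results and have to be \<open>0\<close> before and after the computation.
\<close>

definition implements :: "nat \<Rightarrow> 's com \<Rightarrow> (nat \<Rightarrow> nat) \<Rightarrow> bool" where
  "implements k c f \<longleftrightarrow>
     (\<forall>ps v h out. (\<forall>j>k. v j = 0) \<longrightarrow> exec ps c (v, h, out) (v(k := f (v k)), h, out))"

lemma implements_exec:
  "implements k c f \<Longrightarrow> (\<And>j. j > k \<Longrightarrow> v j = 0) \<Longrightarrow> s' = (v(k := f (v k)), h, out) \<Longrightarrow> exec ps c (v, h, out) s'"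
  by (simp add: implements_def)

lemma pr_implements: "pr f \<Longrightarrow> \<exists>c :: 's com. implements k c f"
proof (induction arbitrary: k rule: pr.induct)
  case zero
  have "implements k (clear k) (\<lambda>_. 0)"
    by (auto simp: implements_def intro!: exec_clear)
  then show ?case ..
next
  case Suc
  have "implements k (Inc k) Suc"
    by (auto simp: implements_def intro!: exec_Inc)
  then show ?case ..
next
  case fst
  have "implements k (Seq (decode_pair k) (clear (k + 1))) (\<lambda>n. fst (prod_decode n))"
    by (auto simp: implements_def fun_eq_iff intro!: exec_Seq_eq[OF exec_decode_pair[OF _ _ refl] exec_clear[OF refl]])
  then show ?case ..
next
  case snd
  have "implements k (Seq (decode_pair k) (Seq (clear k) (transfer (k + 1) k))) (\<lambda>n. snd (prod_decode n))"
    by (auto simp: implements_def fun_eq_iff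
      intro!: exec_Seq_eq[OF exec_decode_pair[OF _ _ refl] exec_Seq_eq[OF exec_clear[OF refl] exec_transfer[OF _ refl] refl]])
  then show ?case ..
next
  case (pair f g)
  \<comment> \<open>Each subprogram uses all counters above its own as scratch space. The result of
    \<open>g\<close> has to survive while \<open>f\<close> is computed, so \<open>g\<close> works at
    \<open>k + 1\<close> and \<open>f\<close> above it at \<open>k + 2\<close>.\<close>
  from pair.IH obtain cf cg :: "'s com" where cf: "implements (k + 2) cf f" and cg: "implements (k + 1) cg g" by meson
  have "implements k (Seq (copy k) (Seq cg (Seq (transfer k (k + 2)) (Seq cf (Seq (transfer (k + 2) k) (encode_pair k))))))
      (\<lambda>n. prod_encode (f n, g n))"
    unfolding implements_def
  proof (intro allI impI)
    fix ps :: "'s str list" and v :: "nat \<Rightarrow> nat" and h :: "nat \<Rightarrow> nat" and out :: "'s list"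
    assume z: "\<forall>j>k. v j = 0"
    let ?x = "v k"
    have "exec ps (copy k) (v, h, out) (v(k + 1 := ?x), h, out)"
      by (rule exec_copy) (auto simp: z)
    moreover have "exec ps cg (v(k + 1 := ?x), h, out) (v(k + 1 := g ?x), h, out)"
      by (rule implements_exec[OF cg]) (auto simp: z)
    moreover have "exec ps (transfer k (k + 2)) (v(k + 1 := g ?x), h, out) (v(k := 0, k + 1 := g ?x, k + 2 := ?x), h, out)"
      by (rule exec_transfer) (auto simp: z fun_eq_iff)
    moreover have "exec ps cf (v(k := 0, k + 1 := g ?x, k + 2 := ?x), h, out) (v(k := 0, k + 1 := g ?x, k + 2 := f ?x), h, out)"
      by (rule implements_exec[OF cf]) (auto simp: z fun_eq_iff)
    moreover have "exec ps (transfer (k + 2) k) (v(k := 0, k + 1 := g ?x, k + 2 := f ?x), h, out) (v(k := f ?x, k + 1 := g ?x), h, out)"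
      by (rule exec_transfer) (auto simp: z fun_eq_iff)
    moreover have "exec ps (encode_pair k) (v(k := f ?x, k + 1 := g ?x), h, out) (v(k := prod_encode (f ?x, g ?x)), h, out)"
      by (rule exec_encode_pair) (auto simp: z fun_eq_iff)
    ultimately show "exec ps (Seq (copy k) (Seq cg (Seq (transfer k (k + 2)) (Seq cf (Seq (transfer (k + 2) k) (encode_pair k))))))
       (v, h, out) (v(k := prod_encode (f ?x, g ?x)), h, out)"
      by (blast intro: exec.Seq)
  qed
  then show ?case ..
next
  case (comp f g)
  from comp.IH obtain cf cg :: "'s com" where cf: "implements k cf f" and cg: "implements k cg g" by meson
  have "implements k (Seq cg cf) (\<lambda>n. f (g n))"
    unfolding implements_def
    by (auto intro!: exec_Seq_eq[OF implements_exec[OF cg _ refl] implements_exec[OF cf _ refl]])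
  then show ?case ..
next
  case (iter f)
  from iter.IH obtain c :: "'s com" where c: "implements (k + 1) c f" by meson
  have "implements k (Seq (decode_pair k) (Seq (Loop k (Seq (Dec k) c)) (transfer (k + 1) k)))
      (\<lambda>n. (f ^^ fst (prod_decode n)) (snd (prod_decode n)))"
    unfolding implements_def
  proof (intro allI impI)
    fix ps :: "'s str list" and v :: "nat \<Rightarrow> nat" and h :: "nat \<Rightarrow> nat" and out :: "'s list"
    assume z: "\<forall>j>k. v j = 0"
    obtain n x where nx: "prod_decode (v k) = (n, x)" by fastforce
    define \<sigma> where "\<sigma> m = (v(k := m, k + 1 := (f ^^ (n - m)) x), h, out)" for m
    have "exec ps (decode_pair k) (v, h, out) (\<sigma> n)"
      by (rule exec_decode_pair) (auto simp: z \<sigma>_def nx)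
    moreover have "exec ps (Loop k (Seq (Dec k) c)) (\<sigma> n) (\<sigma> 0)"
    proof (rule exec_Loop[where \<sigma> = \<sigma> and N = n])
      fix m assume "m < n"
      then have "n - m = Suc (n - Suc m)" by simp
      then show "exec ps (Seq (Dec k) c) (\<sigma> (Suc m)) (\<sigma> m)" unfolding \<sigma>_def
        by (intro exec_Seq_eq[OF exec_Dec[OF _ refl] implements_exec[OF c _ refl]]) (auto simp: z fun_eq_iff)
    qed (auto simp: \<sigma>_def)
    moreover have "exec ps (transfer (k + 1) k) (\<sigma> 0) (v(k := (f ^^ n) x), h, out)"
      unfolding \<sigma>_def by (rule exec_transfer) (auto simp: z fun_eq_iff)
    ultimately show "exec ps (Seq (decode_pair k) (Seq (Loop k (Seq (Dec k) c)) (transfer (k + 1) k)))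
       (v, h, out) (v(k := (f ^^ fst (prod_decode (v k))) (snd (prod_decode (v k)))), h, out)"
      by (auto simp: nx intro: exec.Seq)
  qed
  then show ?case ..
qed

lemma pr_id: "pr (\<lambda>n. n)"
  using pr.pair[OF pr.fst pr.snd] by simp

lemma pr_const: "pr (\<lambda>_. k)"
  by (induction k) (auto intro: pr.zero pr.comp[OF pr.Suc])

text \<open>A bijection and not just an injection: every number is a code, so \<open>dec\<close> is
  total and quantifiers over codes and over objects can be exchanged. A finite alphabet cannot be
  numbered in this sense; words occur below as lists of symbol codes.\<close>

class numbered =
  fixes enc :: "'a \<Rightarrow> nat"
  assumes bij_enc: "bij enc"

definition dec :: "nat \<Rightarrow> 'a::numbered" where
  "dec = inv enc"

lemma dec_enc [simp]: "dec (enc x) = x"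
  unfolding dec_def by (simp add: bij_enc bij_is_inj)

lemma enc_dec [simp]: "enc (dec n) = n"
  unfolding dec_def by (simp add: bij_enc bij_is_surj surj_f_inv_f)

lemma enc_inject [simp]: "enc x = enc y \<longleftrightarrow> x = y"
  by (metis dec_enc)

lemma ex_dec: "(\<exists>x::'a::numbered. P x) \<longleftrightarrow> (\<exists>n. P (dec n))"
  by (metis dec_enc)

instantiation nat :: numbered
begin
definition enc_nat :: "nat \<Rightarrow> nat" where [simp]: "enc_nat n = n"
instance by standard (simp add: enc_nat_def[abs_def] bij_def)
end

instantiation prod :: (numbered, numbered) numbered
begin
definition enc_prod :: "'a \<times> 'b \<Rightarrow> nat" where
  "enc_prod p = prod_encode (enc (fst p), enc (snd p))"
instance
proof
  show "bij (enc :: 'a \<times> 'b \<Rightarrow> nat)"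
  proof (rule bijI')
    show "\<exists>x :: 'a \<times> 'b. y = enc x" for y :: nat
      by (rule exI[of _ "(dec (fst (prod_decode y)), dec (snd (prod_decode y))) :: 'a \<times> 'b"])
        (simp add: enc_prod_def)
  qed (auto simp: enc_prod_def prod_eq_iff)
qed
end

instantiation list :: (numbered) numbered
begin
definition enc_list :: "'a list \<Rightarrow> nat" where
  "enc_list xs = list_encode (map enc xs)"
instance
proof
  have i: "inj (enc :: 'a \<Rightarrow> nat)" by (simp add: inj_def)
  show "bij (enc :: 'a list \<Rightarrow> nat)"
  proof (rule bijI')
    show "\<exists>x :: 'a list. y = enc x" for y :: nat
      by (rule exI[of _ "map dec (list_decode y) :: 'a list"]) (simp add: enc_list_def comp_def)
  qed (simp add: enc_list_def list_encode_eq inj_map_eq_map[OF i])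
qed
end

lemma dec_nat [simp]: "(dec n :: nat) = n"
  by (metis enc_dec enc_nat_def)

lemma enc_Pair [simp]: "enc (x, y) = prod_encode (enc x, enc y)"
  by (simp add: enc_prod_def)

lemma dec_prod: "dec n = (dec (fst (prod_decode n)), dec (snd (prod_decode n)))"
  by (rule iffD1[OF enc_inject]) (simp del: enc_inject)

lemma enc_Nil [simp]: "enc [] = 0"
  by (simp add: enc_list_def)

lemma enc_Cons [simp]: "enc (x # xs) = Suc (prod_encode (enc x, enc xs))"
  by (simp add: enc_list_def)

text \<open>Makes the code of a list a sufficient number of iterations in
  \<open>compf_foldl\<close>.\<close>

lemma length_le_enc: "length xs \<le> enc xs"
proof (induction xs)
  case (Cons x xs)
  have "enc xs \<le> prod_encode (enc x, enc xs)" by (rule le_prod_encode_2)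
  with Cons show ?case by simp
qed simp

section \<open>Computable functions on numbered types\<close>

text \<open>Primitive recursive on codes; unbounded search enters only with
  \<open>re\<close>.\<close>

definition compf :: "('a::numbered \<Rightarrow> 'b::numbered) \<Rightarrow> bool" where
  "compf f \<longleftrightarrow> pr (\<lambda>n. enc (f (dec n)))"

named_theorems cf

lemma compf_comp: "compf f \<Longrightarrow> compf g \<Longrightarrow> compf (\<lambda>x. f (g x))"
  unfolding compf_def using pr.comp[of "\<lambda>n. enc (f (dec n))" "\<lambda>n. enc (g (dec n))"] by simp

lemma compf_comp2:
  assumes "compf (\<lambda>p. f (fst p) (snd p))" "compf a" "compf b" shows "compf (\<lambda>x. f (a x) (b x))"
  using compf_comp[OF assms(1), of "\<lambda>x. (a x, b x)"] assms(2,3) by (simp add: compf_def pr.pair)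

lemma compf_comp3:
  assumes "compf (\<lambda>p. f (fst p) (fst (snd p)) (snd (snd p)))" "compf a" "compf b" "compf c"
  shows "compf (\<lambda>x. f (a x) (b x) (c x))"
  using compf_comp[OF assms(1), of "\<lambda>x. (a x, b x, c x)"] assms(2-) by (simp add: compf_def pr.pair)

lemma compf_id [cf]: "compf (\<lambda>x. x)"
  by (simp add: compf_def pr_id)

lemma compf_const [cf]: "compf (\<lambda>_. c)"
  by (simp add: compf_def pr_const)

lemma compf_Pair [cf]: "compf f \<Longrightarrow> compf g \<Longrightarrow> compf (\<lambda>x. (f x, g x))"
  by (simp add: compf_def pr.pair)

lemma compf_fst [cf]: assumes "compf f" shows "compf (\<lambda>x. fst (f x))"
proof (rule compf_comp[OF _ assms])
  show "compf (\<lambda>p :: 'b \<times> 'c. fst p)" by (simp add: compf_def dec_prod[where ?'a = 'b] pr.fst)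
qed

lemma compf_snd [cf]: assumes "compf f" shows "compf (\<lambda>x. snd (f x))"
proof (rule compf_comp[OF _ assms])
  show "compf (\<lambda>p :: 'b \<times> 'c. snd p)" by (simp add: compf_def dec_prod[where ?'a = 'b] pr.snd)
qed

lemma compf_enc [cf]: "compf f \<Longrightarrow> compf (\<lambda>x. enc (f x))"
  by (simp add: compf_def)

lemma compf_dec [cf]: "compf f \<Longrightarrow> compf (\<lambda>x. dec (f x))"
  by (simp add: compf_def)

lemma compf_Suc [cf]: "compf f \<Longrightarrow> compf (\<lambda>x. Suc (f x))"
  by (simp add: compf_def pr.comp[OF pr.Suc])

text \<open>\<open>pr.iter\<close> iterates a fixed function without parameters, so the parameter
  \<open>e\<close> travels unchanged as the first component of the iterated state.\<close>

lemma compf_funpow [cf]: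
  fixes f :: "'a::numbered \<Rightarrow> 'b::numbered \<Rightarrow> 'b"
  assumes "compf (\<lambda>p. f (fst p) (snd p))" "compf n" "compf a"
  shows "compf (\<lambda>e. (f e ^^ n e) (a e))"
proof -
  define F where "F p = (fst p, f (fst p) (snd p))" for p
  have F: "compf F" unfolding F_def by (intro cf assms)
  define G where "G n = enc (F (dec n))" for n
  have G: "pr G" using F by (simp add: compf_def G_def[abs_def])
  have GF: "(G ^^ m) k = enc ((F ^^ m) (dec k))" for m k
    by (induction m) (simp_all add: G_def)
  have Ff: "(F ^^ m) (e, x) = (e, (f e ^^ m) x)" for m e x
    by (induction m) (auto simp: F_def)
  have "compf (\<lambda>p :: nat \<times> _. (F ^^ fst p) (snd p))"
    unfolding compf_def using pr.iter[OF G] by (simp add: GF dec_prod[where ?'a = nat])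
  from compf_comp[OF this, of "\<lambda>e. (n e, (e, a e))"]
  have "compf (\<lambda>e. (e, (f e ^^ n e) (a e)))" using assms by (simp add: Ff cf)
  from compf_snd[OF this] show ?thesis by simp
qed

text \<open>Iteration does not see how often it has been applied, so the index is counted in the
  first component of the state.\<close>

lemma compf_rec_nat [cf]:
  assumes "compf (\<lambda>p. h (fst p) (fst (snd p)) (snd (snd p)))" "compf n" "compf a"
  shows "compf (\<lambda>e. rec_nat (a e) (h e) (n e))"
proof -
  have "((\<lambda>p. (Suc (fst p), h e (fst p) (snd p))) ^^ m) (0, x) = (m, rec_nat x (h e) m)" for m x e
    by (induction m) auto
  moreover have "compf (\<lambda>e. snd (((\<lambda>p. (Suc (fst p), h e (fst p) (snd p))) ^^ n e) (0 :: nat, a e)))"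
    by (intro cf assms(2,3) compf_comp3[OF assms(1)])
  ultimately show ?thesis by simp
qed

lemma compf_case_nat [cf]:
  assumes "compf (\<lambda>p. h (fst p) (snd p))" "compf n" "compf a"
  shows "compf (\<lambda>e. case n e of 0 \<Rightarrow> a e | Suc m \<Rightarrow> h e m)"
proof -
  have "(case k of 0 \<Rightarrow> x | Suc m \<Rightarrow> f m) = rec_nat x (\<lambda>m _. f m) k" for k x and f :: "nat \<Rightarrow> 'b"
    by (cases k) auto
  moreover have "compf (\<lambda>e. rec_nat (a e) (\<lambda>m _. h e m) (n e))"
    by (intro cf assms(2,3) compf_comp2[OF assms(1)])
  ultimately show ?thesis by simp
qed

section \<open>Decidable predicates and arithmetic\<close>

definition decidable :: "('a::numbered \<Rightarrow> bool) \<Rightarrow> bool" where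
  "decidable P \<longleftrightarrow> compf (\<lambda>x. of_bool (P x) :: nat)"

lemma decidable_comp: "decidable P \<Longrightarrow> compf g \<Longrightarrow> decidable (\<lambda>x. P (g x))"
  unfolding decidable_def by (rule compf_comp)

lemma decidable_comp2:
  "decidable (\<lambda>p. P (fst p) (snd p)) \<Longrightarrow> compf a \<Longrightarrow> compf b \<Longrightarrow> decidable (\<lambda>x. P (a x) (b x))"
  unfolding decidable_def by (rule compf_comp2)

lemma compf_of_bool [cf]: "decidable P \<Longrightarrow> compf (\<lambda>x. of_bool (P x) :: nat)"
  by (simp add: decidable_def)

lemma compf_if [cf]:
  assumes "decidable P" "compf f" "compf g" shows "compf (\<lambda>x. if P x then f x else g x)"
proof -
  have "(if b then u else v) = (case of_bool b of 0 \<Rightarrow> v | Suc _ \<Rightarrow> u)" for b and u v :: 'b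
    by auto
  then show ?thesis by (simp only:) (intro cf assms compf_comp[OF assms(2)])
qed

lemma decidable_nonzero: assumes "compf f" shows "decidable (\<lambda>x. f x \<noteq> (0::nat))"
proof -
  have "of_bool (k \<noteq> 0) = (case k of 0 \<Rightarrow> 0 | Suc _ \<Rightarrow> (1 :: nat))" for k :: nat
    by (cases k) auto
  then show ?thesis unfolding decidable_def using assms by (simp only:) (intro cf)
qed

lemma compf_add [cf]: assumes "compf f" "compf g" shows "compf (\<lambda>x. f x + g x :: nat)"
proof -
  have "m + n = (Suc ^^ n) m" for m n by (induction n) auto
  then show ?thesis using assms by (simp only:) (intro cf)
qed

lemma compf_diff [cf]: assumes "compf f" "compf g" shows "compf (\<lambda>x. f x - g x :: nat)"
proof -
  have "m - n = ((\<lambda>k. case k of 0 \<Rightarrow> 0 | Suc l \<Rightarrow> l) ^^ n) m" for m n :: nat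
    by (induction n) (auto split: nat.split)
  then show ?thesis using assms by (simp only:) (intro cf)
qed

lemma compf_mult [cf]: assumes "compf f" "compf g" shows "compf (\<lambda>x. f x * g x :: nat)"
proof -
  have "m * n = ((\<lambda>k. k + m) ^^ n) 0" for m n :: nat by (induction n) auto
  then show ?thesis by (simp only:) (intro cf assms compf_comp[OF assms(1)])
qed

lemma compf_power [cf]: assumes "compf f" "compf g" shows "compf (\<lambda>x. f x ^ g x :: nat)"
proof -
  have "m ^ n = ((\<lambda>k. k * m) ^^ n) 1" for m n :: nat by (induction n) auto
  then show ?thesis by (simp only:) (intro cf assms compf_comp[OF assms(1)])
qed

named_theorems dc

lemma decidable_const [dc]: "decidable (\<lambda>_. b)"
  unfolding decidable_def by (rule cf)

lemma decidable_not [dc]: assumes "decidable P" shows "decidable (\<lambda>x. \<not> P x)"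
proof -
  have "of_bool (\<not> b) = (1 - of_bool b :: nat)" for b by auto
  then show ?thesis unfolding decidable_def by (simp only:) (intro cf assms)
qed

lemma decidable_conj [dc]: assumes "decidable P" "decidable Q" shows "decidable (\<lambda>x. P x \<and> Q x)"
  unfolding decidable_def by (simp only: of_bool_conj) (intro cf assms)

lemma decidable_disj [dc]: assumes "decidable P" "decidable Q" shows "decidable (\<lambda>x. P x \<or> Q x)"
  using decidable_not[OF decidable_conj[OF decidable_not[OF assms(1)] decidable_not[OF assms(2)]]] by simp

lemma decidable_imp [dc]: assumes "decidable P" "decidable Q" shows "decidable (\<lambda>x. P x \<longrightarrow> Q x)"
  using decidable_disj[OF decidable_not[OF assms(1)] assms(2)] by (simp only: imp_conv_disj)

lemma decidable_less [dc]: assumes "compf f" "compf g" shows "decidable (\<lambda>x. f x < (g x :: nat))"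
proof -
  have "(m < n) = (n - m \<noteq> 0)" for m n :: nat by auto
  then show ?thesis using assms by (simp only:) (intro decidable_nonzero cf)
qed

lemma decidable_le [dc]: assumes "compf f" "compf g" shows "decidable (\<lambda>x. f x \<le> (g x :: nat))"
  using decidable_not[OF decidable_less[OF assms(2,1)]] by (simp add: not_less)

lemma decidable_eq [dc]: assumes "compf f" "compf g" shows "decidable (\<lambda>x. f x = g x)"
proof -
  have "(u = v) = (enc u \<le> enc v \<and> enc v \<le> enc u)" for u v :: 'b by (auto simp: le_antisym)
  then show ?thesis using assms by (simp only:) (intro dc cf)
qed

lemma decidable_ball [dc]:
  fixes P :: "'a::numbered \<Rightarrow> nat \<Rightarrow> bool"
  assumes "decidable (\<lambda>p. P (fst p) (snd p))" "compf n"
  shows "decidable (\<lambda>e. \<forall>i<n e. P e i)"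
proof -
  have "of_bool (\<forall>i<k. Q i) = rec_nat (1::nat) (\<lambda>i r. r * of_bool (Q i)) k" for k Q
    by (induction k) (simp_all add: All_less_Suc of_bool_conj mult.commute)
  then show ?thesis
    unfolding decidable_def by (simp only:) (intro cf assms(2) decidable_comp2[OF assms(1)])
qed

subsection \<open>Lists\<close>

lemma compf_Cons [cf]: "compf f \<Longrightarrow> compf g \<Longrightarrow> compf (\<lambda>x. f x # g x)"
  by (simp add: compf_def pr.pair pr.comp[OF pr.Suc])

lemma compf_case_list [cf]:
  fixes l :: "'a::numbered \<Rightarrow> 'b::numbered list"
  assumes h: "compf (\<lambda>p. h (fst p) (fst (snd p)) (snd (snd p)))" and l: "compf l" and a: "compf a"
  shows "compf (\<lambda>e. case l e of [] \<Rightarrow> a e | x # xs \<Rightarrow> h e x xs)"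
proof -
  have "(\<lambda>e. case l e of [] \<Rightarrow> a e | x # xs \<Rightarrow> h e x xs) =
      (\<lambda>e. case enc (l e) of 0 \<Rightarrow> a e | Suc m \<Rightarrow> h e (fst (dec m :: 'b \<times> 'b list)) (snd (dec m :: 'b \<times> 'b list)))"
    by (auto simp: fun_eq_iff dec_prod split: list.split)
  moreover have "compf (\<lambda>e. case enc (l e) of 0 \<Rightarrow> a e | Suc m \<Rightarrow> h e (fst (dec m :: 'b \<times> 'b list)) (snd (dec m :: 'b \<times> 'b list)))"
    by (intro cf l a compf_comp3[OF h])
  ultimately show ?thesis by (simp only:)
qed

text \<open>The iterated state consists of the accumulator and the rest of the list. It is
  stationary once the rest is empty, so iterating too often does no harm, and
  \<open>enc (l e)\<close> iterations suffice.\<close>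

lemma compf_foldl [cf]:
  assumes h: "compf (\<lambda>p. h (fst p) (fst (snd p)) (snd (snd p)))" and l: "compf l" and a: "compf a"
  shows "compf (\<lambda>e. foldl (h e) (a e) (l e))"
proof -
  define st where "st e p = (case snd p of [] \<Rightarrow> p | x # xs \<Rightarrow> (h e (fst p) x, xs))" for e p
  have st: "(st e ^^ n) (u, ys) = (foldl (h e) u ys, [])" if "length ys \<le> n" for e n u ys
    using that
  proof (induction ys arbitrary: n u)
    case Nil
    show ?case by (induction n) (simp_all add: st_def)
  next
    case (Cons y ys)
    then obtain m where m: "n = Suc m" "length ys \<le> m" by (cases n) auto
    have "st e (u, y # ys) = (h e u y, ys)" by (simp add: st_def)
    then show ?case by (simp add: m(1) funpow_Suc_right Cons.IH[OF m(2)] del: funpow.simps)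
  qed
  have "compf (\<lambda>e. fst ((st e ^^ enc (l e)) (a e, l e)))"
    unfolding st_def by (intro cf l a compf_comp3[OF h])
  then show ?thesis using st[OF length_le_enc] by simp
qed

lemma compf_rev [cf]: assumes "compf l" shows "compf (\<lambda>e. rev (l e))"
proof -
  have "foldl (\<lambda>r x. x # r) ys xs = rev xs @ ys" for xs ys :: "'b list" by (induction xs arbitrary: ys) auto
  from this[of "[]"] have "rev xs = foldl (\<lambda>r x. x # r) [] xs" for xs :: "'b list" by simp
  then show ?thesis using assms by (simp only:) (intro cf)
qed

lemma compf_foldr [cf]:
  assumes h: "compf (\<lambda>p. h (fst p) (fst (snd p)) (snd (snd p)))" and l: "compf l" and a: "compf a"
  shows "compf (\<lambda>e. foldr (h e) (l e) (a e))"
  unfolding foldr_conv_foldl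
  by (intro cf l a compf_comp3[OF h])

lemma compf_map [cf]:
  assumes h: "compf (\<lambda>p. h (fst p) (snd p))" and l: "compf l"
  shows "compf (\<lambda>e. map (h e) (l e))"
proof -
  have "map f xs = foldr (\<lambda>x r. f x # r) xs []" for f :: "'b \<Rightarrow> 'c" and xs by (induction xs) auto
  then show ?thesis by (simp only:) (intro cf l compf_comp2[OF h])
qed

lemma compf_append [cf]: assumes "compf f" "compf g" shows "compf (\<lambda>e. f e @ g e)"
proof -
  have "xs @ ys = foldr (#) xs ys" for xs ys :: "'b list" by (induction xs) auto
  then show ?thesis using assms by (simp only:) (intro cf)
qed

lemma compf_concat [cf]: assumes "compf f" shows "compf (\<lambda>e. concat (f e))"
  unfolding concat_conv_foldr using assms by (intro cf)

lemma compf_length [cf]: assumes "compf f" shows "compf (\<lambda>e. length (f e))"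
proof -
  have "length xs = foldr (\<lambda>_ r. Suc r) xs 0" for xs :: "'b list" by (induction xs) auto
  then show ?thesis using assms by (simp only:) (intro cf)
qed

lemma compf_sum_list [cf]: assumes "compf f" shows "compf (\<lambda>e. sum_list (f e) :: nat)"
  unfolding sum_list.eq_foldr using assms by (intro cf)

lemma compf_tl [cf]: assumes "compf f" shows "compf (\<lambda>e. tl (f e))"
  unfolding tl_def using assms by (intro cf)

lemma compf_drop [cf]: assumes "compf n" "compf f" shows "compf (\<lambda>e. drop (n e) (f e))"
proof -
  have "drop k xs = (tl ^^ k) xs" for k and xs :: "'b list"
    by (induction k arbitrary: xs) (auto simp: drop_Suc funpow_swap1 tl_drop)
  then show ?thesis using assms by (simp only:) (intro cf)
qed

lemma compf_take [cf]: assumes "compf n" "compf f" shows "compf (\<lambda>e. take (n e) (f e))"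
  unfolding take_rev[of _ "rev _", unfolded rev_rev_ident]
  using assms by (intro cf)

definition nth_or :: "'a \<Rightarrow> 'a list \<Rightarrow> nat \<Rightarrow> 'a" where
  "nth_or d xs i = (case drop i xs of [] \<Rightarrow> d | x # _ \<Rightarrow> x)"

lemma nth_or: "nth_or d xs i = (if i < length xs then xs ! i else d)"
  unfolding nth_or_def by (cases "drop i xs") (auto simp: nth_via_drop)

lemma compf_nth_or [cf]: "compf d \<Longrightarrow> compf l \<Longrightarrow> compf n \<Longrightarrow> compf (\<lambda>e. nth_or (d e) (l e) (n e))"
  unfolding nth_or_def by (intro cf)

lemma compf_list_update [cf]:
  assumes "compf l" "compf n" "compf x" shows "compf (\<lambda>e. (l e)[n e := x e])"
proof -
  have "xs[i := y] = (if i < length xs then take i xs @ y # drop (Suc i) xs else xs)" for xs :: "'b list" and i y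
    by (simp add: upd_conv_take_nth_drop not_less list_update_beyond)
  then show ?thesis using assms by (simp only:) (intro cf dc)
qed

lemma compf_replicate [cf]:
  assumes "compf n" "compf x" shows "compf (\<lambda>e. replicate (n e) (x e))"
proof -
  have "replicate k y = (((#) y) ^^ k) []" for k and y :: 'b by (induction k) auto
  then show ?thesis by (simp only:) (intro cf compf_comp[OF assms(2)] assms)
qed

lemma decidable_list_all [dc]:
  assumes "decidable (\<lambda>p. P (fst p) (snd p))" "compf l"
  shows "decidable (\<lambda>e. \<forall>x\<in>set (l e). P e x)"
proof -
  have "of_bool (\<forall>x\<in>set xs. Q x) = foldr (\<lambda>x r. r * of_bool (Q x)) xs (1::nat)" for xs :: "'b list" and Q
    by (induction xs) (simp_all add: of_bool_conj mult.commute)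
  then show ?thesis
    unfolding decidable_def by (simp only:) (intro cf assms(2) decidable_comp2[OF assms(1)])
qed

section \<open>Recursively enumerable predicates\<close>

definition re :: "('a::numbered \<Rightarrow> bool) \<Rightarrow> bool" where
  "re P \<longleftrightarrow> (\<exists>Q. decidable Q \<and> (\<forall>x. P x \<longleftrightarrow> (\<exists>t::nat. Q (x, t))))"

lemma reI: "decidable Q \<Longrightarrow> (\<And>x. P x \<longleftrightarrow> (\<exists>t::'b::numbered. Q (x, t))) \<Longrightarrow> re P"
  unfolding re_def
  by (rule exI[of _ "\<lambda>p. Q (fst p, dec (snd p))"]) (auto simp: ex_dec[of "\<lambda>t. Q (_, t)"] intro!: decidable_comp[of Q] cf)

named_theorems re

lemma re_decidable: "decidable P \<Longrightarrow> re P"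
  by (rule reI[of "\<lambda>p :: _ \<times> nat. P (fst p)"]) (auto intro!: decidable_comp[of P] cf)

lemma re_comp: assumes "re P" "compf g" shows "re (\<lambda>x. P (g x))"
proof -
  from assms(1) obtain Q where Q: "decidable Q" "\<And>x. P x \<longleftrightarrow> (\<exists>t::nat. Q (x, t))" by (auto simp: re_def)
  show ?thesis
    by (rule reI[of "\<lambda>p. Q (g (fst p), snd p)"])
      (use Q assms(2) in \<open>auto intro!: decidable_comp[of Q] cf intro: compf_comp[of g]\<close>)
qed

lemma re_comp2:
  assumes "re (\<lambda>p. P (fst p) (snd p))" "compf a" "compf b" shows "re (\<lambda>x. P (a x) (b x))"
  using re_comp[OF assms(1), of "\<lambda>x. (a x, b x)"] assms(2,3) by (simp add: cf)

lemma re_comp3: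
  assumes "re (\<lambda>p. P (fst p) (fst (snd p)) (snd (snd p)))" "compf a" "compf b" "compf c"
  shows "re (\<lambda>x. P (a x) (b x) (c x))"
  using re_comp[OF assms(1), of "\<lambda>x. (a x, b x, c x)"] assms(2-) by (simp add: cf)

lemma re_conj [re]: assumes "re P" "re P'" shows "re (\<lambda>x. P x \<and> P' x)"
proof -
  from assms obtain Q Q' where Q: "decidable Q" "\<And>x. P x \<longleftrightarrow> (\<exists>t::nat. Q (x, t))"
    "decidable Q'" "\<And>x. P' x \<longleftrightarrow> (\<exists>t::nat. Q' (x, t))" by (auto simp: re_def)
  show ?thesis
    by (rule reI[of "\<lambda>p. Q (fst p, fst (snd p)) \<and> Q' (fst p, snd (snd p))"])
      (use Q in \<open>auto intro!: dc decidable_comp[of Q] decidable_comp[of Q'] cf\<close>)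
qed

lemma re_ex [re]: assumes "re (\<lambda>p. P (fst p) (snd p))" shows "re (\<lambda>x. \<exists>y. P x y)"
proof -
  from assms obtain Q where Q: "decidable Q" "\<And>x. P (fst x) (snd x) \<longleftrightarrow> (\<exists>t::nat. Q (x, t))" by (auto simp: re_def)
  then have P: "P x y \<longleftrightarrow> (\<exists>t. Q ((x, y), t))" for x y by (metis fst_conv snd_conv)
  show ?thesis
    by (rule reI[of "\<lambda>p. Q ((fst p, fst (snd p)), snd (snd p))"])
      (auto simp: P intro!: decidable_comp[of Q] Q cf)
qed

lemma re_disj [re]: assumes "re P" "re P'" shows "re (\<lambda>x. P x \<or> P' x)"
proof -
  from assms obtain Q Q' where Q: "decidable Q" "\<And>x. P x \<longleftrightarrow> (\<exists>t::nat. Q (x, t))"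
    "decidable Q'" "\<And>x. P' x \<longleftrightarrow> (\<exists>t::nat. Q' (x, t))" by (auto simp: re_def)
  show ?thesis
    by (rule reI[of "\<lambda>p. Q p \<or> Q' p"]) (use Q in \<open>auto intro!: dc\<close>)
qed

text \<open>The certificates for all \<open>i\<close> below the bound are collected in a single
  list.\<close>

lemma re_ball [re]:
  fixes P :: "'a::numbered \<Rightarrow> nat \<Rightarrow> bool"
  assumes "re (\<lambda>p. P (fst p) (snd p))" "compf n" shows "re (\<lambda>x. \<forall>i<n x. P x i)"
proof -
  from assms obtain Q where Q: "decidable Q" "\<And>x. P (fst x) (snd x) \<longleftrightarrow> (\<exists>t::nat. Q (x, t))" by (auto simp: re_def)
  then have P: "P x y \<longleftrightarrow> (\<exists>t. Q ((x, y), t))" for x y by (metis fst_conv snd_conv)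
  have "(\<forall>i<n x. P x i) \<longleftrightarrow> (\<exists>ts. \<forall>i<n x. Q ((x, i), nth_or 0 ts i))" (is "?l \<longleftrightarrow> ?r") for x
  proof
    assume ?l
    then obtain t where "\<forall>i<n x. Q ((x, i), t i)" unfolding P by metis
    then have "\<forall>i<n x. Q ((x, i), nth_or 0 (map t [0..<n x]) i)" by (simp add: nth_or)
    then show ?r by blast
  qed (auto simp: P)
  moreover have "decidable (\<lambda>p. \<forall>i<n (fst p). Q ((fst p, i), nth_or 0 (snd p) i))"
    by (intro dc decidable_comp[OF Q(1)] compf_comp[OF assms(2)] cf)
  ultimately show ?thesis by (intro reI[of "\<lambda>p. \<forall>i<n (fst p). Q ((fst p, i), nth_or 0 (snd p) i)"]) auto
qed

section \<open>Enumerating machines\<close>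

text \<open>Odd codes for the alphabet, positive even ones for auxiliary symbols.
  \<open>Blank\<close> gets 0, which is the default of \<open>nth0\<close> for cells not stored and
  the end marker of a word in \<open>input_nat\<close>.\<close>

primrec symc :: "('s::finite) sym \<Rightarrow> nat" where
  "symc Blank = 0"
| "symc (Sym a) = 2 * to_nat a + 1"
| "symc (Aux n) = 2 * n + 2"

lemma symc_inject [simp]: "symc x = symc y \<longleftrightarrow> x = y"
  by (cases x; cases y; simp; presburger)

declare symc.simps(2,3) [simp del]

abbreviation sc :: "'s::finite \<Rightarrow> nat" where
  "sc a \<equiv> symc (Sym a)"

lemma inj_sc: "inj sc"
  by (auto simp: inj_def)

lemma map_sc_inject [simp]: "map sc u = map sc w \<longleftrightarrow> u = w"
  by (rule inj_map_eq_map[OF inj_sc])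

text \<open>What has been read from the first two input tapes after \<open>n\<close> stages, newest
  first: a stage is one \<open>Cons\<close>, and earlier buffers are recovered by
  \<open>drop\<close>. A missing tape reads as blank, so one format serves one and two
  arguments.\<close>

definition buf :: "('s::finite) str list \<Rightarrow> nat \<Rightarrow> (nat \<times> nat) list" where
  "buf ps n = rev (map (\<lambda>i. (symc (in_cell ps 0 i), symc (in_cell ps 1 i))) [0..<n])"

lemma length_buf [simp]: "length (buf ps n) = n"
  by (simp add: buf_def)

lemma buf_0 [simp]: "buf ps 0 = []"
  by (simp add: buf_def)

lemma buf_Suc: "buf ps (Suc n) = (symc (in_cell ps 0 n), symc (in_cell ps 1 n)) # buf ps n"
  by (simp add: buf_def)

lemma drop_buf: "drop (n - m) (buf ps n) = buf ps (min n m)"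
  by (simp add: buf_def drop_rev take_map min_def)

primrec incs :: "nat \<Rightarrow> nat \<Rightarrow> 's com" where
  "incs k 0 = Skip"
| "incs k (Suc m) = Seq (Inc k) (incs k m)"

lemma exec_incs: "s' = (v(k := v k + m), h, out) \<Longrightarrow> exec ps (incs k m) (v, h, out) s'"
proof (induction m arbitrary: v s')
  case 0
  then show ?case by (simp add: exec.Skip)
next
  case (Suc m)
  show ?case unfolding incs.simps
    by (rule exec.Seq[OF exec_Inc[OF refl] Suc.IH]) (simp add: Suc.prems fun_eq_iff)
qed

primrec read_sym :: "('s::finite) list \<Rightarrow> nat \<Rightarrow> nat \<Rightarrow> 's com" where
  "read_sym [] j k = Skip"
| "read_sym (a # as) j k = IfSym j a (incs k (sc a)) (read_sym as j k)"

lemma in_cell_cases: "in_cell ps j n = Blank \<or> (\<exists>a. in_cell ps j n = Sym a)"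
  by (cases "ps ! j") (auto simp: in_cell_def)

lemma exec_read_sym:
  assumes "v k = 0" "\<And>a. in_cell ps j (h j) = Sym a \<Longrightarrow> a \<in> set as" "s' = (v(k := symc (in_cell ps j (h j))), h, out)"
  shows "exec ps (read_sym as j k) (v, h, out) s'"
  using assms(2)
proof (induction as)
  case Nil
  then have "in_cell ps j (h j) = Blank" using in_cell_cases[of ps j "h j"] by auto
  then have "s' = (v, h, out)" using assms(1,3) by (auto simp: fun_eq_iff)
  then show ?case by (simp add: exec.Skip)
next
  case (Cons a as)
  show ?case
  proof (cases "in_cell ps j (h j) = Sym a")
    case True
    then show ?thesis unfolding read_sym.simps
      by (intro exec.IfSym_True exec_incs) (use assms(1,3) in auto)
  next
    case False
    then show ?thesis unfolding read_sym.simps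
      by (intro exec.IfSym_False Cons.IH) (use Cons.prems in auto)
  qed
qed

text \<open>\<open>Put\<close> emits a symbol fixed in the program, so the symbol to be written is
  selected by counting down through a finite table. The entries \<open>None\<close> fill the gaps
  between symbol codes.\<close>

primrec put_nth :: "'s option list \<Rightarrow> nat \<Rightarrow> 's com" where
  "put_nth [] k = Skip"
| "put_nth (x # xs) k = IfNZ k (Seq (Dec k) (put_nth xs k)) (case x of None \<Rightarrow> Skip | Some a \<Rightarrow> Put a)"

lemma exec_put_nth:
  assumes "v k < length xs" "xs ! v k = Some a" "s' = (v(k := 0), h, out @ [a])"
  shows "exec ps (put_nth xs k) (v, h, out) s'"
  using assms
proof (induction xs arbitrary: v)
  case (Cons x xs)
  show ?case
  proof (cases "v k")
    case 0
    then have "s' = (v, h, out @ [a])" using Cons.prems by (auto simp: fun_eq_iff)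
    then show ?thesis using 0 Cons.prems by (auto intro!: exec.IfNZ_False exec.Put)
  next
    case (Suc n)
    then show ?thesis unfolding put_nth.simps
      by (intro exec.IfNZ_True exec.Seq[OF exec_Dec[OF _ refl]] Cons.IH) (use Cons.prems in auto)
  qed
qed simp

definition sym_table :: "('s::finite) option list" where
  "sym_table = map (\<lambda>i. if i \<in> range (sc :: 's \<Rightarrow> nat) then Some (inv sc i) else None) [0..<Suc (Max (range (sc :: 's \<Rightarrow> nat)))]"

lemma sym_table: "sc a < length (sym_table :: ('s::finite) option list)" "(sym_table :: 's option list) ! sc a = Some (a :: 's)"
proof -
  have "sc a \<le> Max (range (sc :: 's \<Rightarrow> nat))" by (rule Max_ge) auto
  then show "sc a < length (sym_table :: 's option list)" by (simp add: sym_table_def less_Suc_eq_le)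
  then show "(sym_table :: 's option list) ! sc a = Some a"
    using inv_f_f[OF inj_sc, of a] unfolding sym_table_def by (simp del: upt_Suc)
qed

text \<open>A list has code 0 if it is empty and otherwise \<open>Suc\<close> of a pair, so
  \<open>Dec\<close> and \<open>decode_pair\<close> split off its head.\<close>

definition put_list :: "nat \<Rightarrow> ('s::finite) com" where
  "put_list k = Loop k (Seq (Dec k) (Seq (decode_pair k) (Seq (put_nth sym_table k) (transfer (k + 1) k))))"

lemma exec_put_list:
  assumes "v k = enc (map sc w)" "v (k + 1) = 0" "v (k + 2) = 0" "s' = (v(k := 0), h, out @ w)"
  shows "exec ps (put_list k) (v, h, out) s'"
  using assms
proof (induction w arbitrary: v out)
  case Nil
  then have "s' = (v, h, out)" by (auto simp: fun_eq_iff)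
  then show ?case unfolding put_list_def using Nil by (auto intro: exec.Loop_End)
next
  case (Cons a w)
  let ?c = "Seq (Dec k) (Seq (decode_pair k) (Seq (put_nth sym_table k) (transfer (k + 1) k)))"
  have vk: "v k = Suc (prod_encode (sc a, enc (map sc w)))" using Cons.prems(1) by simp
  have "exec ps (Dec k) (v, h, out) (v(k := prod_encode (sc a, enc (map sc w))), h, out)"
    by (rule exec_Dec) (auto simp: vk)
  moreover have "exec ps (decode_pair k) (v(k := prod_encode (sc a, enc (map sc w))), h, out)
      (v(k := sc a, k + 1 := enc (map sc w)), h, out)"
    by (rule exec_decode_pair) (use Cons.prems in \<open>simp_all add: fun_eq_iff\<close>)
  moreover have "exec ps (put_nth sym_table k) (v(k := sc a, k + 1 := enc (map sc w)), h, out)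
      (v(k := 0, k + 1 := enc (map sc w)), h, out @ [a])"
    by (rule exec_put_nth[where a = a]) (use sym_table[of a] in \<open>auto simp: fun_eq_iff\<close>)
  moreover have "exec ps (transfer (k + 1) k) (v(k := 0, k + 1 := enc (map sc w)), h, out @ [a])
      (v(k := enc (map sc w)), h, out @ [a])"
    by (rule exec_transfer) (use Cons.prems in \<open>auto simp: fun_eq_iff\<close>)
  ultimately have step: "exec ps ?c (v, h, out) (v(k := enc (map sc w)), h, out @ [a])"
    by (blast intro: exec.Seq)
  have "exec ps (put_list k) (v(k := enc (map sc w)), h, out @ [a]) s'"
    by (rule Cons.IH) (use Cons.prems in auto)
  then show ?case using step vk unfolding put_list_def by (auto intro: exec.Loop_Step)
qed

text \<open>
  The machine alternately reads one more cell of each input tape and writes the word computed from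
  everything read so far.
\<close>

lemma stage_machine:
  assumes "compf e"
  shows "\<exists>P :: ('s::finite) instr list. \<forall>ps E. (\<forall>n. e (buf ps n) = map sc (E n)) \<longrightarrow>
    (\<forall>n. \<exists>t\<ge>n. \<not> halted P (config_at P ps t) \<and>
       outp (config_at P ps t) = concat (map (\<lambda>i. E (Suc i)) [0..<n]))"
proof -
  have "pr (\<lambda>n. enc (e (dec n)))" using assms by (simp add: compf_def)
  then obtain ce :: "'s com" where ce: "implements 2 ce (\<lambda>n. enc (e (dec n)))"
    using pr_implements by blast
  obtain as :: "'s list" where as: "set as = UNIV" using finite_list[of "UNIV :: 's set"] by auto
  \<comment> \<open>Counter 0 stays 1 and keeps the loop running, counter 1 holds the code of the
    buffer, and the counters from 2 on are 0 between stages. The two symbols are paired and put in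
    front of the buffer; then the word is computed from a copy of it.\<close>
  define c :: "'s com" where "c = Seq (read_sym as 0 2) (Seq (Move 0) (Seq (read_sym as 1 3) (Seq (Move 1)
    (Seq (encode_pair 2) (Seq (transfer 1 3) (Seq (encode_pair 2) (Seq (Inc 2) (Seq (transfer 2 1)
    (Seq (copy 1) (Seq ce (put_list 2)))))))))))"
  define P where "P = forever_prog (Inc 0) 0 c"
  show ?thesis
  proof (rule exI[of _ P], intro allI impI)
    fix ps :: "'s str list" and E :: "nat \<Rightarrow> 's list" and n
    assume E: "\<forall>n. e (buf ps n) = map sc (E n)"
    \<comment> \<open>A stage reads before it writes, so stage \<open>i\<close> prints
      \<open>E (Suc i)\<close>, and \<open>E 0\<close> is never printed.\<close>
    define s :: "nat \<Rightarrow> 's state" where "s n = ((\<lambda>i. if i = 0 then 1 else if i = 1 then enc (buf ps n) else 0),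
      (\<lambda>j. if j < 2 then n else 0), concat (map (\<lambda>i. E (Suc i)) [0..<n]))" for n
    have init: "exec ps (Inc 0) (\<lambda>_. 0, \<lambda>_. 0, []) (s 0)"
      by (rule exec_Inc) (auto simp: s_def fun_eq_iff)
    have body: "exec ps c (s n) (s (Suc n))" for n
    proof -
      let ?b = "enc (buf ps n)" and ?x = "symc (in_cell ps 0 n)" and ?y = "symc (in_cell ps 1 n)"
      let ?out = "concat (map (\<lambda>i. E (Suc i)) [0..<n])"
      let ?b' = "enc (buf ps (Suc n))"
      define V :: "nat \<Rightarrow> nat \<Rightarrow> nat \<Rightarrow> nat \<Rightarrow> nat" where
        "V b x y i = (if i = 0 then 1 else if i = 1 then b else if i = 2 then x else if i = 3 then y else 0)" for b x y i
      define H :: "nat \<Rightarrow> nat \<Rightarrow> nat \<Rightarrow> nat" where "H x y j = (if j = 0 then x else if j = 1 then y else 0)" for x y j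
      have b': "?b' = Suc (prod_encode (prod_encode (?x, ?y), ?b))" by (simp add: buf_Suc)
      have "exec ps (read_sym as 0 2) (V ?b 0 0, H n n, ?out) (V ?b ?x 0, H n n, ?out)"
        by (rule exec_read_sym) (auto simp: as V_def H_def fun_eq_iff)
      moreover have "exec ps (Move 0) (V ?b ?x 0, H n n, ?out) (V ?b ?x 0, H (Suc n) n, ?out)"
        by (rule exec_eq[OF exec.Move]) (auto simp: H_def fun_eq_iff)
      moreover have "exec ps (read_sym as 1 3) (V ?b ?x 0, H (Suc n) n, ?out) (V ?b ?x ?y, H (Suc n) n, ?out)"
        by (rule exec_read_sym) (auto simp: as V_def H_def fun_eq_iff)
      moreover have "exec ps (Move 1) (V ?b ?x ?y, H (Suc n) n, ?out) (V ?b ?x ?y, H (Suc n) (Suc n), ?out)"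
        by (rule exec_eq[OF exec.Move]) (auto simp: H_def fun_eq_iff)
      moreover have "exec ps (encode_pair 2) (V ?b ?x ?y, H (Suc n) (Suc n), ?out) (V ?b (prod_encode (?x, ?y)) 0, H (Suc n) (Suc n), ?out)"
        by (rule exec_encode_pair) (auto simp: V_def fun_eq_iff)
      moreover have "exec ps (transfer 1 3) (V ?b (prod_encode (?x, ?y)) 0, H (Suc n) (Suc n), ?out) (V 0 (prod_encode (?x, ?y)) ?b, H (Suc n) (Suc n), ?out)"
        by (rule exec_transfer) (auto simp: V_def fun_eq_iff)
      moreover have "exec ps (encode_pair 2) (V 0 (prod_encode (?x, ?y)) ?b, H (Suc n) (Suc n), ?out) (V 0 (prod_encode (prod_encode (?x, ?y), ?b)) 0, H (Suc n) (Suc n), ?out)"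
        by (rule exec_encode_pair) (auto simp: V_def fun_eq_iff)
      moreover have "exec ps (Inc 2) (V 0 (prod_encode (prod_encode (?x, ?y), ?b)) 0, H (Suc n) (Suc n), ?out) (V 0 ?b' 0, H (Suc n) (Suc n), ?out)"
        by (rule exec_Inc) (auto simp: V_def fun_eq_iff b')
      moreover have "exec ps (transfer 2 1) (V 0 ?b' 0, H (Suc n) (Suc n), ?out) (V ?b' 0 0, H (Suc n) (Suc n), ?out)"
        by (rule exec_transfer) (auto simp: V_def fun_eq_iff)
      moreover have "exec ps (copy 1) (V ?b' 0 0, H (Suc n) (Suc n), ?out) (V ?b' ?b' 0, H (Suc n) (Suc n), ?out)"
        by (rule exec_copy) (auto simp: V_def fun_eq_iff)
      moreover have "exec ps ce (V ?b' ?b' 0, H (Suc n) (Suc n), ?out) (V ?b' (enc (map sc (E (Suc n)))) 0, H (Suc n) (Suc n), ?out)"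
        by (rule implements_exec[OF ce]) (auto simp: V_def fun_eq_iff E)
      moreover have "exec ps (put_list 2) (V ?b' (enc (map sc (E (Suc n)))) 0, H (Suc n) (Suc n), ?out) (V ?b' 0 0, H (Suc n) (Suc n), ?out @ E (Suc n))"
        by (rule exec_put_list) (auto simp: V_def fun_eq_iff)
      ultimately have "exec ps c (V ?b 0 0, H n n, ?out) (V ?b' 0 0, H (Suc n) (Suc n), ?out @ E (Suc n))"
        unfolding c_def by (blast intro: exec.Seq)
      moreover have "s m = (V (enc (buf ps m)) 0 0, H m m, concat (map (\<lambda>i. E (Suc i)) [0..<m]))" for m
        by (auto simp: s_def V_def H_def fun_eq_iff)
      ultimately show ?thesis by simp
    qed
    from forever_prog_outp[of ps "Inc 0" s c 0, OF init body]
    show "\<exists>t\<ge>n. \<not> halted P (config_at P ps t) \<and> outp (config_at P ps t) = concat (map (\<lambda>i. E (Suc i)) [0..<n])"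
      by (simp add: P_def s_def)
  qed
qed

text \<open>The version of \<open>wrap\<close> on symbol codes; the codes of 1 and 0 are parameters,
  so that the definition lives entirely on numbers.\<close>

definition wrapc :: "nat \<Rightarrow> nat \<Rightarrow> nat list \<Rightarrow> nat list" where
  "wrapc o1 o0 w = [o1, o1, o0] @ concat (map (\<lambda>a. [a, o0]) w) @ [o1, o1]"

lemma compf_wrapc [cf]:
  assumes "compf a" "compf b" "compf f" shows "compf (\<lambda>x. wrapc (a x) (b x) (f x))"
  unfolding wrapc_def by (intro cf assms compf_comp[OF assms(2)])

lemma map_sc_wrap: "map sc (wrap w) = wrapc (sc (1::'s)) (sc (0::'s)) (map sc (w :: ('s::{finite,zero_neq_one}) list))"
  by (simp add: wrap_def wrapc_def map_concat comp_def)

abbreviation wraps :: "(nat \<Rightarrow> ('s::zero_neq_one) list) \<Rightarrow> nat \<Rightarrow> 's list" where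
  "wraps v n \<equiv> concat (map (\<lambda>i. wrap (v i)) [0..<n])"

lemma length_wraps: "n \<le> length (wraps v n)"
  by (induction n) (auto simp: wrap_def)

lemma wraps_le: "m \<le> n \<Longrightarrow> \<exists>u. wraps v n = wraps v m @ u"
proof (induction n rule: dec_induct)
  case (step n)
  then show ?case by auto
qed simp

lemma seq_tuple_nth:
  assumes "i < length (wraps v n)" shows "seq_tuple v i = wraps v n ! i"
proof (cases "Suc i \<le> n")
  case True
  then obtain u where "wraps v n = wraps v (Suc i) @ u" using wraps_le by blast
  moreover have "i < length (wraps v (Suc i))" using length_wraps[of "Suc i" v] by linarith
  ultimately show ?thesis unfolding seq_tuple_def by (simp add: nth_append del: upt_Suc)
next
  case False
  then obtain u where "wraps v (Suc i) = wraps v n @ u" using wraps_le[of n "Suc i" v] by auto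
  then show ?thesis unfolding seq_tuple_def using assms by (simp add: nth_append del: upt_Suc)
qed

text \<open>
  A stage number codes a candidate for the next word together with a certificate; the first
  component of the code only ensures that every candidate is tried at arbitrarily late stages.
\<close>

theorem enumerating_machine:
  fixes V :: "(nat \<times> nat) list \<Rightarrow> nat \<Rightarrow> nat list \<Rightarrow> bool"
  assumes V: "re (\<lambda>p. V (fst p) (fst (snd p)) (snd (snd p)))"
  shows "\<exists>F :: ('s::{finite,zero_neq_one}) str list \<rightharpoonup> 's str. computable_string_fun F \<and>
    (\<forall>ps. list_all2 of_kind ks ps \<and>
       (\<forall>k. \<exists>n. \<exists>x :: 's list. V (buf ps n) k (map sc x)) \<and>
       (\<forall>n k w. V (buf ps n) k w \<longrightarrow> w \<in> range (map sc :: 's list \<Rightarrow> nat list)) \<longrightarrow>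
       (\<exists>x. F ps = Some (Inf (seq_tuple x)) \<and> (\<forall>k. \<exists>n. V (buf ps n) k (map sc (x k)))))"
proof -
  from V obtain Q where Q: "decidable Q" "\<And>b k w. V b k w \<longleftrightarrow> (\<exists>t::nat. Q ((b, k, w), t))"
    unfolding re_def by (metis fst_conv snd_conv)
  define cand :: "nat \<Rightarrow> nat \<times> nat \<times> nat list \<times> nat" where "cand n = dec n" for n
  \<comment> \<open>The second component of a candidate is the length of the buffer to which its
    certificate refers. Dropping the newer entries restores that buffer, so a certificate stays
    valid at later stages.\<close>
  define ok where "ok b k \<longleftrightarrow> Q ((drop (length b - fst (snd (cand (length b)))) b, k, fst (snd (snd (cand (length b))))),
     snd (snd (snd (cand (length b)))))" for b k
  have ok: "decidable (\<lambda>p. ok (fst p) (snd p))" unfolding ok_def cand_def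
    by (intro decidable_comp[OF Q(1)] cf)
  \<comment> \<open>The machine stores only the buffer. The number of words written so far is
    recomputed by replaying all stages, from the oldest entry at the end of the list to the newest
    at its head.\<close>
  define stp where "stp x p = (x # fst p, if ok (x # fst p) (snd p) then Suc (snd p) else snd p)" for x p
  define cnt where "cnt b = snd (foldr stp b ([], 0))" for b
  have fst_st: "fst (foldr stp b ([], 0)) = b" for b by (induction b) (auto simp: stp_def)
  have cnt_Cons: "cnt (x # b) = (if ok (x # b) (cnt b) then Suc (cnt b) else cnt b)" for x b
    by (simp add: cnt_def stp_def fst_st)
  define e where "e b = (if b \<noteq> [] \<and> ok b (cnt (tl b)) then wrapc (sc (1::'s)) (sc (0::'s)) (fst (snd (snd (cand (length b))))) else [])" for b
  have "compf e" unfolding e_def cnt_def cand_def stp_def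
    by (intro cf dc decidable_comp2[OF ok])
  from stage_machine[OF this, where ?'s = 's] obtain P :: "'s instr list" where
    P: "\<And>ps E n. (\<forall>n. e (buf ps n) = map sc (E n)) \<Longrightarrow> \<exists>t\<ge>n. \<not> halted P (config_at P ps t) \<and>
       outp (config_at P ps t) = concat (map (\<lambda>i. E (Suc i)) [0..<n])" by blast
  define T where "T = \<lparr>in_kinds = ks, out_kind = Infinite_Str, prog = P\<rparr>"
  show ?thesis
  proof (intro exI[of _ "string_fun T"] conjI allI impI computable_string_fun_string_fun)
    fix ps :: "'s str list"
    assume *: "list_all2 of_kind ks ps \<and>
       (\<forall>k. \<exists>n. \<exists>x :: 's list. V (buf ps n) k (map sc x)) \<and>
       (\<forall>n k w. V (buf ps n) k w \<longrightarrow> w \<in> range (map sc :: 's list \<Rightarrow> nat list))"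
    define c where "c n = cnt (buf ps n)" for n
    define g where "g n \<longleftrightarrow> ok (buf ps (Suc n)) (c n)" for n
    define W where "W n = fst (snd (snd (cand n)))" for n
    have c_Suc: "c (Suc n) = (if g n then Suc (c n) else c n)" for n
      by (simp add: c_def g_def buf_Suc cnt_Cons)
    have c_0: "c 0 = 0" by (simp add: c_def cnt_def)
    have c_mono: "m \<le> n \<Longrightarrow> c m \<le> c n" for m n
      by (induction n rule: dec_induct) (auto simp: c_Suc)
    have gV: "\<exists>m. V (buf ps m) (c n) (W (Suc n))" if "g n" for n
      using that unfolding g_def ok_def Q(2) W_def by (auto simp: drop_buf)
    define word where "word w = (SOME x :: 's list. map sc x = w)" for w
    have word: "map sc (word (W (Suc n)) :: 's list) = W (Suc n)" if "g n" for n
    proof -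
      from gV[OF that] * obtain x :: "'s list" where "W (Suc n) = map sc x" by blast
      then show ?thesis unfolding word_def by (metis (mono_tags, lifting) someI_ex)
    qed
    \<comment> \<open>If the count remains \<open>k\<close> up to a stage that codes a valid
      candidate for \<open>k\<close>, that stage accepts; otherwise the count has left
      \<open>k\<close>, so an earlier stage has accepted.\<close>
    have reached: "\<exists>n. c n = k \<and> g n" if n0: "c n0 = k" for n0 k
    proof -
      have jump: "\<exists>n. c n = k \<and> g n" if "n0 \<le> n" "c n > k" for n
        using that
      proof (induction n rule: dec_induct)
        case base
        then show ?case using n0 by simp
      next
        case (step n)
        then show ?case using c_mono[of n0 n] n0 by (cases "c n = k") (auto simp: c_Suc split: if_splits)
      qed
      from * obtain m and x :: "'s list" where "V (buf ps m) k (map sc x)" by blast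
      then obtain t where t: "Q ((buf ps m, k, map sc x), t)" using Q(2) by blast
      \<comment> \<open>The first component makes the stage number exceed \<open>n0\<close>, and at
        least \<open>m\<close>, so that the cells needed for the certificate have been read by
        then.\<close>
      define N where "N = enc (Suc n0 + m, m, map sc x, t)"
      have candN: "cand N = (Suc n0 + m, m, map sc x, t)" by (simp only: cand_def N_def dec_enc)
      have "Suc n0 + m \<le> N" using le_prod_encode_1[of "Suc n0 + m"] by (simp add: N_def)
      then obtain N' where N': "N = Suc N'" "n0 \<le> N'" "m \<le> N" by (cases N) auto
      have ok: "ok (buf ps N) k" unfolding ok_def using t N'(3) by (simp only: length_buf candN fst_conv snd_conv drop_buf min_absorb2)
      show ?thesis
      proof (cases "c N' = k")
        case True
        then show ?thesis using ok N'(1) by (auto simp: g_def)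
      next
        case False
        then show ?thesis using jump[of N'] c_mono[OF N'(2)] N'(2) n0 by simp
      qed
    qed
    have step: "\<exists>n. c n = k \<and> g n" for k
    proof (induction k)
      case 0
      show ?case by (rule reached[OF c_0])
    next
      case (Suc k)
      then obtain n where "c n = k" "g n" by blast
      then have "c (Suc n) = Suc k" by (simp add: c_Suc)
      then show ?case by (rule reached)
    qed
    have uniq: "m = n" if "c m = c n" "g m" "g n" for m n
      using c_mono[of "Suc m" n] c_mono[of "Suc n" m] that by (auto simp: c_Suc not_less_eq_eq) (metis Suc_leI Suc_n_not_le_n linorder_neqE_nat)
    define \<nu> where "\<nu> k = (SOME n. c n = k \<and> g n)" for k
    have \<nu>: "c (\<nu> k) = k" "g (\<nu> k)" for k
      using someI_ex[OF step[of k]] by (simp_all add: \<nu>_def)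
    have \<nu>c: "\<nu> (c n) = n" if "g n" for n using uniq[of "\<nu> (c n)" n] \<nu> that by simp
    define x where "x k = (word (W (Suc (\<nu> k))) :: 's list)" for k
    define E where "E n = (if n > 0 \<and> g (n - 1) then wrap (x (c (n - 1))) else [])" for n
    have eE: "e (buf ps n) = map sc (E n)" for n
    proof (cases n)
      case 0
      then show ?thesis using 0 by (simp add: e_def E_def cnt_def)
    next
      case (Suc m)
      have "tl (buf ps (Suc m)) = buf ps m" "buf ps (Suc m) \<noteq> []" by (simp_all add: buf_Suc)
      then show ?thesis using word[of m] \<nu>c[of m] unfolding Suc
        by (auto simp: e_def E_def g_def c_def[symmetric] map_sc_wrap x_def W_def)
    qed
    have out: "concat (map (\<lambda>i. E (Suc i)) [0..<n]) = wraps x (c n)" for n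
      by (induction n) (auto simp: c_0 c_Suc E_def)
    have unb: "\<exists>n. c n \<ge> k" for k using \<nu>(1)[of k] by (metis order_refl)
    have "computes T ps (Inf (seq_tuple x))"
    proof -
      have "\<not> halted P (config_at P ps t)" for t
        using P[of ps E t] eE halted_mono by metis
      moreover have "\<exists>t. n < length (outp (config_at P ps t)) \<and> outp (config_at P ps t) ! n = seq_tuple x n" for n
      proof -
        obtain N where N: "c N \<ge> Suc n" using unb by blast
        obtain t where t: "outp (config_at P ps t) = wraps x (c N)" using P[of ps E N] eE out by auto
        have "n < length (wraps x (c N))" using length_wraps[of "c N" x] N by linarith
        then show ?thesis using t seq_tuple_nth by (metis)
      qed
      ultimately show ?thesis using * by (simp add: computes_def T_def)
    qed
    then show "\<exists>x. string_fun T ps = Some (Inf (seq_tuple x)) \<and> (\<forall>k. \<exists>n. V (buf ps n) k (map sc (x k)))"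
      using gV[OF \<nu>(2)] word[OF \<nu>(2)] \<nu>(1) by (intro exI[of _ x]) (auto simp: string_fun_iff x_def)
  qed
qed

section \<open>Simulating machines on finite inputs\<close>

type_synonym tape_code = "nat list \<times> nat list"
text \<open>The components are the program counter, the unread rest of each input word, the work
  tapes and the output.\<close>

type_synonym config_code = "nat \<times> nat list list \<times> tape_code list \<times> nat list"

abbreviation nth0 :: "nat list \<Rightarrow> nat \<Rightarrow> nat" where
  "nth0 \<equiv> nth_or 0"

lemma nth_or_Nil [simp]: "nth_or d [] z = d"
  by (simp add: nth_or)

lemma nth_or_Cons_0 [simp]: "nth_or d (x # xs) 0 = x"
  by (simp add: nth_or)

lemma nth_or_Cons_Suc [simp]: "nth_or d (x # xs) (Suc z) = nth_or d xs z"
  by (simp add: nth_or)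

lemma nth_or_tl [simp]: "nth_or d (tl xs) z = nth_or d xs (Suc z)"
  by (cases xs) auto

fun sim_instr :: "('s::finite) instr \<Rightarrow> config_code \<Rightarrow> config_code" where
  "sim_instr (Emit a) (l, ins, ts, out) = (Suc l, ins, ts, out @ [sc a])"
| "sim_instr (In_Right i) (l, ins, ts, out) = (Suc l, ins[i := tl (nth_or [] ins i)], ts, out)"
| "sim_instr (In_Test i a l1 l2) (l, ins, ts, out) =
     (if nth0 (nth_or [] ins i) 0 = symc a then l1 else l2, ins, ts, out)"
| "sim_instr (Work_Left i) (l, ins, ts, out) =
     (let t = nth_or ([], []) ts i in (Suc l, ins, ts[i := (tl (fst t), nth0 (fst t) 0 # snd t)], out))"
| "sim_instr (Work_Right i) (l, ins, ts, out) =
     (let t = nth_or ([], []) ts i in (Suc l, ins, ts[i := (nth0 (snd t) 0 # fst t, tl (snd t))], out))"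
| "sim_instr (Work_Write i a) (l, ins, ts, out) =
     (let t = nth_or ([], []) ts i in (Suc l, ins, ts[i := (fst t, symc a # tl (snd t))], out))"
| "sim_instr (Work_Test i a l1 l2) (l, ins, ts, out) =
     (if nth0 (snd (nth_or ([], []) ts i)) 0 = symc a then l1 else l2, ins, ts, out)"

lemma compf_sim_instr: "compf (sim_instr a)"
proof -
  have "compf (\<lambda>c. sim_instr a (fst c, fst (snd c), fst (snd (snd c)), snd (snd (snd c))))"
    by (cases a; simp only: sim_instr.simps Let_def; intro cf dc)
  then show ?thesis by simp
qed

text \<open>The simulated program is fixed and not part of the data, so choosing the instruction at
  the program counter is a case distinction among finitely many functions.\<close>

lemma compf_nth_fun:
  assumes "\<forall>f\<in>set fs. compf f"
  shows "compf (\<lambda>p. if fst p < length fs then (fs ! fst p) (snd p) else snd p)"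
  using assms
proof (induction fs)
  case Nil
  then show ?case by (simp add: cf)
next
  case (Cons f fs)
  let ?g = "\<lambda>p. if fst p < length fs then (fs ! fst p) (snd p) else snd p"
  have f: "compf f" and g: "compf ?g" using Cons by auto
  have "compf (\<lambda>p. case fst p of 0 \<Rightarrow> f (snd p) | Suc n \<Rightarrow> ?g (n, snd p))"
    by (rule compf_case_nat compf_comp[OF f] compf_comp[OF g] | rule cf)+
  moreover have "(\<lambda>p. case fst p of 0 \<Rightarrow> f (snd p) | Suc n \<Rightarrow> ?g (n, snd p)) =
      (\<lambda>p. if fst p < length (f # fs) then ((f # fs) ! fst p) (snd p) else snd p)"
    by (auto simp: fun_eq_iff split: nat.split)
  ultimately show ?case by simp
qed

definition sim_step :: "('s::finite) instr list \<Rightarrow> config_code \<Rightarrow> config_code" where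
  "sim_step P c = (if fst c < length P then sim_instr (P ! fst c) c else c)"

lemma compf_sim_step: "compf (sim_step P)"
proof -
  have A: "compf (\<lambda>p. if fst p < length (map sim_instr P) then (map sim_instr P ! fst p) (snd p) else snd p)"
    by (rule compf_nth_fun) (auto simp: compf_sim_instr)
  have B: "compf (\<lambda>c :: config_code. (fst c, c))" by (intro cf)
  from compf_comp[OF A B] have "compf (\<lambda>c. if fst c < length P then (map sim_instr P ! fst c) c else c)"
    by (simp only: fst_conv snd_conv length_map)
  moreover have "(\<lambda>c. if fst c < length P then (map sim_instr P ! fst c) c else c) = sim_step P"
    by (auto simp: sim_step_def fun_eq_iff)
  ultimately show ?thesis by simp
qed

text \<open>A program touches only finitely many work tapes; \<open>sim\<close> stores those below
  the maximum of these bounds.\<close>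

primrec tape_bound :: "'s instr \<Rightarrow> nat" where
  "tape_bound (Emit a) = 0"
| "tape_bound (In_Right i) = 0"
| "tape_bound (In_Test i a l1 l2) = 0"
| "tape_bound (Work_Left i) = Suc i"
| "tape_bound (Work_Right i) = Suc i"
| "tape_bound (Work_Write i a) = Suc i"
| "tape_bound (Work_Test i a l1 l2) = Suc i"

text \<open>
  A work tape is coded by the cells to the left of the head, nearest first, and the cells from
  the head on to the right; missing cells are blank.
\<close>

definition codes_tape :: "(int \<Rightarrow> ('s::finite) sym) \<Rightarrow> int \<Rightarrow> tape_code \<Rightarrow> bool" where
  "codes_tape f z t \<longleftrightarrow> (\<forall>n. symc (f (z + int n)) = nth0 (snd t) n) \<and> (\<forall>n. symc (f (z - 1 - int n)) = nth0 (fst t) n)"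

lemma codes_tape_left: assumes "codes_tape f z t" shows "codes_tape f (z - 1) (tl (fst t), nth0 (fst t) 0 # snd t)"
  unfolding codes_tape_def fst_conv snd_conv
proof (intro conjI allI)
  fix n
  show "symc (f (z - 1 + int n)) = nth0 (nth0 (fst t) 0 # snd t) n"
    using assms by (cases n) (auto simp: codes_tape_def, metis diff_zero of_nat_0)
  have "z - 1 - 1 - int n = z - 1 - int (Suc n)" by simp
  moreover have "symc (f (z - 1 - int (Suc n))) = nth0 (fst t) (Suc n)"
    using assms unfolding codes_tape_def by blast
  ultimately show "symc (f (z - 1 - 1 - int n)) = nth0 (tl (fst t)) n" by (simp only: nth_or_tl)
qed

lemma codes_tape_right: assumes "codes_tape f z t" shows "codes_tape f (z + 1) (nth0 (snd t) 0 # fst t, tl (snd t))"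
  unfolding codes_tape_def fst_conv snd_conv
proof (intro conjI allI)
  fix n
  have "z + 1 + int n = z + int (Suc n)" by simp
  moreover have "symc (f (z + int (Suc n))) = nth0 (snd t) (Suc n)"
    using assms unfolding codes_tape_def by blast
  ultimately show "symc (f (z + 1 + int n)) = nth0 (tl (snd t)) n" by (simp only: nth_or_tl)
  show "symc (f (z + 1 - 1 - int n)) = nth0 (nth0 (snd t) 0 # fst t) n"
  proof (cases n)
    case 0
    then show ?thesis using assms by (auto simp: codes_tape_def) (metis add.right_neutral of_nat_0)
  next
    case (Suc m)
    then have "z + 1 - 1 - int n = z - 1 - int m" by simp
    moreover have "symc (f (z - 1 - int m)) = nth0 (fst t) m" using assms unfolding codes_tape_def by blast
    ultimately show ?thesis by (simp only: Suc nth_or_Cons_Suc)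
  qed
qed

lemma codes_tape_write: assumes "codes_tape f z t" shows "codes_tape (f(z := a)) z (fst t, symc a # tl (snd t))"
  unfolding codes_tape_def fst_conv snd_conv
proof (intro conjI allI)
  fix n
  show "symc ((f(z := a)) (z + int n)) = nth0 (symc a # tl (snd t)) n"
    using assms by (cases n) (auto simp: codes_tape_def simp del: of_nat_Suc)
  show "symc ((f(z := a)) (z - 1 - int n)) = nth0 (fst t) n"
    using assms by (auto simp: codes_tape_def)
qed

lemma codes_tape_head: assumes "codes_tape f z t" shows "nth0 (snd t) 0 = symc (f z)"
  using assms unfolding codes_tape_def by (metis add.right_neutral of_nat_0)

definition codes_config :: "nat \<Rightarrow> ('s::finite) list list \<Rightarrow> 's config \<Rightarrow> config_code \<Rightarrow> bool" where
  "codes_config K us c d \<longleftrightarrow> fst d = pc c \<and>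
     fst (snd d) = map (\<lambda>i. map sc (drop (in_pos c i) (us ! i))) [0..<length us] \<and>
     length (fst (snd (snd d))) = K \<and>
     (\<forall>i<K. codes_tape (work c i) (work_pos c i) (fst (snd (snd d)) ! i)) \<and>
     snd (snd (snd d)) = map sc (outp c)"

lemma in_cell_Fin:
  "symc (in_cell (map Fin us) i n) = nth0 (nth_or [] (map (\<lambda>i. map sc (drop (h i) (us ! i))) [0..<length us]) i) 0"
  if "n = h i"
  using that by (auto simp: in_cell_def nth_or)

lemma codes_config_exec:
  assumes d: "codes_config K us c d" and K: "tape_bound a \<le> K"
  shows "codes_config K us (exec_instr (map Fin us) a c) (sim_instr a d)"
proof -
  obtain l ins ts out where [simp]: "d = (l, ins, ts, out)" by (cases d)
  have c: "l = pc c" "ins = map (\<lambda>i. map sc (drop (in_pos c i) (us ! i))) [0..<length us]" "length ts = K"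
    "\<And>i. i < K \<Longrightarrow> codes_tape (work c i) (work_pos c i) (ts ! i)" "out = map sc (outp c)"
    using d by (auto simp: codes_config_def)
  have T: "nth_or ([], []) ts i = ts ! i" if "i < K" for i using that c(3) by (simp add: nth_or)
  show ?thesis
  proof (cases a)
    case (In_Right i)
    have tl: "tl (map sc (drop n w)) = map sc (drop (Suc n) w)" for n and w :: "'a list"
      by (simp only: drop_Suc flip: tl_drop map_tl)
    have "ins[i := tl (nth_or [] ins i)] =
        map (\<lambda>j. map sc (drop (if j = i then Suc (in_pos c j) else in_pos c j) (us ! j))) [0..<length us]"
      by (rule nth_equalityI) (simp_all add: c(2) nth_or nth_list_update tl)
    then show ?thesis using c
      by (simp add: codes_config_def In_Right fun_upd_def)
  next
    case (In_Test i x l1 l2)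
    then show ?thesis using c in_cell_Fin[of "in_pos c i" "in_pos c" i us]
      by (auto simp: codes_config_def)
  next
    case (Work_Test i x l1 l2)
    then show ?thesis using c K codes_tape_head[OF c(4)[of i]]
      by (auto simp: codes_config_def T)
  qed (use c K in \<open>auto simp: codes_config_def Let_def T nth_list_update codes_tape_left codes_tape_right codes_tape_write\<close>)
qed

definition sim :: "('s::finite) instr list \<Rightarrow> nat list list \<Rightarrow> nat \<Rightarrow> config_code" where
  "sim P us t = (sim_step P ^^ t) (0, us, replicate (Max (insert 0 (tape_bound ` set P))) ([], []), [])"

lemma compf_sim [cf]: "compf f \<Longrightarrow> compf g \<Longrightarrow> compf (\<lambda>x. sim P (f x) (g x))"
  unfolding sim_def by (intro cf compf_comp[OF compf_sim_step])

lemma codes_config_sim: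
  "codes_config (Max (insert 0 (tape_bound ` set P))) us (config_at P (map Fin us) t) (sim P (map (map sc) us) t)"
proof (induction t)
  case 0
  have "map (map sc) us = map (\<lambda>i. map sc (us ! i)) [0..<length us]"
    by (rule nth_equalityI) (simp_all)
  then show ?case
    by (simp add: codes_config_def config_at_def sim_def init_config_def codes_tape_def)
next
  case (Suc t)
  let ?c = "config_at P (map Fin us) t" and ?d = "sim P (map (map sc) us) t"
  have s: "sim P (map (map sc) us) (Suc t) = sim_step P ?d" by (simp add: sim_def)
  have pc: "fst ?d = pc ?c" using Suc.IH by (simp add: codes_config_def)
  show ?case
  proof (cases "pc ?c < length P")
    case True
    then have "tape_bound (P ! pc ?c) \<le> Max (insert 0 (tape_bound ` set P))" by (intro Max_ge) auto
    from codes_config_exec[OF Suc.IH this] show ?thesis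
      using True by (simp add: s sim_step_def pc config_at_Suc step_def halted_def)
  next
    case False
    then show ?thesis using Suc.IH by (simp add: s sim_step_def pc config_at_Suc step_def halted_def)
  qed
qed

lemma sim_halted: "halted P (config_at P (map Fin us) t) \<longleftrightarrow> length P \<le> fst (sim P (map (map sc) us) t)"
  using codes_config_sim[of P us t] by (auto simp: codes_config_def halted_def)

lemma sim_outp: "snd (snd (snd (sim P (map (map sc) us) t))) = map sc (outp (config_at P (map Fin us) t))"
  using codes_config_sim[of P us t] by (auto simp: codes_config_def)

text \<open>The running time is the certificate. Number and kinds of the strings are tested as well,
  because \<open>computes\<close> fails when they do not fit the machine, whatever its program
  does.\<close>

lemma re_graph:
  assumes "computable_string_fun (F :: ('s::finite) str list \<rightharpoonup> 's str)"
  shows "\<exists>G. re (\<lambda>p. G (fst p) (snd p)) \<and>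
    (\<forall>us y. G (map (map sc) us) y \<longleftrightarrow> (\<exists>v. y = map sc v \<and> F (map Fin us) = Some (Fin v)))"
proof -
  from assms obtain T where T: "\<And>ps q. F ps = Some q \<longleftrightarrow> computes T ps q"
    by (auto simp: computable_string_fun_def)
  define G where "G us y \<longleftrightarrow> length us = length (in_kinds T) \<and>
    (set (in_kinds T) \<subseteq> {Finite_Str} \<and> out_kind T = Finite_Str) \<and>
    (\<exists>t. length (prog T) \<le> fst (sim (prog T) us t) \<and> y = snd (snd (snd (sim (prog T) us t))))" for us y
  have "re (\<lambda>p. G (fst p) (snd p))"
    unfolding G_def by (intro re re_decidable dc cf)
  moreover have "G (map (map sc) us) y \<longleftrightarrow> (\<exists>v. y = map sc v \<and> F (map Fin us) = Some (Fin v))" for us :: "'s list list" and y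
  proof -
    have 1: "list_all2 of_kind ks (map Fin us) \<longleftrightarrow> length us = length ks \<and> set ks \<subseteq> {Finite_Str}" for ks
    proof (induction ks arbitrary: us)
      case (Cons k ks)
      then show ?case by (cases us; cases k) auto
    qed auto
    have 2: "of_kind k (Fin w) \<longleftrightarrow> k = Finite_Str" for k and w :: "'s list" by (cases k) auto
    show ?thesis
      unfolding G_def T computes_def 1 2 length_map sim_halted[symmetric] sim_outp writes.simps by blast
  qed
  ultimately show ?thesis by blast
qed

definition prefix_of :: "nat list \<Rightarrow> nat list \<Rightarrow> bool" where
  "prefix_of x y \<longleftrightarrow> take (length x) y = x"

lemma decidable_prefix_of [dc]: "compf f \<Longrightarrow> compf g \<Longrightarrow> decidable (\<lambda>x. prefix_of (f x) (g x))"
  unfolding prefix_of_def by (intro dc cf)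

lemma prefix_of_iff: "prefix_of x y \<longleftrightarrow> (\<exists>z. y = x @ z)"
  unfolding prefix_of_def by (metis append_eq_conv_conj append_take_drop_id)

lemma map_scE:
  assumes "set x \<subseteq> range (sc :: ('s::finite) \<Rightarrow> nat)" obtains w :: "('s::finite) list" where "x = map sc w"
proof -
  have "x = map sc (map (inv sc) x :: 's list)"
    using assms by (induction x) (auto simp: inv_f_f[OF inj_sc])
  then show ?thesis using that by blast
qed

text \<open>An occurrence in an infinite output is visible after finitely many steps; the
  certificate is this time and the text \<open>y\<close> in front of the occurrence. In this way the
  intervals in a computed name of a real become enumerable from a finite word.\<close>

lemma re_occurs:
  assumes "computable_string_fun (F :: ('s::{finite,zero_neq_one}) str list \<rightharpoonup> 's str)"
  shows "\<exists>G. re (\<lambda>p. G (fst p) (snd p)) \<and> (\<forall>us q. F (map Fin us) = Some (Inf q) \<longrightarrow>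
    (\<forall>x. G (map (map sc) us) x \<longleftrightarrow> (\<exists>w. x = map sc w \<and> occurs_in (wrap w) q)))"
proof -
  from assms obtain T where T: "\<And>ps q. F ps = Some q \<longleftrightarrow> computes T ps q"
    by (auto simp: computable_string_fun_def)
  define G where "G us x \<longleftrightarrow> (\<exists>t y. prefix_of (y @ wrapc (sc (1::'s)) (sc (0::'s)) x) (snd (snd (snd (sim (prog T) us t)))))" for us x
  have "re (\<lambda>p. G (fst p) (snd p))"
    unfolding G_def by (intro re re_decidable dc cf)
  moreover have "G (map (map sc) us) x \<longleftrightarrow> (\<exists>w. x = map sc w \<and> occurs_in (wrap w) q)"
    if "F (map Fin us) = Some (Inf q)" for us :: "'s list list" and q x
  proof
    let ?o = "\<lambda>t. outp (config_at (prog T) (map Fin us) t)"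
    have W: "\<exists>t. n < length (?o t) \<and> ?o t ! n = q n" for n
      using that by (auto simp: T computes_def)
    have nth: "?o t ! n = q n" if "n < length (?o t)" for n t
      using W[of n] that outp_nth_mono by metis
    {
      assume "G (map (map sc) us) x"
      then obtain t y z where z: "map sc (?o t) = y @ wrapc (sc (1::'s)) (sc (0::'s)) x @ z"
        unfolding G_def sim_outp prefix_of_iff by auto
      then obtain y' r where r: "?o t = y' @ r" "wrapc (sc (1::'s)) (sc (0::'s)) x @ z = map sc r"
        by (auto simp: map_eq_append_conv)
      from r(2)[symmetric] obtain u z' where u': "r = u @ z'" "wrapc (sc (1::'s)) (sc (0::'s)) x = map sc u"
        by (auto simp: map_eq_append_conv)
      have u: "?o t = y' @ u @ z'" using r(1) u'(1) by simp
      \<comment> \<open>A list of numbers need not code a word; this one does, because its entries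
        are found on the output tape.\<close>
      have "set x \<subseteq> set (map sc u)" unfolding u'(2)[symmetric] by (auto simp: wrapc_def)
      then have "set x \<subseteq> range (sc :: 's \<Rightarrow> nat)" by auto
      then obtain w :: "'s list" where w: "x = map sc w" using map_scE by blast
      then have "map sc u = map sc (wrap w)" using u'(2) by (simp add: map_sc_wrap)
      then have "u = wrap w" by (simp only: map_sc_inject)
      then have "q (length y' + j) = wrap w ! j" if "j < length (wrap w)" for j
        using nth[of "length y' + j" t] that u by (simp add: nth_append)
      then show "\<exists>w. x = map sc w \<and> occurs_in (wrap w) q" using w unfolding occurs_in_def by blast
    next
      assume "\<exists>w. x = map sc w \<and> occurs_in (wrap w) q"
      then obtain w i where w: "x = map sc w" "\<And>j. j < length (wrap w) \<Longrightarrow> q (i + j) = wrap w ! j"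
        unfolding occurs_in_def by blast
      obtain t where t: "i + length (wrap w) < length (?o t)" using W by blast
      have "take (i + length (wrap w)) (?o t) = take i (?o t) @ wrap w"
      proof (rule nth_equalityI)
        show "length (take (i + length (wrap w)) (?o t)) = length (take i (?o t) @ wrap w)" using t by simp
        fix k assume "k < length (take (i + length (wrap w)) (?o t))"
        then have k: "k < i + length (wrap w)" by simp
        then have "?o t ! k = q k" using nth[of k t] t by simp
        moreover have "wrap w ! (k - i) = q k" if "\<not> k < i" using w(2)[of "k - i"] k that by simp
        ultimately show "take (i + length (wrap w)) (?o t) ! k = (take i (?o t) @ wrap w) ! k"
          using k t by (simp add: nth_append)
      qed
      then have "?o t = (take i (?o t) @ wrap w) @ drop (i + length (wrap w)) (?o t)"
        by (metis append_take_drop_id)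
      then have "map sc (?o t) = (map sc (take i (?o t)) @ map sc (wrap w)) @ map sc (drop (i + length (wrap w)) (?o t))"
        by (metis map_append)
      then show "G (map (map sc) us) x" unfolding G_def sim_outp prefix_of_iff w(1) map_sc_wrap by blast
    }
  qed
  ultimately show ?thesis by blast
qed

section \<open>Enumerability relative to the input\<close>

text \<open>Enumerable from finitely many cells of the input. By monotonicity in the stage, facts
  seen at different stages hold together at the latest one, as conjunctions and bounded quantifiers
  require.\<close>

definition rel_re :: "(('s::finite) str list \<Rightarrow> 'a::numbered \<Rightarrow> bool) \<Rightarrow> bool" where
  "rel_re P \<longleftrightarrow> (\<exists>Q. re (\<lambda>p. Q (fst p) (snd p)) \<and> (\<forall>ps x. P ps x \<longleftrightarrow> (\<exists>n. Q (buf ps n) x)) \<and>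
     (\<forall>(ps :: 's str list) x m n. m \<le> n \<longrightarrow> Q (buf ps m) x \<longrightarrow> Q (buf ps n) x))"

lemma rel_reE:
  fixes P :: "('s::finite) str list \<Rightarrow> 'a::numbered \<Rightarrow> bool"
  assumes "rel_re P"
  obtains Q where "re (\<lambda>p. Q (fst p) (snd p))" "\<And>ps x. P ps x \<longleftrightarrow> (\<exists>n. Q (buf ps n) x)"
    "\<And>(ps :: 's str list) x m n. m \<le> n \<Longrightarrow> Q (buf ps m) x \<Longrightarrow> Q (buf ps n) x"
  using assms unfolding rel_re_def by blast

text \<open>Monotonicity can be forced: \<open>Q\<close> is replaced by its disjunction over all
  earlier buffers, which are the tails of the present one.\<close>

lemma rel_reI:
  fixes P :: "('s::finite) str list \<Rightarrow> 'a::numbered \<Rightarrow> bool"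
  assumes "re (\<lambda>p. Q (fst p) (snd p))" "\<And>ps x. P ps x \<longleftrightarrow> (\<exists>n. Q (buf ps n) x)"
  shows "rel_re P"
proof -
  have past: "(\<exists>m. Q (drop m (buf ps n)) x) \<longleftrightarrow> (\<exists>m\<le>n. Q (buf ps m) x)" for ps :: "'s str list" and n x
  proof
    assume "\<exists>m. Q (drop m (buf ps n)) x"
    then obtain m where m: "Q (drop m (buf ps n)) x" ..
    have "drop m (buf ps n) = buf ps (n - m)"
      using drop_buf[of n "n - m" ps] by (cases "m \<le> n") auto
    then show "\<exists>m\<le>n. Q (buf ps m) x" using m by (metis diff_le_self)
  next
    assume "\<exists>m\<le>n. Q (buf ps m) x"
    then obtain m where "m \<le> n" "Q (buf ps m) x" by blast
    then show "\<exists>m. Q (drop m (buf ps n)) x" using drop_buf[of n m ps] by (intro exI[of _ "n - m"]) simp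
  qed
  show ?thesis unfolding rel_re_def
  proof (intro exI[of _ "\<lambda>b x. \<exists>m. Q (drop m b) x"] conjI allI impI)
    show "re (\<lambda>p. \<exists>m. Q (drop m (fst p)) (snd p))"
      by (intro re re_comp2[OF assms(1)] cf)
  qed (auto simp: past assms(2) intro: le_trans)
qed

named_theorems rre

lemma rel_re_re: "re P \<Longrightarrow> rel_re (\<lambda>ps. P)"
  by (rule rel_reI[of "\<lambda>_. P"]) (auto intro!: re_comp[of P] cf)

lemma rel_re_decidable: "decidable P \<Longrightarrow> rel_re (\<lambda>ps. P)"
  by (intro rel_re_re re_decidable)

lemma rel_re_comp: assumes "rel_re P" "compf g" shows "rel_re (\<lambda>ps x. P ps (g x))"
proof -
  from assms(1) obtain Q where Q: "re (\<lambda>p. Q (fst p) (snd p))" "\<And>ps x. P ps x \<longleftrightarrow> (\<exists>n. Q (buf ps n) x)"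
    by (rule rel_reE) blast
  show ?thesis
    by (rule rel_reI[of "\<lambda>b x. Q b (g x)"]) (auto simp: Q(2) intro!: re_comp2[OF Q(1)] compf_comp[OF assms(2)] cf)
qed

lemma rel_re_comp2:
  assumes "rel_re (\<lambda>ps p. P ps (fst p) (snd p))" "compf a" "compf b" shows "rel_re (\<lambda>ps x. P ps (a x) (b x))"
  using rel_re_comp[OF assms(1), of "\<lambda>x. (a x, b x)"] assms(2,3) by (simp add: cf)

lemma rel_re_comp3:
  assumes "rel_re (\<lambda>ps p. P ps (fst p) (fst (snd p)) (snd (snd p)))" "compf a" "compf b" "compf c"
  shows "rel_re (\<lambda>ps x. P ps (a x) (b x) (c x))"
  using rel_re_comp[OF assms(1), of "\<lambda>x. (a x, b x, c x)"] assms(2-) by (simp add: cf)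

lemma rel_re_conj [rre]:
  fixes P :: "('s::finite) str list \<Rightarrow> 'a::numbered \<Rightarrow> bool"
  assumes "rel_re P" "rel_re P'" shows "rel_re (\<lambda>ps x. P ps x \<and> P' ps x)"
proof -
  from assms(1) obtain Q where Q: "re (\<lambda>p. Q (fst p) (snd p))" "\<And>ps x. P ps x \<longleftrightarrow> (\<exists>n. Q (buf ps n) x)"
    "\<And>(ps :: 's str list) x m n. m \<le> n \<Longrightarrow> Q (buf ps m) x \<Longrightarrow> Q (buf ps n) x" by (rule rel_reE) blast
  from assms(2) obtain Q' where Q': "re (\<lambda>p. Q' (fst p) (snd p))" "\<And>ps x. P' ps x \<longleftrightarrow> (\<exists>n. Q' (buf ps n) x)"
    "\<And>(ps :: 's str list) x m n. m \<le> n \<Longrightarrow> Q' (buf ps m) x \<Longrightarrow> Q' (buf ps n) x" by (rule rel_reE) blast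
  have "(\<exists>n. Q (buf ps n) x) \<and> (\<exists>n. Q' (buf ps n) x) \<longleftrightarrow> (\<exists>n. Q (buf ps n) x \<and> Q' (buf ps n) x)" for ps :: "'s str list" and x
    using Q(3)[of _ _ ps x] Q'(3)[of _ _ ps x] by (meson max.cobounded1 max.cobounded2)
  then show ?thesis
    by (intro rel_reI[of "\<lambda>b x. Q b x \<and> Q' b x"] re Q(1) Q'(1)) (simp add: Q(2) Q'(2))
qed

lemma rel_re_disj [rre]: assumes "rel_re P" "rel_re P'" shows "rel_re (\<lambda>ps x. P ps x \<or> P' ps x)"
proof -
  from assms(1) obtain Q where Q: "re (\<lambda>p. Q (fst p) (snd p))" "\<And>ps x. P ps x \<longleftrightarrow> (\<exists>n. Q (buf ps n) x)"
    by (rule rel_reE) blast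
  from assms(2) obtain Q' where Q': "re (\<lambda>p. Q' (fst p) (snd p))" "\<And>ps x. P' ps x \<longleftrightarrow> (\<exists>n. Q' (buf ps n) x)"
    by (rule rel_reE) blast
  show ?thesis
    by (intro rel_reI[of "\<lambda>b x. Q b x \<or> Q' b x"] re Q(1) Q'(1)) (auto simp: Q(2) Q'(2))
qed

lemma rel_re_ex [rre]: assumes "rel_re (\<lambda>ps p. P ps (fst p) (snd p))" shows "rel_re (\<lambda>ps x. \<exists>y. P ps x y)"
proof -
  from assms obtain Q where Q: "re (\<lambda>p. Q (fst p) (snd p))" "\<And>ps x. P ps (fst x) (snd x) \<longleftrightarrow> (\<exists>n. Q (buf ps n) x)"
    by (rule rel_reE) blast
  have "P ps x y \<longleftrightarrow> (\<exists>n. Q (buf ps n) (x, y))" for ps x y using Q(2)[of ps "(x, y)"] by simp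
  moreover have "re (\<lambda>p. \<exists>y. Q (fst p) (snd p, y))" by (intro re re_comp2[OF Q(1)] cf)
  ultimately show ?thesis by (intro rel_reI[of "\<lambda>b x. \<exists>y. Q b (x, y)"]) auto
qed

lemma rel_re_ball [rre]:
  fixes P :: "('s::finite) str list \<Rightarrow> 'a::numbered \<Rightarrow> nat \<Rightarrow> bool"
  assumes "rel_re (\<lambda>ps p. P ps (fst p) (snd p))" "compf N" shows "rel_re (\<lambda>ps x. \<forall>i<N x. P ps x i)"
proof -
  from assms(1) obtain Q where Q: "re (\<lambda>p. Q (fst p) (snd p))" "\<And>ps x. P ps (fst x) (snd x) \<longleftrightarrow> (\<exists>n. Q (buf ps n) x)"
    "\<And>(ps :: 's str list) x m n. m \<le> n \<Longrightarrow> Q (buf ps m) x \<Longrightarrow> Q (buf ps n) x" by (rule rel_reE) blast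
  have P: "P ps x y \<longleftrightarrow> (\<exists>n. Q (buf ps n) (x, y))" for ps x y using Q(2)[of ps "(x, y)"] by simp
  have "(\<forall>i<k. \<exists>n. Q (buf ps n) (x, i)) \<longleftrightarrow> (\<exists>n. \<forall>i<k. Q (buf ps n) (x, i))" for ps :: "'s str list" and x k
  proof (induction k)
    case (Suc k)
    show ?case unfolding All_less_Suc Suc.IH using Q(3)[of _ _ ps] by (meson max.cobounded1 max.cobounded2)
  qed simp
  moreover have "re (\<lambda>p. \<forall>i<N (snd p). Q (fst p) (snd p, i))"
    by (intro re re_comp2[OF Q(1)] cf compf_comp[OF assms(2)])
  ultimately show ?thesis by (intro rel_reI[of "\<lambda>b x. \<forall>i<N x. Q b (x, i)"]) (auto simp: P)
qed

definition cells :: "('s::finite) str list \<Rightarrow> nat \<Rightarrow> nat \<Rightarrow> nat list" where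
  "cells ps j n = map (\<lambda>i. symc (in_cell ps j i)) [0..<n]"

lemma rel_re_cells:
  assumes "decidable (\<lambda>p. D (fst p) (snd p))" "j \<in> {0, 1}" shows "rel_re (\<lambda>(ps :: ('s::finite) str list) x. \<exists>n. D (cells ps j n) x)"
proof -
  have c: "cells ps 0 n = map fst (rev (buf ps n))" "cells ps 1 n = map snd (rev (buf ps n))" for ps :: "'s str list" and n
    by (simp_all add: cells_def buf_def)
  have 0: "re (\<lambda>p. D (map fst (rev (fst p :: (nat \<times> nat) list))) (snd p))"
    "re (\<lambda>p. D (map snd (rev (fst p :: (nat \<times> nat) list))) (snd p))"
    by (intro re_decidable decidable_comp2[OF assms(1)] cf)+
  have "rel_re (\<lambda>(ps :: 's str list) x. \<exists>n. D (cells ps 0 n) x)"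
    by (rule rel_reI[of "\<lambda>b. D (map fst (rev b))", OF 0(1)]) (simp add: c)
  moreover have "rel_re (\<lambda>(ps :: 's str list) x. \<exists>n. D (cells ps 1 n) x)"
    by (rule rel_reI[of "\<lambda>b. D (map snd (rev b))", OF 0(2)]) (simp only: c)
  ultimately show ?thesis using assms(2) by auto
qed

lemma enumerating_machine_rel_re:
  assumes "rel_re (\<lambda>ps p. V ps (fst p) (snd p))"
  shows "\<exists>F :: ('s::{finite,zero_neq_one}) str list \<rightharpoonup> 's str. computable_string_fun F \<and>
    (\<forall>ps. list_all2 of_kind ks ps \<and> (\<forall>k. \<exists>x :: 's list. V ps k (map sc x)) \<and>
       (\<forall>k w. V ps k w \<longrightarrow> w \<in> range (map sc :: 's list \<Rightarrow> nat list)) \<longrightarrow>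
       (\<exists>x. F ps = Some (Inf (seq_tuple x)) \<and> (\<forall>k. V ps k (map sc (x k)))))"
proof -
  from assms obtain Q where Q: "re (\<lambda>p. Q (fst p) (snd p))" "\<And>ps x. V ps (fst x) (snd x) \<longleftrightarrow> (\<exists>n. Q (buf ps n) x)"
    by (rule rel_reE) blast
  have V: "V ps k w \<longleftrightarrow> (\<exists>n. Q (buf ps n) (k, w))" for ps k w using Q(2)[of ps "(k, w)"] by simp
  from enumerating_machine[of "\<lambda>b k w. Q b (k, w)" ks, where ?'s = 's] Q(1)
  obtain F :: "'s str list \<rightharpoonup> 's str" where F: "computable_string_fun F"
    "\<And>ps. list_all2 of_kind ks ps \<and> (\<forall>k. \<exists>n. \<exists>x :: 's list. Q (buf ps n) (k, map sc x)) \<and>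
       (\<forall>n k w. Q (buf ps n) (k, w) \<longrightarrow> w \<in> range (map sc :: 's list \<Rightarrow> nat list)) \<Longrightarrow>
       (\<exists>x. F ps = Some (Inf (seq_tuple x)) \<and> (\<forall>k. \<exists>n. Q (buf ps n) (k, map sc (x k))))"
    by auto
  show ?thesis
  proof (intro exI[of _ F] conjI allI impI F(1))
    fix ps assume "list_all2 of_kind ks ps \<and> (\<forall>k. \<exists>x :: 's list. V ps k (map sc x)) \<and>
       (\<forall>k w. V ps k w \<longrightarrow> w \<in> range (map sc :: 's list \<Rightarrow> nat list))"
    then show "\<exists>x. F ps = Some (Inf (seq_tuple x)) \<and> (\<forall>k. V ps k (map sc (x k)))"
      unfolding V by (intro F(2)) blast
  qed
qed

section \<open>Wrapped words\<close>

text \<open>Behind the start marker the text is read in pairs: the second entry of a pair is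
  \<open>o0\<close> for every letter of the word and \<open>o1\<close> only for the closing pair,
  which fixes where the word ends.\<close>

lemma wrapc_append_inject:
  assumes "o1 \<noteq> o0" "wrapc o1 o0 u @ x = wrapc o1 o0 v @ y" shows "u = v \<and> x = y"
proof -
  have "concat (map (\<lambda>a. [a, o0]) u) @ [o1, o1] @ x = concat (map (\<lambda>a. [a, o0]) v) @ [o1, o1] @ y"
    using assms(2) by (simp add: wrapc_def)
  then show ?thesis
  proof (induction u arbitrary: v)
    case Nil
    then show ?case using assms(1) by (cases v) auto
  next
    case (Cons a u)
    then show ?case using assms(1) by (cases v) auto
  qed
qed

lemma wrapc_concat_inject:
  assumes "o1 \<noteq> o0" "length us = length vs"
    "concat (map (wrapc o1 o0) us) @ x = concat (map (wrapc o1 o0) vs) @ y"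
  shows "us = vs \<and> x = y"
  using assms(2,3)
proof (induction us vs rule: list_induct2)
  case (Cons u us v vs)
  from Cons.prems have "wrapc o1 o0 u @ (concat (map (wrapc o1 o0) us) @ x) = wrapc o1 o0 v @ (concat (map (wrapc o1 o0) vs) @ y)"
    by simp
  from wrapc_append_inject[OF assms(1) this] Cons.IH show ?case by simp
qed simp

lemma sc_1_neq_0: "sc (1 :: 's::{finite,zero_neq_one}) \<noteq> sc (0 :: 's)"
  by simp

lemma wrap_append_inject:
  fixes u v :: "('s::{finite,zero_neq_one}) list"
  assumes "wrap u @ x = wrap v @ y" shows "u = v"
proof -
  from assms have "map sc (wrap u) @ map sc x = map sc (wrap v) @ map sc y" by (metis map_append)
  from wrapc_append_inject[OF sc_1_neq_0[where ?'s = 's] this[unfolded map_sc_wrap]] show ?thesis by simp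
qed

text \<open>The four 1s are the end of one wrapped word and the beginning of the next. A start
  marker cannot begin at either entry of a pair \<open>[a, 0]\<close>, since one of its first two
  symbols would be 0, nor at the first two of the four 1s, where its third symbol would be
  1.\<close>

lemma no_start_inside:
  assumes "take 3 (drop r (concat (map (\<lambda>a. [a, 0]) v) @ [1, 1, 1, 1] @ z)) = [1, 1, 0 :: 's::zero_neq_one]"
  shows "2 * length v + 2 \<le> r"
  using assms
proof (induction v arbitrary: r)
  case Nil
  then have "r \<noteq> 0" "r \<noteq> 1" by (intro notI; simp add: numeral_3_eq_3)+
  then show ?case by simp
next
  case (Cons a v)
  then have "r \<noteq> 0" "r \<noteq> 1" by (intro notI; simp add: numeral_3_eq_3)+
  then obtain r' where "r = Suc (Suc r')" by (metis One_nat_def not0_implies_Suc)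
  then show ?case using Cons by simp
qed

lemma wrap_start:
  assumes "take 3 (drop r (wrap v @ [1, 1] @ z)) = [1, 1, 0 :: 's::zero_neq_one]" "r < length (wrap v)"
  shows "r = 0"
proof (rule ccontr)
  assume "r \<noteq> 0"
  moreover have "r \<noteq> 1" "r \<noteq> 2" using assms(1) by (auto simp: wrap_def numeral_3_eq_3 numeral_2_eq_2)
  ultimately have "r \<ge> 3" by simp
  then obtain r' where r: "r = 3 + r'" using le_Suc_ex by blast
  have "take 3 (drop r' (concat (map (\<lambda>a. [a, 0]) v) @ [1, 1, 1, 1] @ z)) = [1, 1, 0]"
    using assms(1) by (simp add: r wrap_def numeral_3_eq_3)
  from no_start_inside[OF this] have "length (wrap v) \<le> r"
    by (simp add: r wrap_def length_concat comp_def sum_list_triv)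
  then show False using assms(2) by simp
qed

lemma block_position: "\<exists>n r. i = length (wraps x n) + r \<and> r < length (wrap (x n))"
proof (induction i)
  case 0
  show ?case by (intro exI[of _ 0]) (simp add: wrap_def)
next
  case (Suc i)
  then obtain n r where nr: "i = length (wraps x n) + r" "r < length (wrap (x n))" by blast
  show ?case
  proof (cases "Suc r < length (wrap (x n))")
    case True
    then show ?thesis using nr(1) by (intro exI[of _ n] exI[of _ "Suc r"]) simp
  next
    case False
    then show ?thesis using nr by (intro exI[of _ "Suc n"] exI[of _ 0]) (simp add: wrap_def)
  qed
qed

lemma take_drop_wraps:
  assumes "\<And>j. j < length u \<Longrightarrow> seq_tuple x (i + j) = u ! j" "i + length u \<le> length (wraps x N)"
  shows "take (length u) (drop i (wraps x N)) = u"
proof (rule nth_equalityI)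
  show l: "length (take (length u) (drop i (wraps x N))) = length u" using assms(2) by simp
  fix k assume "k < length (take (length u) (drop i (wraps x N)))"
  then have "k < length u" using l by simp
  then show "take (length u) (drop i (wraps x N)) ! k = u ! k"
    using assms seq_tuple_nth[of "i + k" x N] by simp
qed

text \<open>A start marker occurs in a tuple only where a component begins, and unique decoding then
  identifies that component. Hence a tuple is at the same time an enumeration of exactly its
  components.\<close>

lemma occurs_in_seq_tuple:
  fixes x :: "nat \<Rightarrow> ('s::{finite,zero_neq_one}) list"
  shows "occurs_in (wrap w) (seq_tuple x) \<longleftrightarrow> w \<in> range x"
proof
  assume "occurs_in (wrap w) (seq_tuple x)"
  then obtain i where i: "\<And>j. j < length (wrap w) \<Longrightarrow> seq_tuple x (i + j) = wrap w ! j"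
    unfolding occurs_in_def by blast
  obtain n r where nr: "i = length (wraps x n) + r" "r < length (wrap (x n))" using block_position by blast
  \<comment> \<open>Large enough for the prefix to contain the whole occurrence and also the block
    after the \<open>n\<close>-th, whose leading \<open>[1, 1]\<close> is needed for
    \<open>wrap_start\<close>.\<close>
  define N where "N = i + length (wrap w) + n + 2"
  have len: "i + length (wrap w) \<le> length (wraps x N)" using length_wraps[of N x] by (simp add: N_def)
  have "Suc (Suc n) \<le> N" by (simp add: N_def)
  then obtain z0 where z0: "wraps x N = wraps x (Suc (Suc n)) @ z0" using wraps_le by blast
  obtain z where z: "wraps x N = wraps x n @ wrap (x n) @ [1, 1] @ z" using z0 by (simp add: wrap_def)
  have "take (length (wrap w)) (drop i (wraps x N)) = wrap w" by (rule take_drop_wraps[OF i len])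
  then have w: "take (length (wrap w)) (drop r (wrap (x n) @ [1, 1] @ z)) = wrap w"
    unfolding z nr(1) by simp
  have "take 3 (take (length (wrap w)) (drop r (wrap (x n) @ [1, 1] @ z))) = [1, 1, 0]"
    unfolding w by (simp add: wrap_def numeral_3_eq_3)
  moreover have "3 \<le> length (wrap w)" by (simp add: wrap_def)
  ultimately have "take 3 (drop r (wrap (x n) @ [1, 1] @ z)) = [1, 1, 0]" by (simp only: take_take min_absorb1)
  then have "r = 0" using wrap_start nr(2) by blast
  then have "wrap (x n) @ ([1, 1] @ z) = wrap w @ drop (length (wrap w)) (wrap (x n) @ [1, 1] @ z)"
    using w by (metis append_take_drop_id drop0)
  then show "w \<in> range x" using wrap_append_inject by blast
next
  assume "w \<in> range x"
  then obtain n where w: "w = x n" by blast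
  have "seq_tuple x (length (wraps x n) + j) = wrap (x n) ! j" if "j < length (wrap (x n))" for j
    using seq_tuple_nth[of "length (wraps x n) + j" x "Suc n"] that by (simp add: nth_append)
  then show "occurs_in (wrap w) (seq_tuple x)" unfolding occurs_in_def w by blast
qed

text \<open>
  For the words to be enumerated, the \<open>k\<close>-th output word is the word tested by the candidate \<open>k\<close> if
  the test succeeds, and any word of the set otherwise.
\<close>

theorem enumerating_set_machine:
  assumes "rel_re Q"
  shows "\<exists>F :: ('s::{finite,zero_neq_one}) str list \<rightharpoonup> 's str. computable_string_fun F \<and>
    (\<forall>ps. list_all2 of_kind ks ps \<and> (\<exists>x :: 's list. Q ps (map sc x)) \<and>
       (\<forall>w. Q ps w \<longrightarrow> w \<in> range (map sc :: 's list \<Rightarrow> nat list)) \<longrightarrow>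
       (\<exists>q. F ps = Some (Inf q) \<and> (\<forall>w. occurs_in (wrap w) q \<longleftrightarrow> Q ps (map sc w))))"
proof -
  from assms obtain G where G: "re (\<lambda>p. G (fst p) (snd p))" "\<And>ps x. Q ps x \<longleftrightarrow> (\<exists>n. G (buf ps n) x)"
    by (rule rel_reE) blast
  from G(1) obtain T where T: "decidable T" "\<And>b x. G b x \<longleftrightarrow> (\<exists>t::nat. T ((b, x), t))"
    unfolding re_def by (metis fst_conv snd_conv)
  define cand :: "nat \<Rightarrow> nat \<times> nat list \<times> nat" where "cand k = dec k" for k
  \<comment> \<open>Once \<open>fst (cand k)\<close> cells are read, the outcome of the decidable
    test \<open>T\<close> is settled for good. Failure is thus recognized as effectively as success,
    and the implication does not spoil enumerability.\<close>
  define D where "D b k w \<longleftrightarrow> fst (cand k) \<le> length b \<and>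
    (T ((drop (length b - fst (cand k)) b, fst (snd (cand k))), snd (snd (cand k))) \<longrightarrow> w = fst (snd (cand k)))" for b k w
  have D: "D (buf ps n) k w \<longleftrightarrow> fst (cand k) \<le> n \<and>
      (T ((buf ps (fst (cand k)), fst (snd (cand k))), snd (snd (cand k))) \<longrightarrow> w = fst (snd (cand k)))"
    for ps :: "'s str list" and n k w
    unfolding D_def length_buf drop_buf by (metis min_absorb2)
  define V where "V ps k w \<longleftrightarrow> Q ps w \<and> (\<exists>n. D (buf ps n) k w)" for ps :: "'s str list" and k w
  have "re (\<lambda>p. D (fst p) (fst (snd p)) (snd (snd p)))"
    unfolding D_def cand_def by (intro re_decidable dc cf decidable_comp[OF T(1)])
  then have D_re: "rel_re (\<lambda>(ps :: 's str list) p. \<exists>n. D (buf ps n) (fst p) (snd p))"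
    by (rule rel_reI) simp
  have "rel_re (\<lambda>ps p. V ps (fst p) (snd p))"
    unfolding V_def by (intro rel_re_conj D_re rel_re_comp[OF assms] cf)
  from enumerating_machine_rel_re[OF this, where ks = ks]
  obtain F :: "'s str list \<rightharpoonup> 's str" where F: "computable_string_fun F"
    "\<And>ps. list_all2 of_kind ks ps \<and> (\<forall>k. \<exists>x :: 's list. V ps k (map sc x)) \<and>
       (\<forall>k w. V ps k w \<longrightarrow> w \<in> range (map sc :: 's list \<Rightarrow> nat list)) \<Longrightarrow>
       (\<exists>x. F ps = Some (Inf (seq_tuple x)) \<and> (\<forall>k. V ps k (map sc (x k))))" by blast
  show ?thesis
  proof (intro exI[of _ F] conjI allI impI F(1))
    fix ps
    assume *: "list_all2 of_kind ks ps \<and> (\<exists>x :: 's list. Q ps (map sc x)) \<and>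
       (\<forall>w. Q ps w \<longrightarrow> w \<in> range (map sc :: 's list \<Rightarrow> nat list))"
    have "\<exists>x :: 's list. V ps k (map sc x)" for k
    proof (cases "T ((buf ps (fst (cand k)), fst (snd (cand k))), snd (snd (cand k)))")
      case True
      then have Q: "Q ps (fst (snd (cand k)))" using G(2) T(2) by blast
      then obtain x :: "'s list" where "fst (snd (cand k)) = map sc x" using * by blast
      then show ?thesis using Q unfolding V_def D by (metis order_refl)
    next
      case False
      then show ?thesis using * unfolding V_def D by blast
    qed
    then obtain x where x: "F ps = Some (Inf (seq_tuple x))" "\<And>k. V ps k (map sc (x k))"
      using F(2)[of ps] * unfolding V_def by blast
    have "w \<in> range x \<longleftrightarrow> Q ps (map sc w)" for w
    proof
      assume "w \<in> range x"
      then show "Q ps (map sc w)" using x(2) unfolding V_def by blast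
    next
      assume "Q ps (map sc w)"
      then obtain n t where t: "T ((buf ps n, map sc w), t)" using G(2) T(2) by blast
      define k where "k = enc (n, map sc w, t)"
      have "cand k = (n, map sc w, t)" by (simp only: cand_def k_def dec_enc)
      then have "map sc (x k) = map sc w" using x(2)[of k] t unfolding V_def D by simp
      then show "w \<in> range x" by auto
    qed
    then show "\<exists>q. F ps = Some (Inf q) \<and> (\<forall>w. occurs_in (wrap w) q \<longleftrightarrow> Q ps (map sc w))"
      using x(1) occurs_in_seq_tuple by blast
  qed
qed

subsection \<open>Reading the components of a tuple\<close>

definition word_at :: "('s::{finite,zero_neq_one}) str list \<Rightarrow> nat \<Rightarrow> nat \<Rightarrow> nat list \<Rightarrow> bool" where
  "word_at ps j n w \<longleftrightarrow> (\<exists>ws m. length ws = n \<and>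
     prefix_of (concat (map (wrapc (sc (1::'s)) (sc (0::'s))) (ws @ [w]))) (cells ps j m))"

lemma rel_re_word_at:
  assumes "j \<in> {0, 1}" shows "rel_re (\<lambda>(ps :: ('s::{finite,zero_neq_one}) str list) p. word_at ps j (fst p) (snd p))"
proof -
  have "rel_re (\<lambda>(ps :: 's str list) p. \<exists>ws m. length ws = fst p \<and>
     prefix_of (concat (map (wrapc (sc (1::'s)) (sc (0::'s))) (ws @ [snd p]))) (cells ps j m))"
    by (intro rre rel_re_cells[OF _ assms, where D = "\<lambda>l x. length (snd x) = fst (fst x) \<and>
     prefix_of (concat (map (wrapc (sc (1::'s)) (sc (0::'s))) (snd x @ [snd (fst x)]))) l"] dc cf)
  then show ?thesis unfolding word_at_def .
qed

lemma map_sc_wraps: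
  "map sc (wraps x n) = concat (map (wrapc (sc (1::'s)) (sc (0::'s))) (map (\<lambda>i. map sc (x i)) [0..<n]))"
  for x :: "nat \<Rightarrow> ('s::{finite,zero_neq_one}) list"
  by (simp add: map_concat comp_def map_sc_wrap)

lemma cells_seq_tuple:
  assumes "j < length ps" "ps ! j = Inf (seq_tuple x)" "m \<le> length (wraps x N)"
  shows "cells ps j m = map sc (take m (wraps x N))"
  by (rule nth_equalityI) (use assms seq_tuple_nth[of _ x N] in \<open>auto simp: cells_def in_cell_def\<close>)

text \<open>\<open>wrapc_concat_inject\<close> leaves no choice for the guessed earlier components,
  so the parsed word is the \<open>n\<close>-th one.\<close>

lemma word_at_seq_tuple:
  fixes x :: "nat \<Rightarrow> ('s::{finite,zero_neq_one}) list"
  assumes "j < length ps" "ps ! j = Inf (seq_tuple x)"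
  shows "word_at ps j n w \<longleftrightarrow> w = map sc (x n)"
proof
  let ?c = "\<lambda>ws. concat (map (wrapc (sc (1::'s)) (sc (0::'s))) ws)"
  assume "word_at ps j n w"
  then obtain ws m where ws: "length ws = n" "prefix_of (?c (ws @ [w])) (cells ps j m)"
    unfolding word_at_def by blast
  define N where "N = m + Suc n"
  have m: "m \<le> length (wraps x N)" using length_wraps[of N x] by (simp add: N_def)
  have "map sc (wraps x N) = cells ps j m @ map sc (drop m (wraps x N))"
    unfolding cells_seq_tuple[OF assms m] by (metis append_take_drop_id map_append)
  then obtain z where z: "map sc (wraps x N) = ?c (ws @ [w]) @ z"
    using ws(2) unfolding prefix_of_iff by (metis append.assoc)
  have "Suc n \<le> N" by (simp add: N_def)
  then obtain y where "wraps x N = wraps x (Suc n) @ y" using wraps_le by blast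
  then have "map sc (wraps x N) = ?c (map (\<lambda>i. map sc (x i)) [0..<Suc n]) @ map sc y"
    by (metis map_append map_sc_wraps)
  with z have "?c (ws @ [w]) @ z = ?c (map (\<lambda>i. map sc (x i)) [0..<Suc n]) @ map sc y" by simp
  from wrapc_concat_inject[OF sc_1_neq_0 _ this] ws(1) show "w = map sc (x n)" by simp
next
  assume w: "w = map sc (x n)"
  define m where "m = length (wraps x (Suc n))"
  have "cells ps j m = map sc (wraps x (Suc n))"
    using cells_seq_tuple[OF assms, of m "Suc n"] by (simp add: m_def del: upt_Suc)
  then show "word_at ps j n w" unfolding word_at_def map_sc_wraps prefix_of_iff
    by (intro exI[of _ "map (\<lambda>i. map sc (x i)) [0..<n]"] exI[of _ m] conjI exI[of _ "[]"]) (simp_all add: w)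
qed

section \<open>Codes of numbers\<close>

text \<open>This and the next two predicates mirror \<open>nat_word\<close>, \<open>rat_word\<close>
  and \<open>interval_word\<close> on lists of symbol codes. Rationals are kept as triples of
  naturals, so that all later comparisons are between natural numbers.\<close>

definition nat_code :: "nat \<Rightarrow> nat \<Rightarrow> nat list \<Rightarrow> nat \<Rightarrow> bool" where
  "nat_code o1 o0 x n \<longleftrightarrow> (x = [o0] \<or> take 1 x = [o1] \<and> (\<forall>a\<in>set x. a = o1 \<or> a = o0)) \<and>
     n = foldr (\<lambda>a r. of_bool (a = o1) + 2 * r) (rev x) 0"

definition rat_code :: "nat \<Rightarrow> nat \<Rightarrow> nat list \<Rightarrow> nat \<times> nat \<times> nat \<Rightarrow> bool" where
  "rat_code o1 o0 x t \<longleftrightarrow> snd (snd t) \<noteq> 0 \<and> (\<exists>u v w. x = wrapc o1 o0 u @ wrapc o1 o0 v @ wrapc o1 o0 w \<and>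
     nat_code o1 o0 u (fst t) \<and> nat_code o1 o0 v (fst (snd t)) \<and> nat_code o1 o0 w (snd (snd t)))"

definition interval_code :: "nat \<Rightarrow> nat \<Rightarrow> nat list \<Rightarrow> (nat \<times> nat \<times> nat) \<times> (nat \<times> nat \<times> nat) \<Rightarrow> bool" where
  "interval_code o1 o0 x t \<longleftrightarrow> (\<exists>u v. x = wrapc o1 o0 u @ wrapc o1 o0 v \<and>
     rat_code o1 o0 u (fst t) \<and> rat_code o1 o0 v (snd t))"

lemma decidable_nat_code [dc]:
  "compf f \<Longrightarrow> compf g \<Longrightarrow> decidable (\<lambda>p. nat_code o1 o0 (f p) (g p))"
  unfolding nat_code_def by (intro dc cf)

lemma re_rat_code: "re (\<lambda>p. rat_code o1 o0 (fst p) (snd p))"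
  unfolding rat_code_def by (intro re re_decidable dc cf)

lemma re_interval_code: "re (\<lambda>p. interval_code o1 o0 (fst p) (snd p))"
  unfolding interval_code_def by (intro re re_comp2[OF re_rat_code] re_decidable dc cf)

lemma nat_code_iff:
  "nat_code (sc (1::'s::{finite,zero_neq_one})) (sc (0::'s)) x n \<longleftrightarrow> (\<exists>w :: 's list. x = map sc w \<and> nat_word w = Some n)"
proof -
  have val: "foldr (\<lambda>a r. of_bool (a = sc (1::'s)) + 2 * r) (rev (map sc w)) 0 =
      (horner_sum of_bool 2 (map (\<lambda>a. a = 1) (rev w)) :: nat)" for w :: "'s list"
    by (simp add: rev_map horner_sum_foldr foldr_map comp_def)
  have hd: "take 1 (map sc w) = [sc (1::'s)] \<longleftrightarrow> (\<exists>v. w = 1 # v)" for w :: "'s list"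
    by (cases w) auto
  have zero: "map sc w = [sc (0::'s)] \<longleftrightarrow> w = [0]" for w :: "'s list"
    using map_sc_inject[of w "[0]"] by simp
  have all: "(\<forall>a\<in>set (map sc w). a = sc (1::'s) \<or> a = sc (0::'s)) \<longleftrightarrow> set w \<subseteq> {0, 1}" for w :: "'s list"
    by auto
  have mp: "nat_code (sc (1::'s)) (sc (0::'s)) (map sc w) n \<longleftrightarrow> nat_word w = Some n" for w :: "'s list"
    unfolding nat_code_def val hd zero all nat_word_def by auto
  show ?thesis
  proof
    assume *: "nat_code (sc (1::'s)) (sc (0::'s)) x n"
    then have "set x \<subseteq> range (sc :: 's \<Rightarrow> nat)" unfolding nat_code_def by auto
    then obtain w :: "'s list" where "x = map sc w" by (rule map_scE)
    then show "\<exists>w :: 's list. x = map sc w \<and> nat_word w = Some n" using * mp by blast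
  qed (use mp in blast)
qed

lemma ex_nat_word: "\<exists>w :: ('s::zero_neq_one) list. nat_word w = Some n"
proof (induction n rule: less_induct)
  case (less n)
  show ?case
  proof (cases "n < 2")
    case True
    then consider "n = 0" | "n = 1" by linarith
    then show ?thesis
    proof cases
      case 1
      then show ?thesis by (intro exI[of _ "[0]"]) (simp add: nat_word_def)
    next
      case 2
      then show ?thesis by (intro exI[of _ "[1]"]) (simp add: nat_word_def)
    qed
  next
    case False
    then obtain w :: "'s list" where w: "nat_word w = Some (n div 2)" using less[of "n div 2"] by auto
    \<comment> \<open>\<open>n div 2\<close> is positive, so its word begins with 1 and appending a
      digit creates no leading zero.\<close>
    have "w \<noteq> [0]" using w False by (auto simp: nat_word_def)
    then obtain v where v: "w = 1 # v" "set v \<subseteq> {0, 1}"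
      "horner_sum of_bool 2 (map (\<lambda>a. a = 1) (rev w)) = n div 2"
      using w by (auto simp: nat_word_def split: if_splits)
    define b :: 's where "b = of_bool (odd n)"
    have "nat_word (w @ [b]) = Some (of_bool (b = 1) + 2 * (n div 2))"
      using v(2) unfolding v(3)[symmetric] by (auto simp: nat_word_def v(1) b_def)
    moreover have "of_bool (b = 1) + 2 * (n div 2) = n" by (cases "odd n") (auto simp: b_def)
    ultimately show ?thesis by metis
  qed
qed

definition rat_val :: "nat \<times> nat \<times> nat \<Rightarrow> rat" where
  "rat_val t = (of_nat (fst t) - of_nat (fst (snd t))) / of_nat (snd (snd t))"

lemma rat_word_code:
  "q \<in> rat_word (w :: ('s::{finite,zero_neq_one}) list) \<longleftrightarrow> (\<exists>t. rat_code (sc (1::'s)) (sc (0::'s)) (map sc w) t \<and> q = rat_val t)"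
proof
  assume "q \<in> rat_word w"
  then obtain i j k u v z where *: "q = (of_nat i - of_nat j) / of_nat k" "w = wrap u @ wrap v @ wrap z"
     "nat_word u = Some i" "nat_word v = Some j" "nat_word z = Some k" "k \<noteq> 0"
    unfolding rat_word_def by blast
  have "rat_code (sc (1::'s)) (sc (0::'s)) (map sc w) (i, j, k)"
    unfolding rat_code_def fst_conv snd_conv nat_code_iff
    using * by (intro conjI exI[of _ "map sc u"] exI[of _ "map sc v"] exI[of _ "map sc z"]) (auto simp: map_sc_wrap)
  then show "\<exists>t. rat_code (sc (1::'s)) (sc (0::'s)) (map sc w) t \<and> q = rat_val t"
    using *(1) by (intro exI[of _ "(i, j, k)"]) (simp add: rat_val_def)
next
  assume "\<exists>t. rat_code (sc (1::'s)) (sc (0::'s)) (map sc w) t \<and> q = rat_val t"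
  then obtain t and u v z :: "'s list" where *: "q = rat_val t" "snd (snd t) \<noteq> 0"
    "map sc w = wrapc (sc (1::'s)) (sc (0::'s)) (map sc u) @ wrapc (sc (1::'s)) (sc (0::'s)) (map sc v) @
      wrapc (sc (1::'s)) (sc (0::'s)) (map sc z)"
    "nat_word u = Some (fst t)" "nat_word v = Some (fst (snd t))" "nat_word z = Some (snd (snd t))"
    unfolding rat_code_def nat_code_iff by blast
  have "map sc w = map sc (wrap u @ wrap v @ wrap z)" unfolding map_append map_sc_wrap by (rule *(3))
  then have "w = wrap u @ wrap v @ wrap z" by (simp only: map_sc_inject)
  then show "q \<in> rat_word w" unfolding rat_word_def using * unfolding rat_val_def by blast
qed

lemma rat_code_range:
  assumes "rat_code (sc (1::'s::{finite,zero_neq_one})) (sc (0::'s)) x t" shows "\<exists>w :: 's list. x = map sc w"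
proof -
  from assms obtain u v z :: "'s list" where
    "x = wrapc (sc (1::'s)) (sc (0::'s)) (map sc u) @ wrapc (sc (1::'s)) (sc (0::'s)) (map sc v) @
      wrapc (sc (1::'s)) (sc (0::'s)) (map sc z)"
    unfolding rat_code_def nat_code_iff by blast
  then have "x = map sc (wrap u @ wrap v @ wrap z)" unfolding map_append map_sc_wrap .
  then show ?thesis by blast
qed

lemma interval_word_code:
  "(a, b) \<in> interval_word (w :: ('s::{finite,zero_neq_one}) list) \<longleftrightarrow>
     (\<exists>s t. interval_code (sc (1::'s)) (sc (0::'s)) (map sc w) (s, t) \<and> a = rat_val s \<and> b = rat_val t)"
proof
  assume "(a, b) \<in> interval_word w"
  then obtain u v where uv: "w = wrap u @ wrap v" "a \<in> rat_word u" "b \<in> rat_word v"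
    unfolding interval_word_def by blast
  then show "\<exists>s t. interval_code (sc (1::'s)) (sc (0::'s)) (map sc w) (s, t) \<and> a = rat_val s \<and> b = rat_val t"
    unfolding rat_word_code interval_code_def fst_conv snd_conv by (metis map_append map_sc_wrap)
next
  assume "\<exists>s t. interval_code (sc (1::'s)) (sc (0::'s)) (map sc w) (s, t) \<and> a = rat_val s \<and> b = rat_val t"
  then obtain s t u v where *: "map sc w = wrapc (sc (1::'s)) (sc (0::'s)) u @ wrapc (sc (1::'s)) (sc (0::'s)) v"
    "rat_code (sc (1::'s)) (sc (0::'s)) u s" "rat_code (sc (1::'s)) (sc (0::'s)) v t" "a = rat_val s" "b = rat_val t"
    unfolding interval_code_def by auto
  obtain u' v' :: "'s list" where uv: "u = map sc u'" "v = map sc v'" using rat_code_range *(2,3) by blast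
  have "map sc w = map sc (wrap u' @ wrap v')" unfolding map_append map_sc_wrap using *(1) uv by simp
  then have "w = wrap u' @ wrap v'" by (simp only: map_sc_inject)
  then show "(a, b) \<in> interval_word w" unfolding interval_word_def using * uv rat_word_code by blast
qed

lemma interval_code_range:
  assumes "interval_code (sc (1::'s::{finite,zero_neq_one})) (sc (0::'s)) x t" shows "\<exists>w :: 's list. x = map sc w"
proof -
  from assms obtain u v :: "'s list" where
    "x = wrapc (sc (1::'s)) (sc (0::'s)) (map sc u) @ wrapc (sc (1::'s)) (sc (0::'s)) (map sc v)"
    unfolding interval_code_def using rat_code_range by blast
  then have "x = map sc (wrap u @ wrap v)" unfolding map_append map_sc_wrap .
  then show ?thesis by blast
qed

lemma nat_code_unique: "nat_code o1 o0 x m \<Longrightarrow> nat_code o1 o0 x n \<Longrightarrow> m = n"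
  by (simp add: nat_code_def)

lemma rat_code_unique:
  assumes "o1 \<noteq> o0" "rat_code o1 o0 x s" "rat_code o1 o0 x t" shows "s = t"
proof -
  from assms(2) obtain u v w where 1: "x = wrapc o1 o0 u @ wrapc o1 o0 v @ wrapc o1 o0 w"
    "nat_code o1 o0 u (fst s)" "nat_code o1 o0 v (fst (snd s))" "nat_code o1 o0 w (snd (snd s))"
    unfolding rat_code_def by blast
  from assms(3) obtain u' v' w' where 2: "x = wrapc o1 o0 u' @ wrapc o1 o0 v' @ wrapc o1 o0 w'"
    "nat_code o1 o0 u' (fst t)" "nat_code o1 o0 v' (fst (snd t))" "nat_code o1 o0 w' (snd (snd t))"
    unfolding rat_code_def by blast
  have "concat (map (wrapc o1 o0) [u, v, w]) @ [] = concat (map (wrapc o1 o0) [u', v', w']) @ []"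
    using 1(1) 2(1) by simp
  from wrapc_concat_inject[OF assms(1) _ this] have "u = u'" "v = v'" "w = w'" by simp_all
  then show ?thesis using 1 2 nat_code_unique by (metis prod_eqI)
qed

lemma interval_code_unique:
  assumes "o1 \<noteq> o0" "interval_code o1 o0 x s" "interval_code o1 o0 x t" shows "s = t"
proof -
  from assms(2) obtain u v where 1: "x = wrapc o1 o0 u @ wrapc o1 o0 v" "rat_code o1 o0 u (fst s)" "rat_code o1 o0 v (snd s)"
    unfolding interval_code_def by blast
  from assms(3) obtain u' v' where 2: "x = wrapc o1 o0 u' @ wrapc o1 o0 v'" "rat_code o1 o0 u' (fst t)" "rat_code o1 o0 v' (snd t)"
    unfolding interval_code_def by blast
  have "concat (map (wrapc o1 o0) [u, v]) @ [] = concat (map (wrapc o1 o0) [u', v']) @ []"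
    using 1(1) 2(1) by simp
  from wrapc_concat_inject[OF assms(1) _ this] have "u = u'" "v = v'" by simp_all
  then show ?thesis using 1 2 rat_code_unique[OF assms(1)] by (metis prod_eqI)
qed

lemma ex_rat_code:
  assumes "snd (snd t) \<noteq> 0" shows "\<exists>w :: 's list. rat_code (sc (1::'s::{finite,zero_neq_one})) (sc (0::'s)) (map sc w) t"
proof -
  obtain u v z :: "'s list" where "nat_word u = Some (fst t)" "nat_word v = Some (fst (snd t))" "nat_word z = Some (snd (snd t))"
    using ex_nat_word by metis
  then have "rat_code (sc (1::'s)) (sc (0::'s)) (map sc (wrap u @ wrap v @ wrap z)) t"
    unfolding rat_code_def nat_code_iff map_append map_sc_wrap using assms by blast
  then show ?thesis by blast
qed

lemma ex_interval_code:
  assumes "snd (snd s) \<noteq> 0" "snd (snd t) \<noteq> 0"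
  shows "\<exists>w :: 's list. interval_code (sc (1::'s::{finite,zero_neq_one})) (sc (0::'s)) (map sc w) (s, t)"
proof -
  obtain u v :: "'s list" where "rat_code (sc (1::'s)) (sc (0::'s)) (map sc u) s" "rat_code (sc (1::'s)) (sc (0::'s)) (map sc v) t"
    using ex_rat_code assms by metis
  then have "interval_code (sc (1::'s)) (sc (0::'s)) (map sc (wrap u @ wrap v)) (s, t)"
    unfolding interval_code_def map_append map_sc_wrap fst_conv snd_conv by blast
  then show ?thesis by blast
qed

lemma ex_rat_val: "\<exists>t. snd (snd t) \<noteq> 0 \<and> rat_val t = q"
proof -
  obtain a b where ab: "q = Fract a b" "b > 0" by (cases q) auto
  have "rat_val (nat a, nat (- a), nat b) = q"
    using ab by (cases "a \<ge> 0") (simp_all add: rat_val_def Fract_of_int_quotient)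
  moreover have "snd (snd (nat a, nat (- a), nat b)) \<noteq> 0" using ab(2) by simp
  ultimately show ?thesis by blast
qed

text \<open>A negative rational is below every nonnegative \<open>x\<close>; otherwise the
  difference of the two naturals in the numerator is a natural number, and the comparison becomes a
  cut.\<close>

lemma rat_val_less:
  assumes "snd (snd t) \<noteq> 0" "x \<ge> 0"
  shows "of_rat (rat_val t) < (x :: real) \<longleftrightarrow> fst t < fst (snd t) \<or> real (fst t - fst (snd t)) < x * real (snd (snd t))"
proof -
  obtain i j k where t: "t = (i, j, k)" by (cases t)
  have k: "real k > 0" using assms(1) t by simp
  have "of_rat (rat_val t) = (real i - real j) / real k" by (simp add: t rat_val_def of_rat_divide of_rat_diff)
  then have "of_rat (rat_val t) < x \<longleftrightarrow> real i - real j < x * real k"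
    using k by (simp add: pos_divide_less_eq)
  moreover have "0 \<le> x * real k" using assms(2) by simp
  ultimately show ?thesis by (auto simp: t of_nat_diff)
qed

lemma less_rat_val:
  assumes "snd (snd t) \<noteq> 0" "x \<ge> 0"
  shows "(x :: real) < of_rat (rat_val t) \<longleftrightarrow> fst (snd t) < fst t \<and> x * real (snd (snd t)) < real (fst t - fst (snd t))"
proof -
  obtain i j k where t: "t = (i, j, k)" by (cases t)
  have k: "real k > 0" using assms(1) t by simp
  have "of_rat (rat_val t) = (real i - real j) / real k" by (simp add: t rat_val_def of_rat_divide of_rat_diff)
  then have "x < of_rat (rat_val t) \<longleftrightarrow> x * real k < real i - real j"
    using k by (simp add: pos_less_divide_eq)
  moreover have "0 \<le> x * real k" using assms(2) by simp
  ultimately show ?thesis by (auto simp: t of_nat_diff)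
qed

section \<open>Real numbers by cuts\<close>

text \<open>
  A nonnegative real \<open>x\<close> is handled through the sets of all \<open>(i, j)\<close> with \<open>i < x j\<close> and with
  \<open>x j < i\<close>.
\<close>

text \<open>\<open>K\<close> relates the codes of words to parameters that determine the named object.\<close>

lemma enumerates_machine:
  fixes K :: "nat list \<Rightarrow> 'c::numbered \<Rightarrow> bool" and \<nu> :: "('s::{finite,zero_neq_one}) list \<Rightarrow> 'x set"
  assumes K: "re (\<lambda>p. K (fst p) (snd p))" and range: "\<forall>x t. K x t \<longrightarrow> x \<in> range (map sc :: 's list \<Rightarrow> nat list)"
    and unique: "\<forall>x s t. K x s \<longrightarrow> K x t \<longrightarrow> s = t"
    and \<nu>: "\<forall>v w. v \<in> \<nu> w \<longleftrightarrow> (\<exists>t. K (map sc w) t \<and> v = val t)"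
    and good: "rel_re (\<lambda>(ps :: 's str list) t. good ps t)"
  shows "\<exists>F :: 's str list \<rightharpoonup> 's str. computable_string_fun F \<and>
    (\<forall>ps S. list_all2 of_kind ks ps \<and> S \<noteq> {} \<and> (\<forall>v\<in>S. \<exists>w. v \<in> \<nu> w) \<and>
       (\<forall>x t. K x t \<longrightarrow> (good ps t \<longleftrightarrow> val t \<in> S)) \<longrightarrow> (\<exists>q. F ps = Some (Inf q) \<and> enumerates \<nu> q S))"
proof -
  define Q where "Q ps x \<longleftrightarrow> (\<exists>t. K x t \<and> good ps t)" for ps :: "'s str list" and x
  have "rel_re Q" unfolding Q_def by (intro rre rel_re_comp[OF good] rel_re_re re_comp2[OF K] cf)
  from enumerating_set_machine[OF this, of ks]
  obtain F :: "'s str list \<rightharpoonup> 's str" where F: "computable_string_fun F"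
    "\<And>ps. list_all2 of_kind ks ps \<and> (\<exists>x :: 's list. Q ps (map sc x)) \<and>
       (\<forall>w. Q ps w \<longrightarrow> w \<in> range (map sc :: 's list \<Rightarrow> nat list)) \<Longrightarrow>
       (\<exists>q. F ps = Some (Inf q) \<and> (\<forall>w. occurs_in (wrap w) q \<longleftrightarrow> Q ps (map sc w)))" by blast
  show ?thesis
  proof (intro exI[of _ F] conjI allI impI F(1))
    fix ps :: "'s str list" and S
    assume *: "list_all2 of_kind ks ps \<and> S \<noteq> {} \<and> (\<forall>v\<in>S. \<exists>w. v \<in> \<nu> w) \<and> (\<forall>x t. K x t \<longrightarrow> (good ps t \<longleftrightarrow> val t \<in> S))"
    have single: "\<nu> w = {val t}" if "K (map sc w) t" for w t
      by (intro set_eqI) (metis that unique \<nu> singleton_iff)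
    have good_iff: "good ps t \<longleftrightarrow> val t \<in> S" if "K x t" for x t using * that by simp
    have Q: "Q ps (map sc w) \<longleftrightarrow> \<nu> w \<noteq> {} \<and> \<nu> w \<subseteq> S" for w
    proof
      assume "Q ps (map sc w)"
      then show "\<nu> w \<noteq> {} \<and> \<nu> w \<subseteq> S" unfolding Q_def using single good_iff by fastforce
    next
      assume w: "\<nu> w \<noteq> {} \<and> \<nu> w \<subseteq> S"
      then obtain v where "v \<in> \<nu> w" by blast
      then obtain t where "K (map sc w) t" using \<nu> by blast
      then show "Q ps (map sc w)" unfolding Q_def using single good_iff w by fastforce
    qed
    have sub: "\<nu> w \<subseteq> S" if v: "v \<in> S" "v \<in> \<nu> w" for v w
    proof -
      from v(2) obtain t where "K (map sc w) t" using \<nu> by blast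
      from single[OF this] v show ?thesis by simp
    qed
    \<comment> \<open>Nonemptiness of \<open>S\<close> supplies a word that may be written whenever
      a candidate fails.\<close>
    from * obtain v where v: "v \<in> S" by blast
    moreover from this * obtain w where w: "v \<in> \<nu> w" by blast
    ultimately have "Q ps (map sc w)" unfolding Q using sub[OF v w] by blast
    then have "\<exists>w :: 's list. Q ps (map sc w)" by blast
    moreover have "w \<in> range (map sc :: 's list \<Rightarrow> nat list)" if "Q ps w" for w
      using that range unfolding Q_def by blast
    ultimately obtain q where q: "F ps = Some (Inf q)" "\<And>w. occurs_in (wrap w) q \<longleftrightarrow> Q ps (map sc w)"
      using F(2)[of ps] * by blast
    have "\<exists>w. \<nu> w \<noteq> {} \<and> \<nu> w \<subseteq> S \<and> v \<in> \<nu> w" if v: "v \<in> S" for v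
    proof -
      from v * obtain w where w: "v \<in> \<nu> w" by blast
      then show ?thesis using sub[OF v w] by blast
    qed
    then have "(\<Union>w\<in>{w. \<nu> w \<noteq> {} \<and> \<nu> w \<subseteq> S}. \<nu> w) = S" by auto
    then have "enumerates \<nu> q S" unfolding enumerates_def q(2) Q by simp
    then show "\<exists>q. F ps = Some (Inf q) \<and> enumerates \<nu> q S" using q(1) by blast
  qed
qed

text \<open>The lower cuts decide about left endpoints and the upper cuts about right endpoints of
  the intervals to be listed; \<open>rat_val_less\<close> and \<open>less_rat_val\<close> translate,
  using \<open>x \<ge> 0\<close>.\<close>

lemma rho_machine:
  assumes L: "rel_re (\<lambda>(ps :: ('s::{finite,zero_neq_one}) str list) p. L ps (fst p) (snd p))"
    and U: "rel_re (\<lambda>(ps :: 's str list) p. U ps (fst p) (snd p))"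
  shows "\<exists>F :: 's str list \<rightharpoonup> 's str. computable_string_fun F \<and>
    (\<forall>ps x. list_all2 of_kind ks ps \<and> x \<ge> 0 \<and> (\<forall>i j. L ps i j \<longleftrightarrow> real i < x * real j) \<and>
       (\<forall>i j. U ps i j \<longleftrightarrow> x * real j < real i) \<longrightarrow> (\<exists>q. F ps = Some q \<and> x \<in> rho q))"
proof -
  let ?K = "interval_code (sc (1::'s)) (sc (0::'s))"
  define val where "val t = (rat_val (fst t), rat_val (snd t))" for t
  define good where "good ps t \<longleftrightarrow>
    (fst (fst t) < fst (snd (fst t)) \<or> L ps (fst (fst t) - fst (snd (fst t))) (snd (snd (fst t)))) \<and>
    (fst (snd (snd t)) < fst (snd t) \<and> U ps (fst (snd t) - fst (snd (snd t))) (snd (snd (snd t))))" for ps :: "'s str list" and t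
  have good: "rel_re good" unfolding good_def
    by (intro rre rel_re_comp2[OF L] rel_re_comp2[OF U] rel_re_decidable dc cf)
  have \<nu>: "v \<in> interval_word w \<longleftrightarrow> (\<exists>t. ?K (map sc w) t \<and> v = val t)" for v and w :: "'s list"
  proof (cases v)
    case (Pair a b)
    have "(\<exists>t. ?K (map sc w) t \<and> (a, b) = val t) \<longleftrightarrow> (\<exists>s t. ?K (map sc w) (s, t) \<and> a = rat_val s \<and> b = rat_val t)"
      unfolding val_def by (metis fst_conv snd_conv prod.inject prod.collapse)
    then show ?thesis by (simp only: Pair interval_word_code)
  qed
  have range: "\<forall>x t. ?K x t \<longrightarrow> x \<in> range (map sc :: 's list \<Rightarrow> nat list)"
    using interval_code_range[where ?'s = 's] by blast
  have unique: "\<forall>x s t. ?K x s \<longrightarrow> ?K x t \<longrightarrow> s = t"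
    using interval_code_unique[OF sc_1_neq_0] by blast
  note machine = enumerates_machine[of ?K interval_word val good ks, OF re_interval_code range unique allI[OF allI[OF \<nu>]] good]
  from machine show ?thesis
  proof (elim exE conjE, goal_cases)
    case (1 F)
    show ?case
    proof (intro exI[of _ F] conjI allI impI 1(1))
      fix ps :: "'s str list" and x :: real
      assume *: "list_all2 of_kind ks ps \<and> x \<ge> 0 \<and> (\<forall>i j. L ps i j \<longleftrightarrow> real i < x * real j) \<and>
         (\<forall>i j. U ps i j \<longleftrightarrow> x * real j < real i)"
      let ?S = "{(a, b). of_rat a < x \<and> x < of_rat b}"
      obtain a b where "of_rat a < x" "x < of_rat b"
        using of_rat_dense[of "x - 1" x] of_rat_dense[of x "x + 1"] by auto
      then have "?S \<noteq> {}" by blast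
      moreover have "\<exists>w :: 's list. v \<in> interval_word w" for v
        unfolding \<nu> val_def using ex_rat_val[of "fst v"] ex_rat_val[of "snd v"] ex_interval_code[where ?'s = 's]
        by (metis fst_conv prod.collapse snd_conv)
      moreover have "good ps t \<longleftrightarrow> val t \<in> ?S" if "?K y t" for y t
      proof -
        have "snd (snd (fst t)) \<noteq> 0" "snd (snd (snd t)) \<noteq> 0"
          using that unfolding interval_code_def rat_code_def by auto
        then show ?thesis using * rat_val_less[of "fst t" x] less_rat_val[of "snd t" x] by (simp add: good_def val_def)
      qed
      ultimately obtain q where "F ps = Some (Inf q)" "enumerates interval_word q ?S"
        using 1(2)[rule_format, of ps ?S] * by blast
      then show "\<exists>q. F ps = Some q \<and> x \<in> rho q" by (auto simp: rho_def)
    qed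
  qed
qed

lemma ereal_rat_val_less:
  assumes "snd (snd t) \<noteq> 0" "x \<ge> 0"
  shows "ereal (of_rat (rat_val t)) < x \<longleftrightarrow> fst t < fst (snd t) \<or> ereal (real (fst t - fst (snd t)) / real (snd (snd t))) < x"
proof -
  obtain i j k where t: "t = (i, j, k)" by (cases t)
  have k: "real k > 0" using assms(1) t by simp
  have v: "of_rat (rat_val t) = (real i - real j) / real k" by (simp add: t rat_val_def of_rat_divide of_rat_diff)
  show ?thesis
  proof (cases "i < j")
    case True
    then have "(real i - real j) / real k < 0" using k by (simp add: divide_neg_pos)
    then have "ereal (of_rat (rat_val t)) < 0" by (simp add: v)
    then have "ereal (of_rat (rat_val t)) < x" using assms(2) by (rule less_le_trans)
    then show ?thesis using True t by simp
  next
    case False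
    then show ?thesis unfolding v using t by (simp add: of_nat_diff)
  qed
qed

text \<open>Here \<open>x\<close> may be infinite, so the cut is stated by a quotient with
  \<open>j > 0\<close> and not by a product with \<open>x\<close>.\<close>

lemma rho_lower_machine:
  assumes L: "rel_re (\<lambda>(ps :: ('s::{finite,zero_neq_one}) str list) p. L ps (fst p) (snd p))"
  shows "\<exists>F :: 's str list \<rightharpoonup> 's str. computable_string_fun F \<and>
    (\<forall>ps x. list_all2 of_kind ks ps \<and> x \<ge> 0 \<and> (\<forall>i j. j > 0 \<longrightarrow> (L ps i j \<longleftrightarrow> ereal (real i / real j) < x)) \<longrightarrow>
       (\<exists>q. F ps = Some q \<and> x \<in> rho_lower q))"
proof -
  let ?K = "rat_code (sc (1::'s)) (sc (0::'s))"
  define good where "good ps t \<longleftrightarrow> fst t < fst (snd t) \<or> L ps (fst t - fst (snd t)) (snd (snd t))" for ps :: "'s str list" and t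
  have good: "rel_re good" unfolding good_def by (intro rre rel_re_comp2[OF L] rel_re_decidable dc cf)
  have range: "\<forall>x t. ?K x t \<longrightarrow> x \<in> range (map sc :: 's list \<Rightarrow> nat list)"
    using rat_code_range[where ?'s = 's] by blast
  have unique: "\<forall>x s t. ?K x s \<longrightarrow> ?K x t \<longrightarrow> s = t"
    using rat_code_unique[OF sc_1_neq_0] by blast
  note machine = enumerates_machine[of ?K rat_word rat_val good ks, OF re_rat_code range unique allI[OF allI[OF rat_word_code]] good]
  from machine show ?thesis
  proof (elim exE conjE, goal_cases)
    case (1 F)
    show ?case
    proof (intro exI[of _ F] conjI allI impI 1(1))
      fix ps :: "'s str list" and x :: ereal
      assume *: "list_all2 of_kind ks ps \<and> x \<ge> 0 \<and> (\<forall>i j. j > 0 \<longrightarrow> (L ps i j \<longleftrightarrow> ereal (real i / real j) < x))"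
      let ?S = "{q. ereal (of_rat q) < x}"
      have "ereal (of_rat (- 1)) < x" using * by (auto intro: less_le_trans[of _ 0])
      then have "?S \<noteq> {}" by blast
      moreover have "\<exists>w :: 's list. v \<in> rat_word w" for v
        unfolding rat_word_code using ex_rat_val[of v] ex_rat_code[where ?'s = 's] by metis
      moreover have "good ps t \<longleftrightarrow> rat_val t \<in> ?S" if "?K y t" for y t
      proof -
        have "snd (snd t) \<noteq> 0" using that unfolding rat_code_def by auto
        then show ?thesis using * ereal_rat_val_less[of t x] by (simp add: good_def)
      qed
      ultimately obtain q where "F ps = Some (Inf q)" "enumerates rat_word q ?S"
        using 1(2)[rule_format, of ps ?S] * by blast
      then show "\<exists>q. F ps = Some q \<and> x \<in> rho_lower q" by (auto simp: rho_lower_def)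
    qed
  qed
qed

lemma rho_intervals:
  "x \<in> rho (Inf q) \<Longrightarrow> (\<exists>w. occurs_in (wrap w) q \<and> (a, b) \<in> interval_word w) \<longleftrightarrow> of_rat a < x \<and> x < of_rat b"
  unfolding rho_def enumerates_def set_eq_iff by auto

lemma rat_val_real:
  "of_rat (rat_val s) = (real (fst s) - real (fst (snd s))) / real (snd (snd s))"
  by (simp add: rat_val_def of_rat_divide of_rat_diff)

lemma interval_code_nonzero:
  "interval_code o1 o0 w (s, t) \<Longrightarrow> snd (snd s) \<noteq> 0 \<and> snd (snd t) \<noteq> 0"
  unfolding interval_code_def rat_code_def by auto

text \<open>By density, \<open>i / j\<close> is below \<open>x\<close> iff some listed interval has
  its left endpoint at or above \<open>i / j\<close>. The comparison with that endpoint is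
  multiplied out and rearranged without subtraction, so it is a test on natural numbers.\<close>

lemma rho_lower_cut:
  assumes x: "(x :: real) \<in> rho (Inf (q :: nat \<Rightarrow> 's::{finite,zero_neq_one}))" and j: "j > 0"
  shows "real i < x * real j \<longleftrightarrow> (\<exists>w s t. occurs_in (wrap w) q \<and> interval_code (sc (1::'s)) (sc (0::'s)) (map sc w) (s, t) \<and>
    i * snd (snd s) + fst (snd s) * j \<le> fst s * j)"
proof -
  have cmp: "i * snd (snd s) + fst (snd s) * j \<le> fst s * j \<longleftrightarrow> real i / real j \<le> of_rat (rat_val s)"
    if "snd (snd s) \<noteq> 0" for s
  proof -
    have "real i / real j \<le> of_rat (rat_val s) \<longleftrightarrow> real (i * snd (snd s) + fst (snd s) * j) \<le> real (fst s * j)"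
      unfolding rat_val_real using that j by (simp add: field_simps)
    then show ?thesis by (simp only: of_nat_le_iff)
  qed
  have x_iff: "real i < x * real j \<longleftrightarrow> real i / real j < x" using j by (simp add: pos_divide_less_eq)
  show ?thesis
  proof
    assume "real i < x * real j"
    then have "real i / real j < x" using x_iff by blast
    then obtain a where a: "real i / real j \<le> of_rat a" "of_rat a < x"
      using of_rat_dense less_imp_le by metis
    obtain b where b: "x < of_rat b" using of_rat_dense[of x "x + 1"] by auto
    obtain w where "occurs_in (wrap w) q" "(a, b) \<in> interval_word w" using rho_intervals[OF x, of a b] a b by blast
    then show "\<exists>w s t. occurs_in (wrap w) q \<and> interval_code (sc (1::'s)) (sc (0::'s)) (map sc w) (s, t) \<and>
      i * snd (snd s) + fst (snd s) * j \<le> fst s * j"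
      using a(1) cmp interval_code_nonzero unfolding interval_word_code by metis
  next
    assume "\<exists>w s t. occurs_in (wrap w) q \<and> interval_code (sc (1::'s)) (sc (0::'s)) (map sc w) (s, t) \<and>
      i * snd (snd s) + fst (snd s) * j \<le> fst s * j"
    then obtain w s t where *: "occurs_in (wrap w) q" "interval_code (sc (1::'s)) (sc (0::'s)) (map sc w) (s, t)"
      "i * snd (snd s) + fst (snd s) * j \<le> fst s * j" by blast
    then have "(rat_val s, rat_val t) \<in> interval_word w" unfolding interval_word_code by blast
    then have "of_rat (rat_val s) < x" using rho_intervals[OF x] *(1) by blast
    moreover have "real i / real j \<le> of_rat (rat_val s)" using cmp interval_code_nonzero *(2,3) by blast
    ultimately show "real i < x * real j" unfolding x_iff by linarith
  qed
qed

lemma rho_upper_cut: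
  assumes x: "(x :: real) \<in> rho (Inf (q :: nat \<Rightarrow> 's::{finite,zero_neq_one}))" and j: "j > 0"
  shows "x * real j < real i \<longleftrightarrow> (\<exists>w s t. occurs_in (wrap w) q \<and> interval_code (sc (1::'s)) (sc (0::'s)) (map sc w) (s, t) \<and>
    fst t * j \<le> i * snd (snd t) + fst (snd t) * j)"
proof -
  have cmp: "fst s * j \<le> i * snd (snd s) + fst (snd s) * j \<longleftrightarrow> of_rat (rat_val s) \<le> real i / real j"
    if "snd (snd s) \<noteq> 0" for s
  proof -
    have "of_rat (rat_val s) \<le> real i / real j \<longleftrightarrow> real (fst s * j) \<le> real (i * snd (snd s) + fst (snd s) * j)"
      unfolding rat_val_real using that j by (simp add: field_simps)
    then show ?thesis by (simp only: of_nat_le_iff)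
  qed
  have x_iff: "x * real j < real i \<longleftrightarrow> x < real i / real j" using j by (simp add: pos_less_divide_eq)
  show ?thesis
  proof
    assume "x * real j < real i"
    then have "x < real i / real j" using x_iff by blast
    then obtain b where b: "of_rat b \<le> real i / real j" "x < of_rat b"
      using of_rat_dense less_imp_le by metis
    obtain a where a: "of_rat a < x" using of_rat_dense[of "x - 1" x] by auto
    obtain w where "occurs_in (wrap w) q" "(a, b) \<in> interval_word w" using rho_intervals[OF x, of a b] a b by blast
    then show "\<exists>w s t. occurs_in (wrap w) q \<and> interval_code (sc (1::'s)) (sc (0::'s)) (map sc w) (s, t) \<and>
      fst t * j \<le> i * snd (snd t) + fst (snd t) * j"
      using b(1) cmp interval_code_nonzero unfolding interval_word_code by metis
  next
    assume "\<exists>w s t. occurs_in (wrap w) q \<and> interval_code (sc (1::'s)) (sc (0::'s)) (map sc w) (s, t) \<and>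
      fst t * j \<le> i * snd (snd t) + fst (snd t) * j"
    then obtain w s t where *: "occurs_in (wrap w) q" "interval_code (sc (1::'s)) (sc (0::'s)) (map sc w) (s, t)"
      "fst t * j \<le> i * snd (snd t) + fst (snd t) * j" by blast
    then have "(rat_val s, rat_val t) \<in> interval_word w" unfolding interval_word_code by blast
    then have "x < of_rat (rat_val t)" using rho_intervals[OF x] *(1) by blast
    moreover have "of_rat (rat_val t) \<le> real i / real j" using cmp interval_code_nonzero *(2,3) by blast
    ultimately show "x * real j < real i" unfolding x_iff by linarith
  qed
qed

section \<open>Cuts of quotients, finite sums and limits\<close>

lemma nat_ratio_between:
  assumes "0 \<le> x" "x < (y::real)" shows "\<exists>s l :: nat. x * real l < real s \<and> real s < y * real l"
proof -
  obtain n :: nat where n: "1 < real n * (y - x)" using assms ex_less_of_nat_mult[of "y - x" 1] by auto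
  define s where "s = nat \<lfloor>x * real n\<rfloor> + 1"
  have s: "real s = of_int \<lfloor>x * real n\<rfloor> + 1" using assms by (simp add: s_def)
  have "x * real n < real s" unfolding s by linarith
  moreover have "real s \<le> x * real n + 1" unfolding s by linarith
  then have "real s < y * real n" using n by (simp add: algebra_simps)
  ultimately show ?thesis by blast
qed

text \<open>Cuts compare a real only with rationals; two reals are compared through a rational
  \<open>s / l\<close> that separates them.\<close>

lemma nat_ratio_between_iff:
  assumes "0 \<le> x"
  shows "(\<exists>s l :: nat. x * real l < real s \<and> real s < y * real l) \<longleftrightarrow> x < (y::real)"
proof
  assume "\<exists>s l :: nat. x * real l < real s \<and> real s < y * real l"
  then obtain l :: nat where "x * real l < y * real l" by (meson less_trans)
  then show "x < y" by (simp add: mult_less_cancel_right)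
qed (rule nat_ratio_between[OF assms])

lemma sum_list_lessThan: "sum_list xs = (\<Sum>k<length xs. nth_or 0 xs k :: nat)"
  by (simp add: sum_list_sum_nth nth_or atLeast0LessThan)

text \<open>The terms are rounded down to a common denominator \<open>n\<close>. This costs at most
  \<open>1 / n\<close> per term, and \<open>n\<close> is chosen so that the total loss stays below
  the slack. The alternative 0 is there for vanishing terms, which have no natural number strictly
  below them.\<close>

lemma sum_lower_cut:
  assumes f: "\<And>k. k < N \<Longrightarrow> 0 \<le> (f k :: real)"
  shows "real i < (\<Sum>k<N. f k) * real j \<longleftrightarrow> (\<exists>n as. length as = N \<and>
    (\<forall>k<N. nth_or 0 as k = 0 \<or> real (nth_or 0 as k) < f k * real n) \<and> i * n < sum_list as * j)"
proof
  assume i: "real i < (\<Sum>k<N. f k) * real j"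
  obtain n :: nat where "real N * real j < real n * ((\<Sum>k<N. f k) * real j - real i)"
    using i ex_less_of_nat_mult[of "(\<Sum>k<N. f k) * real j - real i" "real N * real j"] by auto
  then have n: "real i * real n < ((\<Sum>k<N. f k) * real n - real N) * real j" by (simp add: algebra_simps)
  define a where "a k = nat (\<lceil>f k * real n\<rceil> - 1)" for k
  have a1: "f k * real n - 1 \<le> real (a k)" for k unfolding a_def by linarith
  have a2: "a k = 0 \<or> real (a k) < f k * real n" for k unfolding a_def by linarith
  have "(\<Sum>k<N. f k) * real n - real N = (\<Sum>k<N. f k * real n - 1)"
    by (simp add: sum_subtractf sum_distrib_right)
  also have "\<dots> \<le> (\<Sum>k<N. real (a k))" using a1 by (intro sum_mono)
  finally have "real i * real n < (\<Sum>k<N. real (a k)) * real j"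
    using n by (meson less_le_trans mult_right_mono of_nat_0_le_iff)
  also have "(\<Sum>k<N. real (a k)) * real j = real ((\<Sum>k<N. a k) * j)" by simp
  finally have "i * n < (\<Sum>k<N. a k) * j" by (metis of_nat_less_iff of_nat_mult)
  moreover have "sum_list (map a [0..<N]) = (\<Sum>k<N. a k)" by (simp add: sum_list_lessThan nth_or)
  ultimately show "\<exists>n as. length as = N \<and> (\<forall>k<N. nth_or 0 as k = 0 \<or> real (nth_or 0 as k) < f k * real n) \<and>
      i * n < sum_list as * j"
    using a2 by (intro exI[of _ n] exI[of _ "map a [0..<N]"]) (simp add: nth_or)
next
  assume "\<exists>n as. length as = N \<and> (\<forall>k<N. nth_or 0 as k = 0 \<or> real (nth_or 0 as k) < f k * real n) \<and>
      i * n < sum_list as * j"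
  then obtain n as where *: "length as = N" "\<And>k. k < N \<Longrightarrow> nth_or 0 as k = 0 \<or> real (nth_or 0 as k) < f k * real n"
    "i * n < sum_list as * j" by blast
  have le: "real (nth_or 0 as k) \<le> f k * real n" if "k < N" for k
    using *(2)[OF that] f[OF that] by (auto simp: less_imp_le)
  have n0: "n \<noteq> 0"
  proof
    assume "n = 0"
    then have "nth_or 0 as k = 0" if "k < N" for k using *(2)[OF that] by auto
    then show False using *(1,3) by (simp add: sum_list_lessThan)
  qed
  have "real (i * n) < real (sum_list as * j)" using *(3) by (simp only: of_nat_less_iff)
  also have "\<dots> = (\<Sum>k<N. real (nth_or 0 as k)) * real j" using *(1) by (simp add: sum_list_lessThan)
  also have "\<dots> \<le> (\<Sum>k<N. f k * real n) * real j" using le by (intro mult_right_mono sum_mono) auto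
  also have "\<dots> = ((\<Sum>k<N. f k) * real j) * real n" unfolding sum_distrib_right[symmetric] by simp
  finally show "real i < (\<Sum>k<N. f k) * real j" using n0 by simp
qed

text \<open>The same with rounding up. Strict upper bounds exist even for vanishing terms, so there
  is no exceptional case.\<close>

lemma sum_upper_cut:
  "(\<Sum>k<N. (f k :: real)) * real j < real i \<longleftrightarrow> (\<exists>n bs. length bs = N \<and>
    (\<forall>k<N. f k * real n < real (nth_or 0 bs k)) \<and> sum_list bs * j < i * n)" if f: "\<And>k. k < N \<Longrightarrow> 0 \<le> f k"
proof
  assume i: "(\<Sum>k<N. f k) * real j < real i"
  obtain n :: nat where "real N * real j < real n * (real i - (\<Sum>k<N. f k) * real j)"
    using i ex_less_of_nat_mult[of "real i - (\<Sum>k<N. f k) * real j" "real N * real j"] by auto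
  then have n: "((\<Sum>k<N. f k) * real n + real N) * real j < real i * real n" by (simp add: algebra_simps)
  define b where "b k = nat (\<lfloor>f k * real n\<rfloor> + 1)" for k
  have b1: "real (b k) \<le> f k * real n + 1" if "k < N" for k
  proof -
    have "0 \<le> f k * real n" using f[OF that] by simp
    then show ?thesis unfolding b_def by linarith
  qed
  have b2: "f k * real n < real (b k)" for k unfolding b_def by linarith
  have "(\<Sum>k<N. real (b k)) \<le> (\<Sum>k<N. f k * real n + 1)" using b1 by (intro sum_mono) simp
  also have "\<dots> = (\<Sum>k<N. f k) * real n + real N" by (simp add: sum.distrib sum_distrib_right)
  finally have "(\<Sum>k<N. real (b k)) * real j < real i * real n"
    using n by (meson le_less_trans mult_right_mono of_nat_0_le_iff)
  moreover have "(\<Sum>k<N. real (b k)) * real j = real ((\<Sum>k<N. b k) * j)" by simp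
  ultimately have "(\<Sum>k<N. b k) * j < i * n" by (metis of_nat_less_iff of_nat_mult)
  moreover have "sum_list (map b [0..<N]) = (\<Sum>k<N. b k)" by (simp add: sum_list_lessThan nth_or)
  ultimately show "\<exists>n bs. length bs = N \<and> (\<forall>k<N. f k * real n < real (nth_or 0 bs k)) \<and> sum_list bs * j < i * n"
    using b2 by (intro exI[of _ n] exI[of _ "map b [0..<N]"]) (simp add: nth_or)
next
  assume "\<exists>n bs. length bs = N \<and> (\<forall>k<N. f k * real n < real (nth_or 0 bs k)) \<and> sum_list bs * j < i * n"
  then obtain n bs where *: "length bs = N" "\<And>k. k < N \<Longrightarrow> f k * real n < real (nth_or 0 bs k)"
    "sum_list bs * j < i * n" by blast
  have n0: "real n > 0" using *(3) by (cases n) auto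
  have "((\<Sum>k<N. f k) * real j) * real n = (\<Sum>k<N. f k * real n) * real j"
    unfolding sum_distrib_right[symmetric] by simp
  also have "\<dots> \<le> (\<Sum>k<N. real (nth_or 0 bs k)) * real j"
    using *(2) by (intro mult_right_mono sum_mono) (auto simp: less_imp_le)
  also have "\<dots> = real (sum_list bs * j)" using *(1) by (simp add: sum_list_lessThan)
  also have "\<dots> < real (i * n)" using *(3) by (simp only: of_nat_less_iff)
  finally show "(\<Sum>k<N. f k) * real j < real i" using n0 by simp
qed

lemma ex_power2_greater: "0 < (y :: real) \<Longrightarrow> \<exists>n. x < 2 ^ n * y"
  using real_arch_pow[of 2 "x / y"] by (auto simp: pos_divide_less_eq)

text \<open>The numbers \<open>s n - c / 2 ^ n\<close> are lower bounds of \<open>x\<close> that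
  converge to it, so \<open>i / j\<close> is below \<open>x\<close> iff it is below one of them;
  everything is multiplied by \<open>j * 2 ^ n\<close>.\<close>

lemma limit_lower_cut:
  assumes s: "\<And>n. \<bar>s n - x\<bar> \<le> real c / 2 ^ n"
  shows "real i < x * real j \<longleftrightarrow> (\<exists>n. real (i * 2 ^ n + c * j) < s n * real (j * 2 ^ n))"
proof -
  have s': "x * 2 ^ n - c \<le> s n * 2 ^ n" "s n * 2 ^ n \<le> x * 2 ^ n + c" for n
    using s[of n] by (auto simp: abs_le_iff field_simps)
  have eq: "real (i * 2 ^ n + c * j) < s n * real (j * 2 ^ n) \<longleftrightarrow> real i * 2 ^ n + real c * j < (s n * 2 ^ n) * j" for n
    by (simp add: ac_simps)
  show ?thesis unfolding eq
  proof
    assume "real i < x * real j"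
    then obtain n where "2 * real c * j < 2 ^ n * (x * j - i)" using ex_power2_greater by (metis diff_gt_0_iff_gt)
    then have "real i * 2 ^ n + real c * j < (x * 2 ^ n - c) * j" by (simp add: algebra_simps)
    also have "\<dots> \<le> (s n * 2 ^ n) * j" using s'(1) by (intro mult_right_mono) auto
    finally show "\<exists>n. real i * 2 ^ n + real c * j < (s n * 2 ^ n) * j" ..
  next
    assume "\<exists>n. real i * 2 ^ n + real c * j < (s n * 2 ^ n) * j"
    then obtain n where "real i * 2 ^ n + real c * j < (s n * 2 ^ n) * j" ..
    also have "\<dots> \<le> (x * 2 ^ n + c) * j" using s'(2) by (intro mult_right_mono) auto
    finally have "real i * 2 ^ n < (x * j) * 2 ^ n" by (simp add: algebra_simps)
    then show "real i < x * real j" by simp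
  qed
qed

text \<open>The subtraction of naturals may be truncated: then the right-hand side is 0 and the
  inequality fails, as it should because \<open>s n\<close> is nonnegative.\<close>

lemma limit_upper_cut:
  assumes s: "\<And>n. \<bar>s n - x\<bar> \<le> real c / 2 ^ n" and pos: "\<And>n. 0 \<le> s n"
  shows "x * real j < real i \<longleftrightarrow> (\<exists>n. s n * real (j * 2 ^ n) < real (i * 2 ^ n - c * j))"
proof -
  have s': "x * 2 ^ n - c \<le> s n * 2 ^ n" "s n * 2 ^ n \<le> x * 2 ^ n + c" for n
    using s[of n] by (auto simp: abs_le_iff field_simps)
  have diff: "y < real (b - a) \<longleftrightarrow> y + real a < real b" if "0 \<le> y" for y and a b :: nat
    using that by (cases "a \<le> b") (auto simp: of_nat_diff)
  have eq: "s n * real (j * 2 ^ n) < real (i * 2 ^ n - c * j) \<longleftrightarrow> (s n * 2 ^ n) * j + real c * j < real i * 2 ^ n" for n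
    using diff[of "s n * real (j * 2 ^ n)" "i * 2 ^ n" "c * j"] pos by (simp add: ac_simps)
  show ?thesis unfolding eq
  proof
    assume "x * real j < real i"
    then obtain n where n: "2 * real c * j < 2 ^ n * (i - x * j)" using ex_power2_greater by (metis diff_gt_0_iff_gt)
    have "(s n * 2 ^ n) * j \<le> (x * 2 ^ n + c) * j" using s'(2) by (intro mult_right_mono) auto
    then have "(s n * 2 ^ n) * j + real c * j < real i * 2 ^ n" using n by (simp add: algebra_simps)
    then show "\<exists>n. (s n * 2 ^ n) * j + real c * j < real i * 2 ^ n" ..
  next
    assume "\<exists>n. (s n * 2 ^ n) * j + real c * j < real i * 2 ^ n"
    then obtain n where n: "(s n * 2 ^ n) * j + real c * j < real i * 2 ^ n" ..
    have "(x * 2 ^ n - c) * j \<le> (s n * 2 ^ n) * j" using s'(1) by (intro mult_right_mono) auto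
    then have "(x * j) * 2 ^ n \<le> (s n * 2 ^ n) * j + real c * j" by (simp add: algebra_simps)
    with n have "(x * j) * 2 ^ n < real i * 2 ^ n" by linarith
    then show "x * real j < real i" by simp
  qed
qed

section \<open>The measure space\<close>

context infinite_computable_measure_space
begin

lemma ring_sets: "E \<in> R \<Longrightarrow> E \<in> sets M"
  using generates by (auto intro: sigma_sets.Basic simp flip: generates)

lemma ring_finite: "E \<in> R \<Longrightarrow> emeasure M E \<noteq> \<infinity>"
  by (rule finite_on_ring)

lemma D_sets [measurable]: "D (Suc n) \<in> sets M"
  using D_in_ring ring_sets by simp

lemma C_sets [measurable]: "C n \<in> sets M"
  using C_in_ring[of n] ring_sets C_0 by (cases "n = 0") auto

lemma D_finite: "emeasure M (D (Suc n)) \<noteq> \<infinity>"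
  using D_in_ring ring_finite by simp

lemma C_finite: "emeasure M (C n) \<noteq> \<infinity>"
  using C_in_ring[of n] ring_finite C_0 by (cases "n = 0") auto

lemma C_le: "m \<le> n \<Longrightarrow> C m \<subseteq> C n"
proof (induction n rule: dec_induct)
  case (step n)
  then show ?case using C_mono[of n] C_0 by (cases "n = 0") auto
qed simp

lemma D_sub_C: "k < n \<Longrightarrow> D (Suc k) \<subseteq> C n"
  using D_eq[of "Suc k"] C_le[of "Suc k" n] by auto

lemma C_eq_UN: "C n = (\<Union>k<n. D (Suc k))"
proof (induction n)
  case 0
  then show ?case using C_0 by simp
next
  case (Suc n)
  have "C (Suc n) = C n \<union> D (Suc n)" using D_eq[of "Suc n"] C_le[of n "Suc n"] by auto
  then show ?case using Suc by (auto simp: lessThan_Suc)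
qed

lemma measure_D_pos: "measure M (D (Suc n)) > 0"
  using D_large[of "Suc n"] by (smt (verit) zero_less_power le_add1 plus_1_eq_Suc)

section \<open>Estimates for the new probability measure\<close>

definition weight :: "'a set \<Rightarrow> nat \<Rightarrow> real" where
  "weight A n = measure M (A \<inter> D (Suc n)) / measure M (D (Suc n)) * (1 / 2) ^ Suc n"

abbreviation mt :: "'a set \<Rightarrow> real" where
  "mt \<equiv> mu_tilde M D"

lemma mt_def: "mt A = (\<Sum>n. weight A n)"
  by (simp add: mu_tilde_def weight_def)

lemma weight_nonneg: "0 \<le> weight A n"
  by (simp add: weight_def)

lemma measure_Int_finite: "A \<in> sets M \<Longrightarrow> F \<in> sets M \<Longrightarrow> emeasure M F \<noteq> \<infinity> \<Longrightarrow> emeasure M (A \<inter> F) \<noteq> \<infinity>"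
  by (metis emeasure_mono Int_lower2 top.extremum_uniqueI infinity_ennreal_def)

lemma measure_Int_mono:
  "A \<subseteq> B \<Longrightarrow> A \<in> sets M \<Longrightarrow> B \<in> sets M \<Longrightarrow> F \<in> sets M \<Longrightarrow> emeasure M F \<noteq> \<infinity> \<Longrightarrow>
    measure M (A \<inter> F) \<le> measure M (B \<inter> F)"
  using measure_Int_finite[of B F]
  by (intro measure_mono_fmeasurable) (auto simp: fmeasurable_def top.not_eq_extremum)

lemma weight_le: "A \<in> sets M \<Longrightarrow> weight A n \<le> (1 / 2) ^ Suc n"
proof -
  assume A: "A \<in> sets M"
  have "measure M (A \<inter> D (Suc n)) \<le> measure M (D (Suc n))"
    using D_finite[of n] A by (intro measure_mono_fmeasurable) (auto simp: fmeasurable_def top.not_eq_extremum)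
  then have "measure M (A \<inter> D (Suc n)) / measure M (D (Suc n)) \<le> 1" using measure_D_pos by simp
  then have "measure M (A \<inter> D (Suc n)) / measure M (D (Suc n)) * (1 / 2) ^ Suc n \<le> 1 * (1 / 2) ^ Suc n"
    by (intro mult_right_mono) auto
  then show ?thesis by (simp add: weight_def)
qed

lemma geometric_tail: "(\<lambda>n. (1 / 2 :: real) ^ Suc (n + N)) sums (1 / 2) ^ N"
  using sums_mult[OF geometric_sums[of "1 / 2 :: real"], of "(1 / 2) ^ Suc N"]
  by (simp add: power_add ac_simps)

lemma weight_summable: "A \<in> sets M \<Longrightarrow> summable (weight A)"
  using geometric_tail[of 0]
  by (intro summable_comparison_test[of "weight A" "\<lambda>n. (1 / 2) ^ Suc (n + 0)"])
    (auto simp: sums_iff weight_nonneg weight_le simp del: power_Suc)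

lemma mt_nonneg: "A \<in> sets M \<Longrightarrow> 0 \<le> mt A"
  unfolding mt_def by (intro suminf_nonneg weight_summable weight_nonneg)

lemma partial_le_mt: "A \<in> sets M \<Longrightarrow> (\<Sum>k<n. weight A k) \<le> mt A"
  unfolding mt_def by (intro sum_le_suminf weight_summable) (auto simp: weight_nonneg)

text \<open>Each weight is at most \<open>(1 / 2) ^ Suc k\<close>, since the quotient of measures is
  at most 1; the tail is bounded by the geometric one.\<close>

lemma mt_le_partial: assumes "A \<in> sets M" shows "mt A \<le> (\<Sum>k<n. weight A k) + (1 / 2) ^ n"
proof -
  have "mt A = (\<Sum>k. weight A (k + n)) + (\<Sum>k<n. weight A k)"
    unfolding mt_def by (rule suminf_split_initial_segment[OF weight_summable[OF assms]])
  moreover have "(\<Sum>k. weight A (k + n)) \<le> (\<Sum>k. (1 / 2) ^ Suc (k + n))"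
    using geometric_tail[of n] assms
    by (intro suminf_le summable_ignore_initial_segment weight_summable weight_le) (auto simp: sums_iff)
  ultimately show ?thesis using geometric_tail[of n] by (simp add: sums_iff)
qed

text \<open>Holds term by term. This form contains the triangle inequality for symmetric differences
  and is used for all error estimates below.\<close>

lemma mt_subadditive:
  assumes "A \<subseteq> B \<union> B'" "A \<in> sets M" "B \<in> sets M" "B' \<in> sets M" shows "mt A \<le> mt B + mt B'"
proof -
  have "weight A n \<le> weight B n + weight B' n" for n
  proof -
    have "measure M (A \<inter> D (Suc n)) \<le> measure M ((B \<union> B') \<inter> D (Suc n))"
      using assms D_finite by (intro measure_Int_mono) auto
    also have "\<dots> = measure M ((B \<inter> D (Suc n)) \<union> (B' \<inter> D (Suc n)))" by (simp add: Int_Un_distrib2)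
    also have "\<dots> \<le> measure M (B \<inter> D (Suc n)) + measure M (B' \<inter> D (Suc n))"
      using assms by (intro measure_Un_le) auto
    finally have "measure M (A \<inter> D (Suc n)) / measure M (D (Suc n)) * (1 / 2) ^ Suc n \<le>
        (measure M (B \<inter> D (Suc n)) + measure M (B' \<inter> D (Suc n))) / measure M (D (Suc n)) * (1 / 2) ^ Suc n"
      by (intro mult_right_mono divide_right_mono) auto
    then show ?thesis unfolding weight_def by (simp add: add_divide_distrib distrib_right)
  qed
  then have "mt A \<le> (\<Sum>n. weight B n + weight B' n)"
    unfolding mt_def using assms by (intro suminf_le weight_summable summable_add) auto
  also have "\<dots> = mt B + mt B'"
    unfolding mt_def using assms by (intro suminf_add[symmetric] weight_summable)
  finally show ?thesis .
qed

lemma mt_diff_le: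
  assumes "A \<in> sets M" "B \<in> sets M" shows "\<bar>mt A - mt B\<bar> \<le> mt (sym_diff A B)"
proof -
  have "mt A \<le> mt B + mt (sym_diff A B)" "mt B \<le> mt A + mt (sym_diff A B)"
    using assms by (auto intro!: mt_subadditive)
  then show ?thesis by (simp add: abs_le_iff)
qed

text \<open>The first \<open>n\<close> pieces lie inside \<open>C n\<close>, so only the tail of the
  series is left.\<close>

lemma mt_compl_C: "mt (space M - C n) \<le> (1 / 2) ^ n"
proof -
  have "weight (space M - C n) k = 0" if "k < n" for k
  proof -
    have "(space M - C n) \<inter> D (Suc k) = {}" using D_sub_C[OF that] by auto
    then show ?thesis by (simp add: weight_def)
  qed
  then have "(\<Sum>k<n. weight (space M - C n) k) = 0" by (intro sum.neutral) auto
  moreover have "space M - C n \<in> sets M" by auto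
  ultimately show ?thesis using mt_le_partial[of "space M - C n" n] by simp
qed

text \<open>\<open>C n\<close> consists of the first \<open>n\<close> pieces. On the piece
  \<open>D (Suc k)\<close> the measure is \<open>measure M (D (Suc k)) * 2 ^ Suc k\<close> times the
  weight, and for \<open>k < n\<close> this factor is at most
  \<open>measure M (C n) * 2 ^ n\<close>.\<close>

lemma measure_Int_C_le:
  assumes "A \<in> sets M" shows "measure M (A \<inter> C n) \<le> measure M (C n) * 2 ^ n * mt A"
proof -
  have "A \<inter> C n = (\<Union>k<n. A \<inter> D (Suc k))" unfolding C_eq_UN by auto
  then have "measure M (A \<inter> C n) \<le> (\<Sum>k<n. measure M (A \<inter> D (Suc k)))"
    using measure_subadditive_finite[of "{..<n}" "\<lambda>k. A \<inter> D (Suc k)" M] assms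
      measure_Int_finite[OF assms D_sets D_finite] sets.Int[OF assms D_sets]
    by (simp add: image_subset_iff)
  also have "\<dots> \<le> (\<Sum>k<n. measure M (C n) * 2 ^ n * weight A k)"
  proof (rule sum_mono)
    fix k assume "k \<in> {..<n}"
    then have k: "k < n" by simp
    have "measure M (D (Suc k)) \<le> measure M (C n)"
      using D_sub_C[OF k] C_finite[of n]
      by (intro measure_mono_fmeasurable) (auto simp: fmeasurable_def top.not_eq_extremum)
    moreover have "(2 :: real) ^ Suc k \<le> 2 ^ n" using k by (intro power_increasing) auto
    ultimately have "measure M (D (Suc k)) * 2 ^ Suc k \<le> measure M (C n) * 2 ^ n"
      by (intro mult_mono) auto
    then have "measure M (D (Suc k)) * 2 ^ Suc k * weight A k \<le> measure M (C n) * 2 ^ n * weight A k"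
      by (intro mult_right_mono weight_nonneg)
    moreover have "measure M (D (Suc k)) * 2 ^ Suc k * weight A k = measure M (A \<inter> D (Suc k))"
      using measure_D_pos[of k] by (simp add: weight_def power_one_over field_simps)
    ultimately show "measure M (A \<inter> D (Suc k)) \<le> measure M (C n) * 2 ^ n * weight A k" by simp
  qed
  also have "\<dots> = measure M (C n) * 2 ^ n * (\<Sum>k<n. weight A k)" by (simp add: sum_distrib_left)
  also have "\<dots> \<le> measure M (C n) * 2 ^ n * mt A"
    using partial_le_mt[OF assms] by (intro mult_left_mono) auto
  finally show ?thesis .
qed

lemma measure_Int_C_diff_le:
  assumes "A \<in> sets M" "B \<in> sets M"
  shows "\<bar>measure M (A \<inter> C n) - measure M (B \<inter> C n)\<bar> \<le> measure M (C n) * 2 ^ n * mt (sym_diff A B)"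
proof -
  have *: "measure M (A \<inter> C n) \<le> measure M (B \<inter> C n) + measure M (sym_diff A B \<inter> C n)"
    if "A \<in> sets M" "B \<in> sets M" for A B
  proof -
    have "measure M (A \<inter> C n) \<le> measure M ((B \<union> sym_diff A B) \<inter> C n)"
      using that C_finite by (intro measure_Int_mono) auto
    also have "\<dots> = measure M (B \<inter> C n \<union> sym_diff A B \<inter> C n)" by (simp add: Int_Un_distrib2)
    also have "\<dots> \<le> measure M (B \<inter> C n) + measure M (sym_diff A B \<inter> C n)"
      using that by (intro measure_Un_le) auto
    finally show ?thesis .
  qed
  have "sym_diff B A = sym_diff A B" by auto
  then show ?thesis
    using *[of A B] *[of B A] measure_Int_C_le[of "sym_diff A B" n] assms by (auto simp: abs_le_iff)
qed

text \<open>Continuity from below along the exhausting sequence: a number is below a supremum iff it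
  is below one of the values. These are finite even if \<open>emeasure M A\<close> is not, so cuts
  apply to them.\<close>

lemma less_emeasure_iff:
  assumes "A \<in> sets M" "r \<ge> 0"
  shows "ereal r < enn2ereal (emeasure M A) \<longleftrightarrow> (\<exists>n\<ge>1. r < measure M (A \<inter> C n))"
proof -
  have "A = (\<Union>n. A \<inter> C (Suc n))"
  proof -
    have "(\<Union>n. C (Suc n)) = space M" using C_exhausts by (force simp: Suc_le_eq gr0_conv_Suc)
    then show ?thesis using sets.sets_into_space[OF assms(1)] by auto
  qed
  moreover have "(SUP n. emeasure M (A \<inter> C (Suc n))) = emeasure M (\<Union>n. A \<inter> C (Suc n))"
    using assms C_le[of "Suc n" "Suc (Suc n)" for n] by (intro SUP_emeasure_incseq) (auto simp: incseq_Suc_iff subset_iff)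
  ultimately have sup: "emeasure M A = (SUP n. emeasure M (A \<inter> C (Suc n)))" by simp
  have fin: "emeasure M (A \<inter> C n) = ennreal (measure M (A \<inter> C n))" for n
    using measure_Int_finite[OF assms(1) C_sets C_finite, of n] by (intro emeasure_eq_ennreal_measure) auto
  have "ereal r < enn2ereal (emeasure M A) \<longleftrightarrow> ennreal r < emeasure M A"
    using assms(2) by (simp add: less_ennreal.rep_eq)
  also have "\<dots> \<longleftrightarrow> (\<exists>n. r < measure M (A \<inter> C (Suc n)))"
    unfolding sup less_SUP_iff fin using assms(2) by (simp add: ennreal_less_iff)
  also have "\<dots> \<longleftrightarrow> (\<exists>n\<ge>1. r < measure M (A \<inter> C n))"
    by (metis One_nat_def Suc_le_D le_add1 plus_1_eq_Suc)
  finally show ?thesis .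
qed

end

lemma re_comp4:
  assumes "re (\<lambda>p. P (fst p) (fst (snd p)) (fst (snd (snd p))) (snd (snd (snd p))))" "compf a" "compf b" "compf c" "compf d"
  shows "re (\<lambda>x. P (a x) (b x) (c x) (d x))"
  using re_comp[OF assms(1), of "\<lambda>x. (a x, b x, c x, d x)"] assms(2-) by (simp add: cf)

text \<open>The trailing 0 is the blank behind the input word. It ensures that the entire word has
  been read and not just a prefix, which could denote another number.\<close>

definition input_nat :: "('s::{finite,zero_neq_one}) str list \<Rightarrow> nat \<Rightarrow> bool" where
  "input_nat ps n \<longleftrightarrow> (\<exists>x m. nat_code (sc (1::'s)) (sc (0::'s)) x n \<and> prefix_of (x @ [0]) (cells ps 1 m))"

lemma rel_re_input_nat: "rel_re (\<lambda>(ps :: ('s::{finite,zero_neq_one}) str list) n. input_nat ps n)"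
proof -
  have "rel_re (\<lambda>(ps :: 's str list) n. \<exists>x m. nat_code (sc (1::'s)) (sc (0::'s)) x n \<and> prefix_of (x @ [0]) (cells ps 1 m))"
    by (intro rre rel_re_cells[where D = "\<lambda>l x. nat_code (sc (1::'s)) (sc (0::'s)) (snd x) (fst x) \<and>
      prefix_of (snd x @ [0]) l"] dc cf) simp
  then show ?thesis unfolding input_nat_def .
qed

lemma input_nat_iff:
  fixes w :: "('s::{finite,zero_neq_one}) list"
  assumes "nat_word w = Some n" shows "input_nat [p, Fin w] m \<longleftrightarrow> m = n"
proof -
  have cells: "cells [p, Fin w] 1 k = take k (map sc w @ replicate k 0)" for k
    by (rule nth_equalityI) (auto simp: cells_def in_cell_def nth_append)
  show ?thesis
  proof
    assume "input_nat [p, Fin w] m"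
    then obtain x k where x: "nat_code (sc (1::'s)) (sc (0::'s)) x m" "prefix_of (x @ [0]) (cells [p, Fin w] 1 k)"
      unfolding input_nat_def by blast
    then obtain v :: "'s list" where v: "x = map sc v" "nat_word v = Some m" unfolding nat_code_iff by blast
    obtain z where z: "cells [p, Fin w] 1 k = (x @ [0]) @ z" using x(2) unfolding prefix_of_iff by blast
    \<comment> \<open>0 is the code of \<open>Blank\<close> and of no symbol, so the first 0 marks
      the end of the word.\<close>
    have "takeWhile (\<lambda>a. a \<noteq> 0) (map sc u @ 0 # y) = map sc u" for u :: "'s list" and y
      by (induction u) (auto simp: symc.simps)
    note tw = this
    have "takeWhile (\<lambda>a. a \<noteq> 0) (cells [p, Fin w] 1 k) = x" unfolding z v(1) using tw[of v z] by simp
    moreover have "length x < length (cells [p, Fin w] 1 k)" "(cells [p, Fin w] 1 k) ! length x = 0" unfolding z by (simp_all add: nth_append)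
    ultimately have "x = map sc w"
    proof -
      have len: "length x < k" using \<open>length x < length (cells [p, Fin w] 1 k)\<close> by (simp add: cells_def)
      have "in_cell [p, Fin w] 1 (length x) = Blank"
        using \<open>(cells [p, Fin w] 1 k) ! length x = 0\<close> len in_cell_cases[of "[p, Fin w]" 1 "length x"]
        by (auto simp: cells_def symc.simps)
      then have "length w \<le> length x" by (auto simp: in_cell_def split: if_splits)
      then have "cells [p, Fin w] 1 k = map sc w @ replicate (k - length w) 0"
        unfolding cells using len by (simp add: take_append min_def)
      moreover have "replicate (k - length w) 0 = 0 # replicate (k - length w - 1) (0 :: nat)"
        using len \<open>length w \<le> length x\<close> by (cases "k - length w") auto
      ultimately have "takeWhile (\<lambda>a. a \<noteq> 0) (cells [p, Fin w] 1 k) = map sc w" using tw by metis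
      then show ?thesis using \<open>takeWhile (\<lambda>a. a \<noteq> 0) (cells [p, Fin w] 1 k) = x\<close> by simp
    qed
    then show "m = n" using v assms by simp
  next
    assume "m = n"
    moreover have "prefix_of (map sc w @ [0]) (cells [p, Fin w] 1 (Suc (length w)))"
      unfolding cells prefix_of_def by simp
    ultimately show "input_nat [p, Fin w] m" unfolding input_nat_def nat_code_iff using assms by blast
  qed
qed

context infinite_computable_measure_space
begin

section \<open>Names of ring elements\<close>

definition named :: "nat list \<Rightarrow> 'a set \<Rightarrow> bool" where
  "named y A \<longleftrightarrow> (\<exists>z. y = map sc z \<and> \<alpha> z = Some A)"

lemma named_ring: "named y A \<Longrightarrow> A \<in> R"
  using notation_onto by (auto simp: named_def ran_def)

lemma named_sets: "named y A \<Longrightarrow> A \<in> sets M"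
  using named_ring ring_sets by blast

lemma in_notation_of: "A \<in> notation_of \<alpha> q \<longleftrightarrow> (\<exists>z. q = Fin z \<and> \<alpha> z = Some A)"
  by (cases q) (auto simp: notation_of_def)

text \<open>A relation and not a function: any name of the result will do. This leaves the choice to
  the enumerating machine, and compositions such as \<open>inter_code\<close> are formed by guessing
  the intermediate name.\<close>

definition realizes :: "(nat list \<Rightarrow> nat list \<Rightarrow> nat list \<Rightarrow> bool) \<Rightarrow> ('a set \<Rightarrow> 'a set \<Rightarrow> 'a set) \<Rightarrow> bool" where
  "realizes G f \<longleftrightarrow> (\<forall>x y A B. named x A \<longrightarrow> named y B \<longrightarrow> (\<exists>z. G x y z) \<and> (\<forall>z. G x y z \<longrightarrow> named z (f A B)))"

lemma ex_realizes:
  assumes "computable2 (notation_of \<alpha>) (notation_of \<alpha>) (notation_of \<alpha>) (fun_on2 R R f)"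
  shows "\<exists>G. re (\<lambda>p. G (fst p) (fst (snd p)) (snd (snd p))) \<and> realizes G f"
proof -
  from assms obtain F where F: "computable_string_fun F"
    "\<And>p1 p2 A B. A \<in> notation_of \<alpha> p1 \<Longrightarrow> B \<in> notation_of \<alpha> p2 \<Longrightarrow> fun_on2 R R f A B \<noteq> {} \<Longrightarrow>
        (\<exists>q. F [p1, p2] = Some q \<and> fun_on2 R R f A B \<inter> notation_of \<alpha> q \<noteq> {})"
    unfolding computable2_def by blast
  from re_graph[OF F(1)] obtain G where G: "re (\<lambda>p. G (fst p) (snd p))"
    "\<And>us y. G (map (map sc) us) y \<longleftrightarrow> (\<exists>v. y = map sc v \<and> F (map Fin us) = Some (Fin v))" by blast
  have "re (\<lambda>p. G [fst p, fst (snd p)] (snd (snd p)))"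
    by (intro re_comp2[OF G(1)] cf)
  moreover have "realizes (\<lambda>x y. G [x, y]) f"
    unfolding realizes_def
  proof (intro allI impI)
    fix x y A B assume A: "named x A" and B: "named y B"
    then obtain u v where uv: "x = map sc u" "\<alpha> u = Some A" "y = map sc v" "\<alpha> v = Some B"
      by (auto simp: named_def)
    have f: "fun_on2 R R f A B = {f A B}" using named_ring[OF A] named_ring[OF B] by (simp add: fun_on2_def)
    obtain q where q: "F [Fin u, Fin v] = Some q" "f A B \<in> notation_of \<alpha> q"
      using F(2)[of A "Fin u" B "Fin v"] uv by (auto simp: f in_notation_of)
    then obtain z where z: "q = Fin z" "\<alpha> z = Some (f A B)" by (auto simp: in_notation_of)
    have "G [x, y] w \<longleftrightarrow> w = map sc z" for w
      using G(2)[of "[u, v]" w] q z uv by auto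
    then show "(\<exists>z. G [x, y] z) \<and> (\<forall>z. G [x, y] z \<longrightarrow> named z (f A B))"
      using z(2) by (auto simp: named_def)
  qed
  ultimately show ?thesis by (intro exI[of _ "\<lambda>x y. G [x, y]"]) simp
qed

definition union_code :: "nat list \<Rightarrow> nat list \<Rightarrow> nat list \<Rightarrow> bool" where
  "union_code = (SOME G. re (\<lambda>p. G (fst p) (fst (snd p)) (snd (snd p))) \<and> realizes G (\<union>))"

definition diff_code :: "nat list \<Rightarrow> nat list \<Rightarrow> nat list \<Rightarrow> bool" where
  "diff_code = (SOME G. re (\<lambda>p. G (fst p) (fst (snd p)) (snd (snd p))) \<and> realizes G (-))"

definition inter_code :: "nat list \<Rightarrow> nat list \<Rightarrow> nat list \<Rightarrow> bool" where
  "inter_code x y z \<longleftrightarrow> (\<exists>w. diff_code x y w \<and> diff_code x w z)"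

lemma union_code:
  "re (\<lambda>p. union_code (fst p) (fst (snd p)) (snd (snd p)))" "realizes union_code (\<union>)"
  using someI_ex[OF ex_realizes[OF union_computable]] unfolding union_code_def by blast+

lemma diff_code:
  "re (\<lambda>p. diff_code (fst p) (fst (snd p)) (snd (snd p)))" "realizes diff_code (-)"
  using someI_ex[OF ex_realizes[OF diff_computable]] unfolding diff_code_def by blast+

lemma inter_code:
  "re (\<lambda>p. inter_code (fst p) (fst (snd p)) (snd (snd p)))" "realizes inter_code (\<inter>)"
proof -
  show "re (\<lambda>p. inter_code (fst p) (fst (snd p)) (snd (snd p)))"
    unfolding inter_code_def by (intro re re_comp3[OF diff_code(1)] cf)
  have *: "A \<inter> B = A - (A - B)" for A B :: "'a set" by auto
  show "realizes inter_code (\<inter>)"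
    using diff_code(2) unfolding realizes_def inter_code_def * by meson
qed

definition C_code :: "nat \<Rightarrow> nat list \<Rightarrow> bool" where
  "C_code = (SOME G. re (\<lambda>p. G (fst p) (snd p)) \<and> (\<forall>n\<ge>1. (\<exists>y. G n y) \<and> (\<forall>y. G n y \<longrightarrow> named y (C n))))"

lemma C_code:
  "re (\<lambda>p. C_code (fst p) (snd p))" "n \<ge> 1 \<Longrightarrow> \<exists>y. C_code n y" "n \<ge> 1 \<Longrightarrow> C_code n y \<Longrightarrow> named y (C n)"
proof -
  from C_computable obtain F where F: "computable_string_fun F"
    "\<And>p n. n \<in> nu_nat p \<Longrightarrow> fun_on {1..} C n \<noteq> {} \<Longrightarrow> (\<exists>q. F [p] = Some q \<and> fun_on {1..} C n \<inter> notation_of \<alpha> q \<noteq> {})"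
    unfolding computable1_def by blast
  from re_graph[OF F(1)] obtain G where G: "re (\<lambda>p. G (fst p) (snd p))"
    "\<And>us y. G (map (map sc) us) y \<longleftrightarrow> (\<exists>v. y = map sc v \<and> F (map Fin us) = Some (Fin v))" by blast
  define H where "H n y \<longleftrightarrow> (\<exists>x. nat_code (sc (1::'s)) (sc (0::'s)) x n \<and> G [x] y)" for n y
  have "re (\<lambda>p. H (fst p) (snd p))"
    unfolding H_def by (intro re re_comp2[OF G(1)] re_decidable dc cf)
  moreover have "(\<exists>y. H n y) \<and> (\<forall>y. H n y \<longrightarrow> named y (C n))" if n: "n \<ge> 1" for n
  proof -
    have "\<exists>z. \<alpha> z = Some (C n) \<and> (\<forall>y. G [map sc u] y \<longleftrightarrow> y = map sc z)" if u: "nat_word u = Some n" for u :: "'s list"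
    proof -
      have "n \<in> nu_nat (Fin u)" using u by (simp add: nu_nat_def notation_of_def)
      then obtain z where "F [Fin u] = Some (Fin z)" "\<alpha> z = Some (C n)"
        using F(2)[of n "Fin u"] n by (auto simp: fun_on_def in_notation_of)
      then show ?thesis using G(2)[of "[u]"] by auto
    qed
    then show ?thesis using ex_nat_word[of n, where ?'s = 's] unfolding H_def nat_code_iff named_def by metis
  qed
  ultimately have "\<exists>G. re (\<lambda>p. G (fst p) (snd p)) \<and> (\<forall>n\<ge>1. (\<exists>y. G n y) \<and> (\<forall>y. G n y \<longrightarrow> named y (C n)))"
    by blast
  note * = someI_ex[OF this, folded C_code_def]
  show "re (\<lambda>p. C_code (fst p) (snd p))" "n \<ge> 1 \<Longrightarrow> \<exists>y. C_code n y" "n \<ge> 1 \<Longrightarrow> C_code n y \<Longrightarrow> named y (C n)"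
    using * by blast+
qed

text \<open>The index is shifted: \<open>D_code n\<close> yields names of \<open>D (Suc n)\<close>.
  The case \<open>n = 0\<close> is separate, because nothing is known about \<open>C_code 0\<close>;
  there the set is \<open>C 1\<close> itself.\<close>

definition D_code :: "nat \<Rightarrow> nat list \<Rightarrow> bool" where
  "D_code n y \<longleftrightarrow> n = 0 \<and> C_code 1 y \<or> 0 < n \<and> (\<exists>u v. C_code (Suc n) u \<and> C_code n v \<and> diff_code u v y)"

lemma re_D_code: "re (\<lambda>p. D_code (fst p) (snd p))"
  unfolding D_code_def by (intro re re_comp2[OF C_code(1)] re_comp3[OF diff_code(1)] re_decidable dc cf)

lemma D_code: "\<exists>y. D_code n y" "D_code n y \<Longrightarrow> named y (D (Suc n))"
proof -
  have D: "D (Suc n) = C (Suc n) - C n" using D_eq[of "Suc n"] by simp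
  have df: "(\<exists>z. diff_code x y z) \<and> (\<forall>z. diff_code x y z \<longrightarrow> named z (A - B))" if "named x A" "named y B" for x y A B
    using diff_code(2) that unfolding realizes_def by blast
  show "\<exists>y. D_code n y"
  proof (cases "n = 0")
    case False
    then obtain u v where "C_code (Suc n) u" "C_code n v" using C_code(2)[of n] C_code(2)[of "Suc n"] by auto
    then show ?thesis using False df C_code(3)[of n v] C_code(3)[of "Suc n" u] unfolding D_code_def
      by (metis One_nat_def Suc_leI le_add1 neq0_conv plus_1_eq_Suc)
  qed (use C_code(2)[of 1] in \<open>auto simp: D_code_def\<close>)
  show "named y (D (Suc n))" if "D_code n y"
  proof (cases "n = 0")
    case True
    then have "D (Suc n) = C 1" using D C_0 by simp
    then show ?thesis using True that C_code(3)[of 1 y] by (auto simp: D_code_def)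
  next
    case False
    then show ?thesis using that df C_code(3)[of n] C_code(3)[of "Suc n"] unfolding D_code_def D
      by (metis One_nat_def Suc_leI le_add1 neq0_conv plus_1_eq_Suc)
  qed
qed

text \<open>From a name of a ring element the given machine computes a name of its measure, whose
  intervals become enumerable through \<open>re_occurs\<close>. The cuts with \<open>j = 0\<close>
  involve no measure and are written down directly.\<close>

lemma ex_measure_cuts:
  "\<exists>L U. re (\<lambda>p. L (fst p) (fst (snd p)) (snd (snd p))) \<and> re (\<lambda>p. U (fst p) (fst (snd p)) (snd (snd p))) \<and>
     (\<forall>y A i j. named y A \<longrightarrow> (L y i j \<longleftrightarrow> real i < measure M A * real j) \<and> (U y i j \<longleftrightarrow> measure M A * real j < real i))"
proof -
  from measure_computable obtain F where F: "computable_string_fun F"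
    "\<And>p A. A \<in> notation_of \<alpha> p \<Longrightarrow> fun_on R (measure M) A \<noteq> {} \<Longrightarrow>
       (\<exists>q. F [p] = Some q \<and> fun_on R (measure M) A \<inter> rho q \<noteq> {})"
    unfolding computable1_def by blast
  from re_occurs[OF F(1)] obtain G where G: "re (\<lambda>p. G (fst p) (snd p))"
    "\<And>us q x. F (map Fin us) = Some (Inf q) \<Longrightarrow> G (map (map sc) us) x \<longleftrightarrow> (\<exists>w. x = map sc w \<and> occurs_in (wrap w) q)"
    by blast
  define L where "L y i j \<longleftrightarrow> 0 < j \<and> (\<exists>x s t. G [y] x \<and> interval_code (sc (1::'s)) (sc (0::'s)) x (s, t) \<and>
    i * snd (snd s) + fst (snd s) * j \<le> fst s * j)" for y i j
  define U where "U y i j \<longleftrightarrow> j = 0 \<and> 0 < i \<or> 0 < j \<and> (\<exists>x s t. G [y] x \<and> interval_code (sc (1::'s)) (sc (0::'s)) x (s, t) \<and>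
    fst t * j \<le> i * snd (snd t) + fst (snd t) * j)" for y i j
  have "re (\<lambda>p. L (fst p) (fst (snd p)) (snd (snd p)))" "re (\<lambda>p. U (fst p) (fst (snd p)) (snd (snd p)))"
    unfolding L_def U_def by (intro re re_comp2[OF G(1)] re_comp2[OF re_interval_code] re_decidable dc cf)+
  moreover have "(L y i j \<longleftrightarrow> real i < measure M A * real j) \<and> (U y i j \<longleftrightarrow> measure M A * real j < real i)"
    if A: "named y A" for y A i j
  proof -
    from A obtain u where u: "y = map sc u" "\<alpha> u = Some A" by (auto simp: named_def)
    then have "A \<in> notation_of \<alpha> (Fin u)" by (auto simp: in_notation_of)
    then obtain q' where q': "F [Fin u] = Some q'" "measure M A \<in> rho q'"
      using F(2)[of A "Fin u"] named_ring[OF A] by (auto simp: fun_on_def)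
    then obtain q where q: "q' = Inf q" by (cases q') (auto simp: rho_def)
    have G': "G [y] x \<longleftrightarrow> (\<exists>w. x = map sc w \<and> occurs_in (wrap w) q)" for x
      using G(2)[of "[u]" q x] q' q u by simp
    show ?thesis
    proof (cases "j = 0")
      case False
      then have j: "0 < j" by simp
      have "L y i j \<longleftrightarrow> (\<exists>w s t. occurs_in (wrap w) q \<and> interval_code (sc (1::'s)) (sc (0::'s)) (map sc w) (s, t) \<and>
          i * snd (snd s) + fst (snd s) * j \<le> fst s * j)"
        unfolding L_def G' using j by blast
      moreover have "U y i j \<longleftrightarrow> (\<exists>w s t. occurs_in (wrap w) q \<and> interval_code (sc (1::'s)) (sc (0::'s)) (map sc w) (s, t) \<and>
          fst t * j \<le> i * snd (snd t) + fst (snd t) * j)"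
        unfolding U_def G' using j by blast
      ultimately show ?thesis
        using rho_lower_cut[of "measure M A" q j i] rho_upper_cut[of "measure M A" q j i] q' q j by simp
    qed (simp add: L_def U_def)
  qed
  ultimately show ?thesis by blast
qed

definition measure_lower :: "nat list \<Rightarrow> nat \<Rightarrow> nat \<Rightarrow> bool" where
  "measure_lower = (SOME L. re (\<lambda>p. L (fst p) (fst (snd p)) (snd (snd p))) \<and>
     (\<forall>y A i j. named y A \<longrightarrow> (L y i j \<longleftrightarrow> real i < measure M A * real j)))"

definition measure_upper :: "nat list \<Rightarrow> nat \<Rightarrow> nat \<Rightarrow> bool" where
  "measure_upper = (SOME U. re (\<lambda>p. U (fst p) (fst (snd p)) (snd (snd p))) \<and>
     (\<forall>y A i j. named y A \<longrightarrow> (U y i j \<longleftrightarrow> measure M A * real j < real i)))"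

lemma measure_lower:
  "re (\<lambda>p. measure_lower (fst p) (fst (snd p)) (snd (snd p)))"
  "named y A \<Longrightarrow> measure_lower y i j \<longleftrightarrow> real i < measure M A * real j"
proof -
  from ex_measure_cuts have "\<exists>L. re (\<lambda>p. L (fst p) (fst (snd p)) (snd (snd p))) \<and>
     (\<forall>y A i j. named y A \<longrightarrow> (L y i j \<longleftrightarrow> real i < measure M A * real j))" by blast
  from someI_ex[OF this, folded measure_lower_def]
  show "re (\<lambda>p. measure_lower (fst p) (fst (snd p)) (snd (snd p)))"
    "named y A \<Longrightarrow> measure_lower y i j \<longleftrightarrow> real i < measure M A * real j" by blast+
qed

lemma measure_upper:
  "re (\<lambda>p. measure_upper (fst p) (fst (snd p)) (snd (snd p)))"
  "named y A \<Longrightarrow> measure_upper y i j \<longleftrightarrow> measure M A * real j < real i"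
proof -
  from ex_measure_cuts have "\<exists>U. re (\<lambda>p. U (fst p) (fst (snd p)) (snd (snd p))) \<and>
     (\<forall>y A i j. named y A \<longrightarrow> (U y i j \<longleftrightarrow> measure M A * real j < real i))" by blast
  from someI_ex[OF this, folded measure_upper_def]
  show "re (\<lambda>p. measure_upper (fst p) (fst (snd p)) (snd (snd p)))"
    "named y A \<Longrightarrow> measure_upper y i j \<longleftrightarrow> measure M A * real j < real i" by blast+
qed

section \<open>Names of measurable sets\<close>

abbreviation \<delta> :: "('s, 'a set) naming" where
  "\<delta> \<equiv> delta_mu_tilde M \<alpha> D"

text \<open>Reindexing the components from 0 turns the exponents into \<open>Suc i\<close>. The
  distance to \<open>A\<close> obeys the same bound as the distances between components: in the
  triangle inequality through a later component, the index of that component tends to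
  infinity.\<close>

lemma delta_nameE:
  assumes "A \<in> \<delta> p"
  obtains x B where "A \<in> sets M" "p = Inf (seq_tuple x)" "\<And>i. \<alpha> (x i) = Some (B i)"
    "\<And>i j. i < j \<Longrightarrow> mt (sym_diff (B i) (B j)) \<le> (1 / 2) ^ Suc i"
    "\<And>i. mt (sym_diff (B i) A) \<le> (1 / 2) ^ Suc i"
proof -
  from assms obtain w E where A: "A \<in> sets M" and p: "p = Inf (seq_tuple (\<lambda>i. w (Suc i)))"
    and w: "\<And>n. n \<ge> 1 \<Longrightarrow> \<alpha> (w n) = Some (E n)"
    and lim: "(\<lambda>n. mt (sym_diff (E n) A)) \<longlonglongrightarrow> 0"
    and E: "\<And>n m. 1 \<le> n \<Longrightarrow> n < m \<Longrightarrow> mt (sym_diff (E n) (E m)) \<le> (1 / 2) ^ n"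
    unfolding delta_mu_tilde_def by blast
  have Es: "E n \<in> sets M" if "n \<ge> 1" for n
    using w[OF that] named_sets[of "map sc (w n)" "E n"] unfolding named_def by blast
  have EA: "mt (sym_diff (E n) A) \<le> (1 / 2) ^ n" if n: "n \<ge> 1" for n
  proof -
    have "(\<lambda>m. (1 / 2) ^ n + mt (sym_diff (E m) A)) \<longlonglongrightarrow> (1 / 2) ^ n + 0"
      by (intro tendsto_add tendsto_const lim)
    moreover have "mt (sym_diff (E n) A) \<le> (1 / 2) ^ n + mt (sym_diff (E m) A)" if "m \<ge> Suc n" for m
    proof -
      have "mt (sym_diff (E n) A) \<le> mt (sym_diff (E n) (E m)) + mt (sym_diff (E m) A)"
        using Es[of n] Es[of m] A n that by (intro mt_subadditive) auto
      also have "mt (sym_diff (E n) (E m)) \<le> (1 / 2) ^ n" using E[of n m] n that by simp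
      finally show ?thesis by simp
    qed
    ultimately have "mt (sym_diff (E n) A) \<le> (1 / 2) ^ n + 0" by (intro LIMSEQ_le_const) blast+
    then show ?thesis by simp
  qed
  show ?thesis
    by (rule that[OF A p, of "\<lambda>i. E (Suc i)"]) (use w E EA in \<open>simp_all del: power_Suc\<close>)
qed

text \<open>A name requires only convergence to \<open>A\<close>, for which the weaker exponent
  \<open>i\<close> suffices; between the components the exponent has to be
  \<open>Suc i\<close>.\<close>

lemma delta_nameI:
  assumes A: "A \<in> sets M" and x: "\<And>i. \<alpha> (x i) = Some (B i)"
    and B: "\<And>i j. i < j \<Longrightarrow> mt (sym_diff (B i) (B j)) \<le> (1 / 2) ^ Suc i"
    and lim: "\<And>i. mt (sym_diff (B i) A) \<le> (1 / 2) ^ i"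
  shows "A \<in> \<delta> (Inf (seq_tuple x))"
proof -
  have Bs: "B i \<in> sets M" for i
    using x[of i] named_sets[of "map sc (x i)" "B i"] unfolding named_def by blast
  have "(\<lambda>n. mt (sym_diff (B n) A)) \<longlonglongrightarrow> 0"
  proof (rule tendsto_sandwich[of "\<lambda>_. 0" _ _ "\<lambda>n. (1 / 2) ^ n"])
    show "(\<lambda>n. (1 / 2 :: real) ^ n) \<longlonglongrightarrow> 0" by (rule LIMSEQ_realpow_zero) auto
  qed (use Bs A lim in \<open>auto intro!: always_eventually mt_nonneg\<close>)
  then have "(\<lambda>n. mt (sym_diff (B (Suc n - 1)) A)) \<longlonglongrightarrow> 0" by simp
  then have "(\<lambda>n. mt (sym_diff (B (n - 1)) A)) \<longlonglongrightarrow> 0" by (rule LIMSEQ_imp_Suc)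
  moreover have "mt (sym_diff (B (n - 1)) (B (m - 1))) \<le> (1 / 2) ^ n" if "1 \<le> n" "n < m" for n m
    using B[of "n - 1" "m - 1"] that by (cases n) auto
  ultimately show ?thesis unfolding delta_mu_tilde_def using A x
    by (auto intro!: exI[of _ "\<lambda>n. x (n - 1)"] exI[of _ "\<lambda>n. B (n - 1)"])
qed

text \<open>Abstracts from the tape: a word found at position \<open>i\<close> is treated as an
  arbitrary name of the one set \<open>B i\<close>.\<close>

definition input_name :: "'s str list \<Rightarrow> nat \<Rightarrow> 'a set \<Rightarrow> (nat \<Rightarrow> 'a set) \<Rightarrow> bool" where
  "input_name ps l A B \<longleftrightarrow> A \<in> sets M \<and> (\<forall>i. \<exists>y. word_at ps l i y) \<and> (\<forall>i y. word_at ps l i y \<longrightarrow> named y (B i)) \<and>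
     (\<forall>i j. i < j \<longrightarrow> mt (sym_diff (B i) (B j)) \<le> (1 / 2) ^ Suc i) \<and> (\<forall>i. mt (sym_diff (B i) A) \<le> (1 / 2) ^ Suc i)"

lemma input_nameE:
  assumes "input_name ps l A B"
  shows "A \<in> sets M" "\<exists>y. word_at ps l i y" "word_at ps l i y \<Longrightarrow> named y (B i)" "B i \<in> sets M"
    "i < j \<Longrightarrow> mt (sym_diff (B i) (B j)) \<le> (1 / 2) ^ Suc i" "mt (sym_diff (B i) A) \<le> (1 / 2) ^ Suc i"
proof -
  show "A \<in> sets M" "\<exists>y. word_at ps l i y" "word_at ps l i y \<Longrightarrow> named y (B i)"
    "i < j \<Longrightarrow> mt (sym_diff (B i) (B j)) \<le> (1 / 2) ^ Suc i" "mt (sym_diff (B i) A) \<le> (1 / 2) ^ Suc i"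
    using assms unfolding input_name_def by simp_all
  from assms obtain y where "word_at ps l i y" "named y (B i)" unfolding input_name_def by meson
  then show "B i \<in> sets M" using named_sets by simp
qed

lemma ex_input_name:
  assumes "A \<in> \<delta> p" "l < length ps" "ps ! l = p"
  shows "(\<exists>B. input_name ps l A B) \<and> of_kind Infinite_Str p \<and> A \<in> sets M"
proof -
  from assms(1) obtain x B where *: "A \<in> sets M" "p = Inf (seq_tuple x)" "\<And>i. \<alpha> (x i) = Some (B i)"
    "\<And>i j. i < j \<Longrightarrow> mt (sym_diff (B i) (B j)) \<le> (1 / 2) ^ Suc i"
    "\<And>i. mt (sym_diff (B i) A) \<le> (1 / 2) ^ Suc i" by (rule delta_nameE) blast
  have "word_at ps l i y \<longleftrightarrow> y = map sc (x i)" for i y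
    using word_at_seq_tuple[of l ps x] assms(2,3) *(2) by simp
  then have "input_name ps l A B" unfolding input_name_def named_def using * by auto
  then show ?thesis using * by auto
qed

section \<open>Set operations\<close>

text \<open>The machine may choose among several names of \<open>B k\<close>, but the sets are
  fixed, so the Cauchy and limit conditions do not depend on its choices.\<close>

lemma delta_machine:
  assumes "rel_re (\<lambda>(ps :: 's str list) p. V ps (fst p) (snd p))"
  obtains F :: "'s str list \<rightharpoonup> 's str" where "computable_string_fun F"
    "\<And>ps A B. list_all2 of_kind ks ps \<Longrightarrow> A \<in> sets M \<Longrightarrow> (\<And>k. \<exists>y. V ps k y) \<Longrightarrow>
       (\<And>k y. V ps k y \<Longrightarrow> named y (B k)) \<Longrightarrow>
       (\<And>i j. i < j \<Longrightarrow> mt (sym_diff (B i) (B j)) \<le> (1 / 2) ^ Suc i) \<Longrightarrow> (\<And>i. mt (sym_diff (B i) A) \<le> (1 / 2) ^ i) \<Longrightarrow>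
       (\<exists>q. F ps = Some q \<and> A \<in> \<delta> q)"
proof -
  from enumerating_machine_rel_re[OF assms, of ks]
  obtain F :: "'s str list \<rightharpoonup> 's str" where F: "computable_string_fun F"
    "\<And>ps. list_all2 of_kind ks ps \<and> (\<forall>k. \<exists>x :: 's list. V ps k (map sc x)) \<and>
       (\<forall>k w. V ps k w \<longrightarrow> w \<in> range (map sc :: 's list \<Rightarrow> nat list)) \<Longrightarrow>
       (\<exists>x. F ps = Some (Inf (seq_tuple x)) \<and> (\<forall>k. V ps k (map sc (x k))))" by blast
  show ?thesis
  proof (rule that[OF F(1)])
    fix ps A B
    assume *: "list_all2 of_kind ks ps" "A \<in> sets M" "\<And>k. \<exists>y. V ps k y" "\<And>k y. V ps k y \<Longrightarrow> named y (B k)"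
       "\<And>i j. i < j \<Longrightarrow> mt (sym_diff (B i) (B j)) \<le> (1 / 2) ^ Suc i" "\<And>i. mt (sym_diff (B i) A) \<le> (1 / 2) ^ i"
    have V: "\<exists>z. y = map sc z \<and> \<alpha> z = Some (B k)" if "V ps k y" for k y using *(4)[OF that] by (simp add: named_def)
    have ex: "\<exists>x :: 's list. V ps k (map sc x)" for k using *(3)[of k] V by metis
    have "w \<in> range (map sc :: 's list \<Rightarrow> nat list)" if "V ps k w" for k w using V[OF that] by auto
    then have "list_all2 of_kind ks ps \<and> (\<forall>k. \<exists>x :: 's list. V ps k (map sc x)) \<and>
       (\<forall>k w. V ps k w \<longrightarrow> w \<in> range (map sc :: 's list \<Rightarrow> nat list))" using *(1) ex by simp
    from F(2)[OF this] obtain x where x: "F ps = Some (Inf (seq_tuple x))" "\<And>k. V ps k (map sc (x k))"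
      by blast
    have "\<alpha> (x k) = Some (B k)" for k using V[OF x(2)[of k]] by auto
    from delta_nameI[OF *(2) this *(5,6)] have "A \<in> \<delta> (Inf (seq_tuple x))" .
    then show "\<exists>q. F ps = Some q \<and> A \<in> \<delta> q" using x(1) by blast
  qed
qed

lemma binary_operation_computable:
  assumes re: "re (\<lambda>p. G (fst p) (fst (snd p)) (snd (snd p)))" and G: "realizes G f"
    and f_sets: "\<And>A B. A \<in> sets M \<Longrightarrow> B \<in> sets M \<Longrightarrow> f A B \<in> sets M"
    and f_diff: "\<And>A B A' B'. sym_diff (f A B) (f A' B') \<subseteq> sym_diff A A' \<union> sym_diff B B'"
  shows "computable2 \<delta> \<delta> \<delta> (fun_on2 (sets M) (sets M) f)"
proof -
  define V where "V ps k y \<longleftrightarrow> (\<exists>u v. word_at ps 0 (Suc k) u \<and> word_at ps 1 (Suc k) v \<and> G u v y)" for ps :: "'s str list" and k y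
  have w: "rel_re (\<lambda>(ps :: 's str list) p. word_at ps 0 (fst p) (snd p))" "rel_re (\<lambda>(ps :: 's str list) p. word_at ps 1 (fst p) (snd p))"
    by (rule rel_re_word_at, simp)+
  have V_re: "rel_re (\<lambda>(ps :: 's str list) p. V ps (fst p) (snd p))"
    unfolding V_def by (intro rre rel_re_comp2[OF w(1)] rel_re_comp2[OF w(2)] rel_re_re re_comp3[OF re] cf)
  have Gx: "(\<exists>z. G x y z) \<and> (\<forall>z. G x y z \<longrightarrow> named z (f A B))" if "named x A" "named y B" for x y A B
    using G that unfolding realizes_def by blast
  show ?thesis
  proof (rule delta_machine[OF V_re, of "[Infinite_Str, Infinite_Str]"], goal_cases)
    case (1 F)
    note F = this
    show ?case unfolding computable2_def
    proof (intro exI[of _ F] conjI allI impI F(1))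
      fix p1 p2 A A'
      assume "A \<in> \<delta> p1 \<and> A' \<in> \<delta> p2 \<and> fun_on2 (sets M) (sets M) f A A' \<noteq> {}"
      then obtain B B' where B: "input_name [p1, p2] 0 A B" "input_name [p1, p2] 1 A' B'"
        and k: "of_kind Infinite_Str p1" "of_kind Infinite_Str p2"
        using ex_input_name[of A p1 0 "[p1, p2]"] ex_input_name[of A' p2 1 "[p1, p2]"] by auto
      note b = input_nameE[OF B(1)] and b' = input_nameE[OF B(2)]
      define E where "E i = f (B (Suc i)) (B' (Suc i))" for i
      \<comment> \<open>Two errors of at most \<open>(1 / 2) ^ Suc (Suc i)\<close> add up to the
        bound that is required at \<open>i\<close>; this is the purpose of the shift.\<close>
      have le: "mt (sym_diff (f X X') (f Y Y')) \<le> (1 / 2) ^ Suc i"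
        if "X \<in> sets M" "X' \<in> sets M" "Y \<in> sets M" "Y' \<in> sets M"
          "mt (sym_diff X Y) \<le> (1 / 2) ^ Suc (Suc i)" "mt (sym_diff X' Y') \<le> (1 / 2) ^ Suc (Suc i)" for X X' Y Y' i
      proof -
        have "mt (sym_diff (f X X') (f Y Y')) \<le> mt (sym_diff X Y) + mt (sym_diff X' Y')"
          using that(1-4) f_sets f_diff by (intro mt_subadditive) auto
        then show ?thesis using that(5,6) by simp
      qed
      have "\<exists>q. F [p1, p2] = Some q \<and> f A A' \<in> \<delta> q"
      proof (rule F(2)[where B = E])
        show "list_all2 of_kind [Infinite_Str, Infinite_Str] [p1, p2]" using k by simp
        show "f A A' \<in> sets M" using b(1) b'(1) f_sets by blast
        show "\<exists>y. V [p1, p2] i y" for i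
        proof -
          obtain u v where "word_at [p1, p2] 0 (Suc i) u" "word_at [p1, p2] 1 (Suc i) v" using b(2) b'(2) by blast
          then show ?thesis using Gx b(3) b'(3) unfolding V_def by blast
        qed
        show "named y (E i)" if "V [p1, p2] i y" for i y
          using that Gx b(3) b'(3) unfolding V_def E_def by blast
        show "mt (sym_diff (E i) (E j)) \<le> (1 / 2) ^ Suc i" if "i < j" for i j
          unfolding E_def using b(4) b'(4) b(5)[of "Suc i" "Suc j"] b'(5)[of "Suc i" "Suc j"] that by (intro le) auto
        show "mt (sym_diff (E i) (f A A')) \<le> (1 / 2) ^ i" for i
        proof -
          have "mt (sym_diff (E i) (f A A')) \<le> (1 / 2) ^ Suc i"
            unfolding E_def using b(1,4) b'(1,4) b(6)[of "Suc i"] b'(6)[of "Suc i"] by (intro le) auto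
          also have "\<dots> \<le> (1 / 2) ^ i" by simp
          finally show ?thesis .
        qed
      qed
      then show "\<exists>q. F [p1, p2] = Some q \<and> fun_on2 (sets M) (sets M) f A A' \<inter> \<delta> q \<noteq> {}"
        using b(1) b'(1) by (auto simp: fun_on2_def)
    qed
  qed
qed

text \<open>The complement of a ring element is not in the ring, because ring elements have finite
  measure and the space does not. The space is therefore replaced by a set of the exhausting
  sequence.\<close>

lemma complement_computable: "computable1 \<delta> \<delta> (fun_on (sets M) (\<lambda>A. space M - A))"
proof -
  define V where "V ps k y \<longleftrightarrow> (\<exists>u c. word_at ps 0 (Suc k) u \<and> C_code (k + 2) c \<and> diff_code c u y)" for ps :: "'s str list" and k y
  have w: "rel_re (\<lambda>(ps :: 's str list) p. word_at ps 0 (fst p) (snd p))" by (rule rel_re_word_at) simp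
  have V_re: "rel_re (\<lambda>(ps :: 's str list) p. V ps (fst p) (snd p))"
    unfolding V_def by (intro rre rel_re_comp2[OF w] rel_re_re[OF re_comp3[OF diff_code(1)]] rel_re_re[OF re_comp2[OF C_code(1)]] cf)
  have df: "(\<exists>z. diff_code x y z) \<and> (\<forall>z. diff_code x y z \<longrightarrow> named z (A - B))" if "named x A" "named y B" for x y A B
    using diff_code(2) that unfolding realizes_def by blast
  show ?thesis
  proof (rule delta_machine[OF V_re, of "[Infinite_Str]"], goal_cases)
    case (1 F)
    note F = this
    show ?case unfolding computable1_def
    proof (intro exI[of _ F] conjI allI impI F(1))
      fix p A
      assume "A \<in> \<delta> p \<and> fun_on (sets M) (\<lambda>A. space M - A) A \<noteq> {}"
      then obtain B where B: "input_name [p] 0 A B" and k: "of_kind Infinite_Str p"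
        using ex_input_name[of A p 0 "[p]"] by auto
      note b = input_nameE[OF B]
      \<comment> \<open>\<open>B (Suc i)\<close> is the component with number \<open>i + 2\<close>
        when counting from 1, so both indices agree. The missing part of the space and the error of
        the component are each at most \<open>(1 / 2) ^ (i + 2)\<close>.\<close>
      define E where "E i = C (i + 2) - B (Suc i)" for i
      have Bsp: "B i \<subseteq> space M" "A \<subseteq> space M" for i using b(1,4) sets.sets_into_space by blast+
      have le: "mt X \<le> (1 / 2) ^ Suc i"
        if "X \<subseteq> (space M - C (i + 2)) \<union> Y" "X \<in> sets M" "Y \<in> sets M" "mt Y \<le> (1 / 2) ^ Suc (Suc i)" for X Y i
      proof -
        have "mt X \<le> mt (space M - C (i + 2)) + mt Y"
          using that by (intro mt_subadditive) auto
        then show ?thesis using that(4) mt_compl_C[of "i + 2"] by simp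
      qed
      have "\<exists>q. F [p] = Some q \<and> space M - A \<in> \<delta> q"
      proof (rule F(2)[where B = E])
        show "list_all2 of_kind [Infinite_Str] [p]" using k by simp
        show "space M - A \<in> sets M" using b(1) by blast
        show "\<exists>y. V [p] i y" for i
        proof -
          obtain u where u: "word_at [p] 0 (Suc i) u" using b(2) by blast
          have "1 \<le> i + 2" by simp
          from C_code(2)[OF this] obtain c where c: "C_code (i + 2) c" by blast
          have "named c (C (i + 2))" using C_code(3) c by simp
          then show ?thesis using u c df b(3) unfolding V_def by blast
        qed
        show "named y (E i)" if Vy: "V [p] i y" for i y
        proof -
          obtain u c where u: "word_at [p] 0 (Suc i) u" and c: "C_code (i + 2) c" and y: "diff_code c u y"
            using Vy unfolding V_def by blast
          have "named c (C (i + 2))" using C_code(3) c by simp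
          then show ?thesis using u y df b(3) unfolding E_def by blast
        qed
        show "mt (sym_diff (E i) (E j)) \<le> (1 / 2) ^ Suc i" if "i < j" for i j
        proof (rule le)
          show "sym_diff (E i) (E j) \<subseteq> (space M - C (i + 2)) \<union> sym_diff (B (Suc i)) (B (Suc j))"
            unfolding E_def using sets.sets_into_space[OF C_sets[of "j + 2"]] C_le[of "i + 2" "j + 2"] that by auto
          show "mt (sym_diff (B (Suc i)) (B (Suc j))) \<le> (1 / 2) ^ Suc (Suc i)" by (rule b(5)) (use that in simp)
        qed (use b(4) in \<open>auto simp: E_def\<close>)
        show "mt (sym_diff (E i) (space M - A)) \<le> (1 / 2) ^ i" for i
        proof -
          have "mt (sym_diff (E i) (space M - A)) \<le> (1 / 2) ^ Suc i"
          proof (rule le)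
            show "sym_diff (E i) (space M - A) \<subseteq> (space M - C (i + 2)) \<union> sym_diff (B (Suc i)) A"
              unfolding E_def using sets.sets_into_space[OF C_sets[of "i + 2"]] Bsp by auto
            show "mt (sym_diff (B (Suc i)) A) \<le> (1 / 2) ^ Suc (Suc i)" using b(6) by blast
          qed (use b(1,4) in \<open>auto simp: E_def\<close>)
          also have "\<dots> \<le> (1 / 2) ^ i" by simp
          finally show ?thesis .
        qed
      qed
      then show "\<exists>q. F [p] = Some q \<and> fun_on (sets M) (\<lambda>A. space M - A) A \<inter> \<delta> q \<noteq> {}"
        using b(1) by (auto simp: fun_on_def)
    qed
  qed
qed


section \<open>Real-valued functions of names\<close>

lemma inter_codeD:
  assumes "named x A" "named y B" shows "\<exists>z. inter_code x y z" "inter_code x y z \<Longrightarrow> named z (A \<inter> B)"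
  using inter_code(2) assms unfolding realizes_def by blast+

text \<open>The truth value of \<open>P\<close> is the same for all names of the two sets, so
  guessing names is harmless.\<close>

lemma ex_D_inter_iff:
  assumes A: "named u A" and P: "\<And>d e. named d (D (Suc k)) \<Longrightarrow> named e (A \<inter> D (Suc k)) \<Longrightarrow> P d e \<longleftrightarrow> Q"
  shows "(\<exists>d e. D_code k d \<and> inter_code u d e \<and> P d e) \<longleftrightarrow> Q"
proof
  assume "\<exists>d e. D_code k d \<and> inter_code u d e \<and> P d e"
  then show Q using P D_code(2) inter_codeD(2)[OF A] by blast
next
  assume Q
  obtain d where d: "D_code k d" using D_code(1) by blast
  from D_code(2)[OF d] have d': "named d (D (Suc k))" .
  obtain e where "inter_code u d e" using inter_codeD(1)[OF A d'] by blast
  then show "\<exists>d e. D_code k d \<and> inter_code u d e \<and> P d e"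
    using P d d' inter_codeD(2)[OF A d'] \<open>Q\<close> by blast
qed

text \<open>With \<open>a\<close> the measure of the intersection and \<open>b\<close> that of the
  piece, \<open>i < weight * j\<close> means \<open>b * i * 2 ^ Suc k < a * j\<close>. This compares
  two reals and is tested through a separating rational \<open>s / l\<close>.\<close>

definition weight_lower :: "nat list \<Rightarrow> nat \<Rightarrow> nat \<Rightarrow> nat \<Rightarrow> bool" where
  "weight_lower u k i j \<longleftrightarrow> (\<exists>d e. D_code k d \<and> inter_code u d e \<and>
     (\<exists>s l. measure_upper d s (i * 2 ^ Suc k * l) \<and> measure_lower e s (j * l)))"

definition weight_upper :: "nat list \<Rightarrow> nat \<Rightarrow> nat \<Rightarrow> nat \<Rightarrow> bool" where
  "weight_upper u k i j \<longleftrightarrow> (\<exists>d e. D_code k d \<and> inter_code u d e \<and>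
     (\<exists>s l. measure_upper e s (j * l) \<and> measure_lower d s (i * 2 ^ Suc k * l)))"

lemma re_weight_lower: "re (\<lambda>p. weight_lower (fst p) (fst (snd p)) (fst (snd (snd p))) (snd (snd (snd p))))"
  unfolding weight_lower_def
  by (intro re re_comp2[OF re_D_code] re_comp3[OF inter_code(1)] re_comp3[OF measure_upper(1)] re_comp3[OF measure_lower(1)] cf)

lemma re_weight_upper: "re (\<lambda>p. weight_upper (fst p) (fst (snd p)) (fst (snd (snd p))) (snd (snd (snd p))))"
  unfolding weight_upper_def
  by (intro re re_comp2[OF re_D_code] re_comp3[OF inter_code(1)] re_comp3[OF measure_upper(1)] re_comp3[OF measure_lower(1)] cf)

lemma weight_eq: "weight A k = measure M (A \<inter> D (Suc k)) / (measure M (D (Suc k)) * 2 ^ Suc k)"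
  by (simp add: weight_def power_one_over)

lemma weight_lower: assumes "named u A" shows "weight_lower u k i j \<longleftrightarrow> real i < weight A k * real j"
  unfolding weight_lower_def
proof (rule ex_D_inter_iff[OF assms])
  fix d e assume de: "named d (D (Suc k))" "named e (A \<inter> D (Suc k))"
  let ?a = "measure M (A \<inter> D (Suc k))" and ?b = "measure M (D (Suc k))"
  have "(\<exists>s l. measure_upper d s (i * 2 ^ Suc k * l) \<and> measure_lower e s (j * l)) \<longleftrightarrow>
      (\<exists>s l :: nat. (?b * real i * 2 ^ Suc k) * real l < real s \<and> real s < (?a * real j) * real l)"
    unfolding measure_upper(2)[OF de(1)] measure_lower(2)[OF de(2)] by (simp add: ac_simps)
  also have "\<dots> \<longleftrightarrow> ?b * real i * 2 ^ Suc k < ?a * real j" by (rule nat_ratio_between_iff) simp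
  also have "\<dots> \<longleftrightarrow> real i < weight A k * real j"
    unfolding weight_eq using measure_D_pos[of k] by (simp add: field_simps)
  finally show "(\<exists>s l. measure_upper d s (i * 2 ^ Suc k * l) \<and> measure_lower e s (j * l)) \<longleftrightarrow> real i < weight A k * real j" .
qed

lemma weight_upper: assumes "named u A" shows "weight_upper u k i j \<longleftrightarrow> weight A k * real j < real i"
  unfolding weight_upper_def
proof (rule ex_D_inter_iff[OF assms])
  fix d e assume de: "named d (D (Suc k))" "named e (A \<inter> D (Suc k))"
  let ?a = "measure M (A \<inter> D (Suc k))" and ?b = "measure M (D (Suc k))"
  have "(\<exists>s l. measure_upper e s (j * l) \<and> measure_lower d s (i * 2 ^ Suc k * l)) \<longleftrightarrow>
      (\<exists>s l :: nat. (?a * real j) * real l < real s \<and> real s < (?b * real i * 2 ^ Suc k) * real l)"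
    unfolding measure_upper(2)[OF de(2)] measure_lower(2)[OF de(1)] by (simp add: ac_simps)
  also have "\<dots> \<longleftrightarrow> ?a * real j < ?b * real i * 2 ^ Suc k" by (rule nat_ratio_between_iff) simp
  also have "\<dots> \<longleftrightarrow> weight A k * real j < real i"
    unfolding weight_eq using measure_D_pos[of k] by (simp add: field_simps)
  finally show "(\<exists>s l. measure_upper e s (j * l) \<and> measure_lower d s (i * 2 ^ Suc k * l)) \<longleftrightarrow> weight A k * real j < real i" .
qed

definition partial_lower :: "nat list \<Rightarrow> nat \<Rightarrow> nat \<Rightarrow> nat \<Rightarrow> bool" where
  "partial_lower u N i j \<longleftrightarrow> (\<exists>n as. length as = N \<and>
     (\<forall>k<N. nth_or 0 as k = 0 \<or> weight_lower u k (nth_or 0 as k) n) \<and> i * n < sum_list as * j)"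

definition partial_upper :: "nat list \<Rightarrow> nat \<Rightarrow> nat \<Rightarrow> nat \<Rightarrow> bool" where
  "partial_upper u N i j \<longleftrightarrow> (\<exists>n bs. length bs = N \<and>
     (\<forall>k<N. weight_upper u k (nth_or 0 bs k) n) \<and> sum_list bs * j < i * n)"

lemma re_partial_lower: "re (\<lambda>p. partial_lower (fst p) (fst (snd p)) (fst (snd (snd p))) (snd (snd (snd p))))"
  unfolding partial_lower_def by (intro re re_comp4[OF re_weight_lower] re_decidable dc cf)

lemma re_partial_upper: "re (\<lambda>p. partial_upper (fst p) (fst (snd p)) (fst (snd (snd p))) (snd (snd (snd p))))"
  unfolding partial_upper_def by (intro re re_comp4[OF re_weight_upper] re_decidable dc cf)

lemma partial_lower: "named u A \<Longrightarrow> partial_lower u N i j \<longleftrightarrow> real i < (\<Sum>k<N. weight A k) * real j"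
  unfolding partial_lower_def by (simp only: weight_lower sum_lower_cut[OF weight_nonneg])

lemma partial_upper: "named u A \<Longrightarrow> partial_upper u N i j \<longleftrightarrow> (\<Sum>k<N. weight A k) * real j < real i"
  unfolding partial_upper_def by (simp only: weight_upper sum_upper_cut[OF weight_nonneg])

lemma word_at_re: "rel_re (\<lambda>(ps :: 's str list) p. word_at ps 0 (fst p) (snd p))"
  by (rule rel_re_word_at) simp

lemma ex_word_at_iff:
  assumes "input_name ps l A B" "\<And>y. named y (B m) \<Longrightarrow> P y \<longleftrightarrow> Q"
  shows "(\<exists>u. word_at ps l m u \<and> P u) \<longleftrightarrow> Q"
  using input_nameE(2,3)[OF assms(1), of m] assms(2) by blast

text \<open>The test of \<open>limit_lower_cut\<close> with error constant 2, applied to the first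
  \<open>n\<close> terms of the series for component \<open>n\<close>.\<close>

definition mt_lower :: "'s str list \<Rightarrow> nat \<Rightarrow> nat \<Rightarrow> bool" where
  "mt_lower ps i j \<longleftrightarrow> (\<exists>n u. word_at ps 0 n u \<and> partial_lower u n (i * 2 ^ n + 2 * j) (j * 2 ^ n))"

definition mt_upper :: "'s str list \<Rightarrow> nat \<Rightarrow> nat \<Rightarrow> bool" where
  "mt_upper ps i j \<longleftrightarrow> (\<exists>n u. word_at ps 0 n u \<and> partial_upper u n (i * 2 ^ n - 2 * j) (j * 2 ^ n))"

lemma rel_re_mt_lower: "rel_re (\<lambda>ps p. mt_lower ps (fst p) (snd p))"
  unfolding mt_lower_def
  by (intro rre rel_re_comp2[OF word_at_re] rel_re_re[OF re_comp4[OF re_partial_lower]] cf)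

lemma rel_re_mt_upper: "rel_re (\<lambda>ps p. mt_upper ps (fst p) (snd p))"
  unfolding mt_upper_def
  by (intro rre rel_re_comp2[OF word_at_re] rel_re_re[OF re_comp4[OF re_partial_upper]] cf)

text \<open>Cutting off the series costs at most \<open>(1 / 2) ^ n\<close> and replacing
  \<open>A\<close> by \<open>B n\<close> at most \<open>(1 / 2) ^ Suc n\<close>; the sum is rounded
  up to obtain a natural number as constant.\<close>

lemma partial_mt_diff:
  assumes "input_name ps l A B" shows "\<bar>(\<Sum>k<n. weight (B n) k) - mt A\<bar> \<le> real 2 / 2 ^ n"
proof -
  note b = input_nameE[OF assms]
  have "\<bar>mt (B n) - mt A\<bar> \<le> (1 / 2) ^ Suc n"
    using mt_diff_le[OF b(4,1)] b(6)[of n] by (rule order_trans)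
  moreover have "(1 / 2 :: real) ^ Suc n \<le> (1 / 2) ^ n" by simp
  moreover have "real 2 / 2 ^ n = 2 * (1 / 2) ^ n" by (simp add: power_one_over)
  ultimately show ?thesis using partial_le_mt[OF b(4), of n n] mt_le_partial[OF b(4), of n n] by linarith
qed

lemma mt_lower: assumes "input_name ps 0 A B" shows "mt_lower ps i j \<longleftrightarrow> real i < mt A * real j"
proof -
  have "mt_lower ps i j \<longleftrightarrow> (\<exists>n. real (i * 2 ^ n + 2 * j) < (\<Sum>k<n. weight (B n) k) * real (j * 2 ^ n))"
    unfolding mt_lower_def by (intro ex_cong1 ex_word_at_iff[OF assms] partial_lower)
  also have "\<dots> \<longleftrightarrow> real i < mt A * real j"
    using limit_lower_cut[of "\<lambda>n. \<Sum>k<n. weight (B n) k" "mt A" 2 i j, OF partial_mt_diff[OF assms]] by blast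
  finally show ?thesis .
qed

lemma mt_upper: assumes "input_name ps 0 A B" shows "mt_upper ps i j \<longleftrightarrow> mt A * real j < real i"
proof -
  have "mt_upper ps i j \<longleftrightarrow> (\<exists>n. (\<Sum>k<n. weight (B n) k) * real (j * 2 ^ n) < real (i * 2 ^ n - 2 * j))"
    unfolding mt_upper_def by (intro ex_cong1 ex_word_at_iff[OF assms] partial_upper)
  also have "\<dots> \<longleftrightarrow> mt A * real j < real i"
    using limit_upper_cut[of "\<lambda>n. \<Sum>k<n. weight (B n) k" "mt A" 2 j i, OF partial_mt_diff[OF assms]]
    by (simp add: sum_nonneg weight_nonneg)
  finally show ?thesis .
qed

lemma mu_tilde_computable: "computable1 \<delta> rho (fun_on (sets M) mt)"
proof -
  from rho_machine[OF rel_re_mt_lower rel_re_mt_upper, of "[Infinite_Str]"]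
  obtain F :: "'s str list \<rightharpoonup> 's str" where F: "computable_string_fun F"
    "\<And>ps x. list_all2 of_kind [Infinite_Str] ps \<and> x \<ge> 0 \<and> (\<forall>i j. mt_lower ps i j \<longleftrightarrow> real i < x * real j) \<and>
       (\<forall>i j. mt_upper ps i j \<longleftrightarrow> x * real j < real i) \<longrightarrow> (\<exists>q. F ps = Some q \<and> x \<in> rho q)" by blast
  show ?thesis unfolding computable1_def
  proof (intro exI[of _ F] conjI allI impI F(1))
    fix p A
    assume "A \<in> \<delta> p \<and> fun_on (sets M) mt A \<noteq> {}"
    then obtain B where B: "input_name [p] 0 A B" and k: "of_kind Infinite_Str p" and A: "A \<in> sets M"
      using ex_input_name[of A p 0 "[p]"] by auto
    have "\<exists>q. F [p] = Some q \<and> mt A \<in> rho q"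
      using F(2)[of "[p]" "mt A"] k mt_nonneg[OF A] mt_lower[OF B] mt_upper[OF B] by simp
    then show "\<exists>q. F [p] = Some q \<and> fun_on (sets M) mt A \<inter> rho q \<noteq> {}"
      using A by (auto simp: fun_on_def)
  qed
qed

text \<open>The factor \<open>measure M (C n)\<close> in the error bound is a real, so a natural
  upper bound \<open>b\<close> for it is guessed and certified by
  \<open>measure_upper c b 1\<close>. The error of component \<open>m\<close> is then at most
  \<open>b * 2 ^ n / 2 ^ m\<close>.\<close>

definition capped_lower :: "'s str list \<Rightarrow> nat \<Rightarrow> nat \<Rightarrow> nat \<Rightarrow> bool" where
  "capped_lower ps n i j \<longleftrightarrow> (\<exists>c b m u e. C_code n c \<and> measure_upper c b 1 \<and> word_at ps 0 m u \<and> inter_code u c e \<and>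
     measure_lower e (i * 2 ^ m + b * 2 ^ n * j) (j * 2 ^ m))"

definition capped_upper :: "'s str list \<Rightarrow> nat \<Rightarrow> nat \<Rightarrow> nat \<Rightarrow> bool" where
  "capped_upper ps n i j \<longleftrightarrow> (\<exists>c b m u e. C_code n c \<and> measure_upper c b 1 \<and> word_at ps 0 m u \<and> inter_code u c e \<and>
     measure_upper e (i * 2 ^ m - b * 2 ^ n * j) (j * 2 ^ m))"

lemma rel_re_capped_lower: "rel_re (\<lambda>ps p. capped_lower ps (fst p) (fst (snd p)) (snd (snd p)))"
  unfolding capped_lower_def
  by (intro rre rel_re_comp2[OF word_at_re] rel_re_re[OF re_comp2[OF C_code(1)]] rel_re_re[OF re_comp3[OF inter_code(1)]]
    rel_re_re[OF re_comp3[OF measure_upper(1)]] rel_re_re[OF re_comp3[OF measure_lower(1)]] cf)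

lemma rel_re_capped_upper: "rel_re (\<lambda>ps p. capped_upper ps (fst p) (fst (snd p)) (snd (snd p)))"
  unfolding capped_upper_def
  by (intro rre rel_re_comp2[OF word_at_re] rel_re_re[OF re_comp2[OF C_code(1)]] rel_re_re[OF re_comp3[OF inter_code(1)]]
    rel_re_re[OF re_comp3[OF measure_upper(1)]] rel_re_re[OF re_comp3[OF measure_lower(1)]] cf)

lemma capped_diff:
  assumes "input_name ps l A B" "measure M (C n) < real b"
  shows "\<bar>measure M (B m \<inter> C n) - measure M (A \<inter> C n)\<bar> \<le> real (b * 2 ^ n) / 2 ^ m"
proof -
  note b = input_nameE[OF assms(1)]
  have "mt (sym_diff (B m) A) \<le> (1 / 2) ^ m" using b(6)[of m] by (rule order_trans) simp
  then have "measure M (C n) * 2 ^ n * mt (sym_diff (B m) A) \<le> real b * 2 ^ n * (1 / 2) ^ m"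
    using assms(2) b(1,4) by (intro mult_mono mt_nonneg) auto
  then show ?thesis using measure_Int_C_diff_le[OF b(4,1), of m n] by (simp add: power_one_over)
qed

text \<open>For every admissible bound \<open>b\<close> the search over \<open>m\<close> has the
  same outcome \<open>X\<close>, so neither the choice of \<open>b\<close> nor that of the names
  matters, and both may be guessed.\<close>

lemma capped_aux:
  assumes B: "input_name ps 0 A B" and n: "n \<ge> 1"
    and P: "\<And>e b m. named e (B m \<inter> C n) \<Longrightarrow> measure M (C n) < real b \<Longrightarrow> P e b m \<longleftrightarrow> Q b m"
    and X: "\<And>b. measure M (C n) < real b \<Longrightarrow> (\<exists>m. Q b m) \<longleftrightarrow> X"
  shows "(\<exists>c b m u e. C_code n c \<and> measure_upper c b 1 \<and> word_at ps 0 m u \<and> inter_code u c e \<and> P e b m) \<longleftrightarrow> X"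
proof
  note b = input_nameE[OF B]
  {
    assume "\<exists>c b m u e. C_code n c \<and> measure_upper c b 1 \<and> word_at ps 0 m u \<and> inter_code u c e \<and> P e b m"
    then obtain c b m u e where *: "C_code n c" "measure_upper c b 1" "word_at ps 0 m u" "inter_code u c e" "P e b m" by blast
    have c: "named c (C n)" using C_code(3)[OF n] *(1) by blast
    have bd: "measure M (C n) < real b" using measure_upper(2)[OF c] *(2) by simp
    have "named e (B m \<inter> C n)" using inter_codeD(2)[OF b(3)[OF *(3)] c *(4)] .
    then show X using P bd *(5) X by blast
  }
  {
    assume "X"
    obtain b :: nat where bd: "measure M (C n) < real b" using reals_Archimedean2 by blast
    then obtain m where m: "Q b m" using X \<open>X\<close> by blast
    obtain c where c: "C_code n c" using C_code(2)[OF n] by blast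
    then have c': "named c (C n)" by (rule C_code(3)[OF n])
    obtain u where u: "word_at ps 0 m u" using b(2) by blast
    obtain e where e: "inter_code u c e" using inter_codeD(1)[OF b(3)[OF u] c'] by blast
    have "named e (B m \<inter> C n)" using inter_codeD(2)[OF b(3)[OF u] c' e] .
    then have "P e b m" using P bd m by blast
    moreover have "measure_upper c b 1" using measure_upper(2)[OF c'] bd by simp
    ultimately show "\<exists>c b m u e. C_code n c \<and> measure_upper c b 1 \<and> word_at ps 0 m u \<and> inter_code u c e \<and> P e b m"
      using c u e by blast
  }
qed

lemma capped_lower:
  assumes "input_name ps 0 A B" "n \<ge> 1" shows "capped_lower ps n i j \<longleftrightarrow> real i < measure M (A \<inter> C n) * real j"
  unfolding capped_lower_def
proof (rule capped_aux[OF assms measure_lower(2) limit_lower_cut[symmetric]])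
  show "\<bar>measure M (B m \<inter> C n) - measure M (A \<inter> C n)\<bar> \<le> real (b * 2 ^ n) / 2 ^ m"
    if "measure M (C n) < real b" for b m by (rule capped_diff[OF assms(1) that])
qed simp_all

lemma capped_upper:
  assumes "input_name ps 0 A B" "n \<ge> 1" shows "capped_upper ps n i j \<longleftrightarrow> measure M (A \<inter> C n) * real j < real i"
  unfolding capped_upper_def
proof (rule capped_aux[OF assms measure_upper(2) limit_upper_cut[symmetric]])
  show "\<bar>measure M (B m \<inter> C n) - measure M (A \<inter> C n)\<bar> \<le> real (b * 2 ^ n) / 2 ^ m"
    if "measure M (C n) < real b" for b m by (rule capped_diff[OF assms(1) that])
qed simp_all

lemma measure_lower_computable:
  "computable1 \<delta> rho_lower (fun_on (sets M) (\<lambda>A. enn2ereal (emeasure M A)))"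
proof -
  define L where "L ps i j \<longleftrightarrow> (\<exists>n. 1 \<le> n \<and> capped_lower ps n i j)" for ps i j
  have "rel_re (\<lambda>ps p. L ps (fst p) (snd p))"
    unfolding L_def by (intro rre rel_re_comp3[OF rel_re_capped_lower] rel_re_decidable dc cf)
  from rho_lower_machine[OF this, of "[Infinite_Str]"]
  obtain F :: "'s str list \<rightharpoonup> 's str" where F: "computable_string_fun F"
    "\<And>ps x. list_all2 of_kind [Infinite_Str] ps \<and> x \<ge> 0 \<and> (\<forall>i j. j > 0 \<longrightarrow> (L ps i j \<longleftrightarrow> ereal (real i / real j) < x)) \<longrightarrow>
       (\<exists>q. F ps = Some q \<and> x \<in> rho_lower q)" by blast
  show ?thesis unfolding computable1_def
  proof (intro exI[of _ F] conjI allI impI F(1))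
    fix p A
    assume "A \<in> \<delta> p \<and> fun_on (sets M) (\<lambda>A. enn2ereal (emeasure M A)) A \<noteq> {}"
    then obtain B where B: "input_name [p] 0 A B" and k: "of_kind Infinite_Str p" and A: "A \<in> sets M"
      using ex_input_name[of A p 0 "[p]"] by auto
    have "L [p] i j \<longleftrightarrow> ereal (real i / real j) < enn2ereal (emeasure M A)" if "j > 0" for i j
    proof -
      have "L [p] i j \<longleftrightarrow> (\<exists>n\<ge>1. real i / real j < measure M (A \<inter> C n))"
        unfolding L_def using capped_lower[OF B] that by (simp add: pos_divide_less_eq cong: conj_cong)
      then show ?thesis using less_emeasure_iff[OF A, of "real i / real j"] by simp
    qed
    then have "\<exists>q. F [p] = Some q \<and> enn2ereal (emeasure M A) \<in> rho_lower q"
      using F(2)[of "[p]" "enn2ereal (emeasure M A)"] k by simp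
    then show "\<exists>q. F [p] = Some q \<and> fun_on (sets M) (\<lambda>A. enn2ereal (emeasure M A)) A \<inter> rho_lower q \<noteq> {}"
      using A by (auto simp: fun_on_def)
  qed
qed

lemma capped_measure_computable:
  "computable2 \<delta> nu_nat rho (fun_on2 (sets M) UNIV (\<lambda>A n. measure M (A \<inter> C n)))"
proof -
  define L where "L ps i j \<longleftrightarrow> (\<exists>n. input_nat ps n \<and> 1 \<le> n \<and> capped_lower ps n i j)" for ps i j
  define U where "U ps i j \<longleftrightarrow> (\<exists>n. input_nat ps n \<and> (n = 0 \<and> 0 < i \<or> 1 \<le> n \<and> capped_upper ps n i j))" for ps i j
  have "rel_re (\<lambda>ps p. L ps (fst p) (snd p))"
    unfolding L_def by (intro rre rel_re_comp[OF rel_re_input_nat] rel_re_comp3[OF rel_re_capped_lower] rel_re_decidable dc cf)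
  moreover have "rel_re (\<lambda>ps p. U ps (fst p) (snd p))"
    unfolding U_def by (intro rre rel_re_comp[OF rel_re_input_nat] rel_re_comp3[OF rel_re_capped_upper] rel_re_decidable dc cf)
  ultimately obtain F :: "'s str list \<rightharpoonup> 's str" where F: "computable_string_fun F"
    "\<And>ps x. list_all2 of_kind [Infinite_Str, Finite_Str] ps \<and> x \<ge> 0 \<and> (\<forall>i j. L ps i j \<longleftrightarrow> real i < x * real j) \<and>
       (\<forall>i j. U ps i j \<longleftrightarrow> x * real j < real i) \<longrightarrow> (\<exists>q. F ps = Some q \<and> x \<in> rho q)"
    using rho_machine[of L U "[Infinite_Str, Finite_Str]"] by blast
  show ?thesis unfolding computable2_def
  proof (intro exI[of _ F] conjI allI impI F(1))
    fix p1 p2 :: "'s str" and A n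
    assume *: "A \<in> \<delta> p1 \<and> n \<in> nu_nat p2 \<and> fun_on2 (sets M) UNIV (\<lambda>A n. measure M (A \<inter> C n)) A n \<noteq> {}"
    then obtain w where w: "p2 = Fin w" "nat_word w = Some n"
      by (cases p2) (auto simp: nu_nat_def notation_of_def)
    from * obtain B where B: "input_name [p1, p2] 0 A B" and k: "of_kind Infinite_Str p1" and A: "A \<in> sets M"
      using ex_input_name[of A p1 0 "[p1, p2]"] by auto
    have nat: "input_nat [p1, p2] m \<longleftrightarrow> m = n" for m unfolding w(1) by (rule input_nat_iff[OF w(2)])
    have "L [p1, p2] i j \<longleftrightarrow> real i < measure M (A \<inter> C n) * real j" for i j
      unfolding L_def nat using capped_lower[OF B, of n] C_0 by (cases "n = 0") auto
    moreover have "U [p1, p2] i j \<longleftrightarrow> measure M (A \<inter> C n) * real j < real i" for i j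
      unfolding U_def nat using capped_upper[OF B, of n] C_0 by (cases "n = 0") auto
    ultimately have "\<exists>q. F [p1, p2] = Some q \<and> measure M (A \<inter> C n) \<in> rho q"
      using F(2)[of "[p1, p2]" "measure M (A \<inter> C n)"] k w(1) by simp
    then show "\<exists>q. F [p1, p2] = Some q \<and> fun_on2 (sets M) UNIV (\<lambda>A n. measure M (A \<inter> C n)) A n \<inter> rho q \<noteq> {}"
      using A by (auto simp: fun_on2_def)
  qed
qed

end

theorem theorem5p5:
  fixes M :: "'a measure"
    and R :: "'a set set"
    and \<alpha> :: "('s::{finite, zero_neq_one}) list \<rightharpoonup> 'a set"
    and C D :: "nat \<Rightarrow> 'a set"
  assumes "infinite_computable_measure_space M R \<alpha> C D"
  shows "computable1 (delta_mu_tilde M \<alpha> D) rho (fun_on (sets M) (mu_tilde M D)) \<and>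
         computable1 (delta_mu_tilde M \<alpha> D) rho_lower
           (fun_on (sets M) (\<lambda>A. enn2ereal (emeasure M A))) \<and>
         computable2 (delta_mu_tilde M \<alpha> D) nu_nat rho
           (fun_on2 (sets M) UNIV (\<lambda>A n. measure M (A \<inter> C n))) \<and>
         computable2 (delta_mu_tilde M \<alpha> D) (delta_mu_tilde M \<alpha> D) (delta_mu_tilde M \<alpha> D)
           (fun_on2 (sets M) (sets M) (\<lambda>A B. A \<union> B)) \<and>
         computable2 (delta_mu_tilde M \<alpha> D) (delta_mu_tilde M \<alpha> D) (delta_mu_tilde M \<alpha> D)
           (fun_on2 (sets M) (sets M) (\<lambda>A B. A \<inter> B)) \<and>
         computable2 (delta_mu_tilde M \<alpha> D) (delta_mu_tilde M \<alpha> D) (delta_mu_tilde M \<alpha> D)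
           (fun_on2 (sets M) (sets M) (\<lambda>A B. A - B)) \<and>
         computable1 (delta_mu_tilde M \<alpha> D) (delta_mu_tilde M \<alpha> D)
           (fun_on (sets M) (\<lambda>A. space M - A))"
proof -
  interpret infinite_computable_measure_space M R \<alpha> C D by fact
  show ?thesis
    using mu_tilde_computable measure_lower_computable capped_measure_computable complement_computable
      binary_operation_computable[OF union_code] binary_operation_computable[OF inter_code]
      binary_operation_computable[OF diff_code]
    by (auto simp: sets.Un sets.Int sets.Diff)
qed

end
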